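(* Assume that the following holds: for every direct product $S=S_1\times\dots\times S_r$ ($r\ge 1$) of nonabelian finite simple groups, every nontrivial automorphism $\varphi$ of $S$ that transitively permutes the factors $S_1,\dots,S_r$, and every positive integer $n$, one has $E_{S,n}(\varphi)=S$. Then for every finite group $G$, every $g\in G$ and every positive integer $n$: (1) if the generalized Fitting height of $E_n(g)$ is equal to $k$, then $g\in F^*_{k+1}(G)$; (2) if the nonsoluble length of $E_n(g)$ is equal to $k$, then $g\in R_k(G)$.
   Context: Commutators are left-normed: $[a_1,a_2,\dots,a_r]=[\dots[[a_1,a_2],a_3],\dots,a_r]$, with $[a,b]=a^{-1}b^{-1}ab$. For an automorphism $\varphi$ of a group $S$, $E_{S,n}(\varphi)=\langle [x,\underbrace{\varphi,\dots,\varphi}_{n}]\mid x\in S\rangle$, where commutators are taken in the semidirect product $S\langle\varphi\rangle$ (so $[x,\varphi]=x^{-1}x^{\varphi}$). For $g\in G$, $E_n(g)=\langle [x,\underbrace{g,\dots,g}_{n}]\mid x\in G\rangle$. For a finite group $H$, the generalized Fitting subgroup $F^*(H)$ is the product of the Fitting subgroup $F(H)$ and all subnormal quasisimple subgroups of $H$ (a group is quasisimple if it is perfect and its quotient by its centre is nonabelian simple). The generalized Fitting series is $F^*_0(H)=1$, and $F^*_{i+1}(H)$ is the full inverse image of $F^*(H/F^*_i(H))$. The generalized Fitting height of $H$ is the least $h$ such that $F^*_h(H)=H$. The nonsoluble length $\lambda(H)$ of a finite group $H$ is the minimum number of nonsoluble factors in a normal series of $H$ each of whose factors either is soluble or is a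 direct product of nonabelian simple groups. $R_i(G)$ denotes the largest normal subgroup of $G$ of nonsoluble length at most $i$. *)

theory Defs
  imports "HOL-Algebra.Algebra"
begin

definition group_comm :: "('a, 'b) monoid_scheme \<Rightarrow> 'a \<Rightarrow> 'a \<Rightarrow> 'a" where
  "group_comm G a b = inv\<^bsub>G\<^esub> a \<otimes>\<^bsub>G\<^esub> inv\<^bsub>G\<^esub> b \<otimes>\<^bsub>G\<^esub> a \<otimes>\<^bsub>G\<^esub> b"

text \<open>The left-normed commutator \<open>[x, g, \<dots>, g]\<close> with \<open>n\<close> entries \<open>g\<close>.\<close>

primrec engel_comm :: "('a, 'b) monoid_scheme \<Rightarrow> 'a \<Rightarrow> 'a \<Rightarrow> nat \<Rightarrow> 'a" where
  "engel_comm G x g 0 = x"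
| "engel_comm G x g (Suc n) = group_comm G (engel_comm G x g n) g"

definition engel_subgroup :: "('a, 'b) monoid_scheme \<Rightarrow> nat \<Rightarrow> 'a \<Rightarrow> 'a set" where
  "engel_subgroup G n g = generate G {engel_comm G x g n |x. x \<in> carrier G}"

text \<open>
  For an automorphism \<open>\<phi>\<close> of \<open>S\<close>, the same commutators in the semidirect product of \<open>S\<close>
  with \<open>\<langle>\<phi>\<rangle>\<close>. There \<open>u\<^sup>\<phi> = \<phi> u\<close>, hence \<open>[u, \<phi>] = u\<^sup>-\<^sup>1 u\<^sup>\<phi>\<close>, which lies in \<open>S\<close> again.
\<close>

primrec aut_engel_comm :: "('a, 'b) monoid_scheme \<Rightarrow> 'a \<Rightarrow> ('a \<Rightarrow> 'a) \<Rightarrow> nat \<Rightarrow> 'a" where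
  "aut_engel_comm S x \<phi> 0 = x"
| "aut_engel_comm S x \<phi> (Suc n) =
     inv\<^bsub>S\<^esub> (aut_engel_comm S x \<phi> n) \<otimes>\<^bsub>S\<^esub> \<phi> (aut_engel_comm S x \<phi> n)"

definition aut_engel_subgroup :: "('a, 'b) monoid_scheme \<Rightarrow> nat \<Rightarrow> ('a \<Rightarrow> 'a) \<Rightarrow> 'a set" where
  "aut_engel_subgroup S n \<phi> = generate S {aut_engel_comm S x \<phi> n |x. x \<in> carrier S}"

text \<open>\<^const>\<open>simple_group\<close> requires \<open>order G > 1\<close>, where \<^const>\<open>order\<close> is a \<^const>\<open>card\<close>;
  so it only admits finite groups.\<close>

definition nonabelian_simple :: "('a, 'b) monoid_scheme \<Rightarrow> bool" where
  "nonabelian_simple G \<longleftrightarrow> simple_group G \<and> \<not> comm_group G"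

definition direct_factor :: "'i set \<Rightarrow> ('i \<Rightarrow> ('a, 'b) monoid_scheme) \<Rightarrow> 'i \<Rightarrow> ('i \<Rightarrow> 'a) set" where
  "direct_factor I T i =
     {x \<in> carrier (product_group I T). \<forall>j\<in>I - {i}. x j = \<one>\<^bsub>T j\<^esub>}"

text \<open>\<open>\<phi>\<close> maps factors to factors, and \<open>\<langle>\<phi>\<rangle>\<close> acts transitively on them; nonnegative powers
  suffice because the set of factors is finite.\<close>

definition permutes_factors_transitively ::
    "nat \<Rightarrow> (nat \<Rightarrow> ('a, 'b) monoid_scheme) \<Rightarrow> ((nat \<Rightarrow> 'a) \<Rightarrow> (nat \<Rightarrow> 'a)) \<Rightarrow> bool" where
  "permutes_factors_transitively r T \<phi> \<longleftrightarrow>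
     (\<forall>i<r. \<exists>j<r. \<phi> ` direct_factor {..<r} T i = direct_factor {..<r} T j) \<and>
     (\<forall>i<r. \<forall>j<r. \<exists>m. (\<phi> ^^ m) ` direct_factor {..<r} T i = direct_factor {..<r} T j)"

text \<open>Taking the simple groups on the same carrier type as \<open>K\<close> is no restriction, as the
  direct factors of \<open>K\<close> are subgroups of \<open>K\<close>.\<close>

definition direct_product_of_nonabelian_simples :: "('a, 'b) monoid_scheme \<Rightarrow> bool" where
  "direct_product_of_nonabelian_simples K \<longleftrightarrow>
     (\<exists>(r :: nat) (T :: nat \<Rightarrow> 'a monoid).
        (\<forall>i<r. nonabelian_simple (T i)) \<and> K \<cong> product_group {..<r} T)"

primrec lower_central :: "('a, 'b) monoid_scheme \<Rightarrow> nat \<Rightarrow> 'a set" where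
  "lower_central G 0 = carrier G"
| "lower_central G (Suc i) =
     generate G {group_comm G x y |x y. x \<in> lower_central G i \<and> y \<in> carrier G}"

definition nilpotent_group :: "('a, 'b) monoid_scheme \<Rightarrow> bool" where
  "nilpotent_group G \<longleftrightarrow> (\<exists>c. lower_central G c = {\<one>\<^bsub>G\<^esub>})"

text \<open>Here and for the generalized Fitting subgroup, the product of a family of subgroups is
  rendered as the subgroup they generate.\<close>

definition fitting_subgroup :: "('a, 'b) monoid_scheme \<Rightarrow> 'a set" where
  "fitting_subgroup G = generate G (\<Union>{N. N \<lhd> G \<and> nilpotent_group (G\<lparr>carrier := N\<rparr>)})"

inductive subnormal :: "('a, 'b) monoid_scheme \<Rightarrow> 'a set \<Rightarrow> bool" for G where
  self: "subnormal G (carrier G)"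
| step: "subnormal G K \<Longrightarrow> L \<lhd> G\<lparr>carrier := K\<rparr> \<Longrightarrow> subnormal G L"

definition group_center :: "('a, 'b) monoid_scheme \<Rightarrow> 'a set" where
  "group_center G = {z \<in> carrier G. \<forall>x\<in>carrier G. z \<otimes>\<^bsub>G\<^esub> x = x \<otimes>\<^bsub>G\<^esub> z}"

definition quasisimple :: "('a, 'b) monoid_scheme \<Rightarrow> bool" where
  "quasisimple Q \<longleftrightarrow>
     derived Q (carrier Q) = carrier Q \<and> nonabelian_simple (Q Mod group_center Q)"

definition gen_fitting_subgroup :: "('a, 'b) monoid_scheme \<Rightarrow> 'a set" where
  "gen_fitting_subgroup G =
     generate G (fitting_subgroup G \<union> \<Union>{Q. subnormal G Q \<and> quasisimple (G\<lparr>carrier := Q\<rparr>)})"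

primrec gen_fitting_series :: "('a, 'b) monoid_scheme \<Rightarrow> nat \<Rightarrow> 'a set" where
  "gen_fitting_series G 0 = {\<one>\<^bsub>G\<^esub>}"
| "gen_fitting_series G (Suc i) =
     {x \<in> carrier G. gen_fitting_series G i #>\<^bsub>G\<^esub> x
                       \<in> gen_fitting_subgroup (G Mod gen_fitting_series G i)}"

text \<open>Meant for finite groups, for which the series reaches the whole group.\<close>

definition gen_fitting_height :: "('a, 'b) monoid_scheme \<Rightarrow> nat" where
  "gen_fitting_height G = (LEAST h. gen_fitting_series G h = carrier G)"

definition normal_series :: "('a, 'b) monoid_scheme \<Rightarrow> nat \<Rightarrow> (nat \<Rightarrow> 'a set) \<Rightarrow> bool" where
  "normal_series G m N \<longleftrightarrow>
     N 0 = {\<one>\<^bsub>G\<^esub>} \<and> N m = carrier G \<and> (\<forall>i\<le>m. N i \<lhd> G) \<and> (\<forall>i<m. N i \<subseteq> N (Suc i))"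

definition series_factor :: "('a, 'b) monoid_scheme \<Rightarrow> (nat \<Rightarrow> 'a set) \<Rightarrow> nat \<Rightarrow> 'a set monoid" where
  "series_factor G N i = G\<lparr>carrier := N (Suc i)\<rparr> Mod N i"

text \<open>Meant for finite groups, for which the minimum is over a nonempty set.\<close>

definition nonsoluble_length :: "('a, 'b) monoid_scheme \<Rightarrow> nat" where
  "nonsoluble_length G =
     (LEAST l. \<exists>m N. normal_series G m N \<and>
        (\<forall>i<m. solvable (series_factor G N i) \<or>
               direct_product_of_nonabelian_simples (series_factor G N i)) \<and>
        l = card {i. i < m \<and> \<not> solvable (series_factor G N i)})"

text \<open>\<open>GREATEST\<close> refers to inclusion.\<close>

definition nonsoluble_radical :: "('a, 'b) monoid_scheme \<Rightarrow> nat \<Rightarrow> 'a set" where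
  "nonsoluble_radical G i =
     (GREATEST N. N \<lhd> G \<and> nonsoluble_length (G\<lparr>carrier := N\<rparr>) \<le> i)"

end

theory Submission
  imports Defs
begin

text \<open>
  Let \<open>K\<close> be a minimal subnormal subgroup of \<open>G\<close> containing \<open>g\<close>; then no proper normal subgroup of
  \<open>K\<close> contains \<open>g\<close>. The main point is that \<open>K = \<langle>E, g\<rangle>\<close> for the Engel subgroup \<open>E\<close> of \<open>g\<close> in \<open>K\<close>.
  To see this, put \<open>L = \<langle>E, g\<rangle>\<close>, which is normalized by the centralizer of \<open>g\<close>, and descend along the
  chief factors \<open>V\<close> of \<open>K\<close>, assuming \<open>K = LV\<close>. If \<open>V\<close> is nonabelian, then each of its simple factors
  either commutes with \<open>g\<close> or, by the hypothesis applied to its \<open>g\<close>-orbit, lies in \<open>E\<close>; so \<open>V\<close>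
  normalizes \<open>L\<close>. If \<open>V\<close> is abelian, then \<open>V \<le> E\<close> or \<open>V\<close> is central. In each case \<open>L\<close> is normal in
  \<open>K\<close>, and therefore \<open>L = K\<close>.

  Thus \<open>E\<close> is subnormal in \<open>G\<close>, it is contained in \<open>E\<^sub>n(g)\<close>, and \<open>K/E\<close> is cyclic. The terms of the
  generalized Fitting series, and of a canonical series that computes the nonsoluble length, meet
  each subnormal subgroup in its own corresponding term. So a bound for \<open>E\<^sub>n(g)\<close> passes down to \<open>E\<close>,
  and from there up to \<open>K\<close> and into \<open>G\<close>.
\<close>

section \<open>Groups, cosets and subnormal subgroups\<close>

text \<open>The obstacle is that \<open>E_n(g)\<close> need not be subnormal in \<open>G\<close>, so
  information about it says nothing directly about normal subgroups of \<open>G\<close>. The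
  subgroup \<open>E\<close> is the link: being subnormal in \<open>G\<close>, it is also subnormal
  in \<open>E_n(g)\<close>, and both comparisons run through subgroups on which the series restrict
  well. Both claims are treated together by isolating, under the name \<open>radical\<close>, three
  closure properties that survive the passage to preimages in quotients. The two series are iterates
  of just two radicals, the generalized Fitting subgroup and the soluble radical. The difference
  between \<open>k + 1\<close> and \<open>k\<close> comes from \<open>K/E\<close>: an abelian
  quotient costs one more generalized Fitting layer, whereas the terms of the nonsoluble series
  absorb soluble quotients. That series alternates generalized Fitting layers with soluble radicals
  because the generalized Fitting subgroup of a group with trivial soluble radical is a direct
  product of nonabelian simple groups.\<close>

abbreviation restrict_carrier :: "('a, 'b) monoid_scheme \<Rightarrow> 'a set \<Rightarrow> ('a, 'b) monoid_scheme"
    (infixl "\<down>" 62) where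
  "G \<down> K \<equiv> G\<lparr>carrier := K\<rparr>"

lemma finite_subgroup: "subgroup K G \<Longrightarrow> finite (carrier G) \<Longrightarrow> finite K"
  using finite_subset subgroup.subset by metis

lemma normal_imp_subset: "N \<lhd> G \<Longrightarrow> N \<subseteq> carrier G"
  by (rule subgroup.subset[OF normal_imp_subgroup])

lemma (in group) inv_cancel_left [simp]:
  "x \<in> carrier G \<Longrightarrow> y \<in> carrier G \<Longrightarrow> inv x \<otimes> (x \<otimes> y) = y"
  "x \<in> carrier G \<Longrightarrow> y \<in> carrier G \<Longrightarrow> x \<otimes> (inv x \<otimes> y) = y"
  by (simp_all flip: m_assoc)

lemmas (in group) group_word = m_assoc inv_mult_group

lemma (in group) subgroup_restrict_iff:
  assumes "subgroup K G"
  shows "subgroup N (G \<down> K) \<longleftrightarrow> subgroup N G \<and> N \<subseteq> K"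
proof
  assume N: "subgroup N (G \<down> K)"
  then show "subgroup N G \<and> N \<subseteq> K"
    using incl_subgroup[OF assms N] subgroup.subset[OF N] by simp
next
  assume "subgroup N G \<and> N \<subseteq> K"
  then show "subgroup N (G \<down> K)"
    using subgroup_incl[OF _ assms] by blast
qed

lemma (in group) normal_restrict_iff:
  assumes "subgroup K G"
  shows "N \<lhd> (G \<down> K) \<longleftrightarrow>
    subgroup N G \<and> N \<subseteq> K \<and> (\<forall>k\<in>K. \<forall>x\<in>N. k \<otimes> x \<otimes> inv k \<in> N)"
proof -
  interpret K: group "G \<down> K"
    using assms by (rule subgroup_imp_group)
  show ?thesis
    unfolding K.normal_inv_iff subgroup_restrict_iff[OF assms] using assms by auto
qed

lemma (in group) normal_conjD:
  assumes "N \<lhd> G" "x \<in> N" "g \<in> carrier G"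
  shows "g \<otimes> x \<otimes> inv g \<in> N" "inv g \<otimes> x \<otimes> g \<in> N"
  using normal.inv_op_closed2[OF assms(1,3,2)] normal.inv_op_closed1[OF assms(1,3,2)] by auto

lemma (in group) normal_subgroup_restrict:
  assumes "N \<lhd> G" "subgroup K G" "N \<subseteq> K"
  shows "N \<lhd> (G \<down> K)"
  using assms by (auto simp: normal_restrict_iff normal_inv_iff subgroup.mem_carrier)

lemma (in group) normal_Int_restrict:
  assumes "N \<lhd> G" "subgroup K G"
  shows "N \<inter> K \<lhd> (G \<down> K)"
  using assms subgroups_Inter_pair[of N K]
  by (auto simp: normal_restrict_iff normal_inv_iff subgroup.mem_carrier subgroup.m_closed subgroup.m_inv_closed)

lemma (in group) normal_generate_Un:
  assumes "M \<lhd> G" "N \<lhd> G"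
  shows "generate G (M \<union> N) \<lhd> G"
proof (rule normal_generateI)
  show "M \<union> N \<subseteq> carrier G"
    using assms normal_imp_subgroup subgroup.subset by blast
qed (use assms normal_conjD in blast)

lemma (in group) generate_Un_normal:
  assumes "subgroup L G" "N \<lhd> G"
  shows "generate G (L \<union> N) = L <#> N"
proof (rule generateI[symmetric])
  show "subgroup (L <#> N) G"
    using assms by (metis mult_norm_subgroup normal.axioms(1) commut_normal)
  have [simp]: "L \<subseteq> carrier G" "N \<subseteq> carrier G" "\<one> \<in> L" "\<one> \<in> N"
    using assms subgroup.subset normal_imp_subgroup subgroup.one_closed by blast+
  show "L \<union> N \<subseteq> L <#> N"
  proof
    fix x assume "x \<in> L \<union> N"
    then consider "x \<in> L" | "x \<in> N" by blast
    then show "x \<in> L <#> N"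
    proof cases
      case 1
      then have "x = x \<otimes> \<one>" using subsetD[OF \<open>L \<subseteq> carrier G\<close> 1] by simp
      with 1 show ?thesis unfolding set_mult_def using \<open>\<one> \<in> N\<close> by blast
    next
      case 2
      then have "x = \<one> \<otimes> x" using subsetD[OF \<open>N \<subseteq> carrier G\<close> 2] by simp
      with 2 show ?thesis unfolding set_mult_def using \<open>\<one> \<in> L\<close> by blast
    qed
  qed
  show "L <#> N \<subseteq> K" if "subgroup K G" "L \<union> N \<subseteq> K" for K
    using that by (auto simp: set_mult_def intro!: subgroup.m_closed[OF that(1)])
qed

lemma (in group) mult_normal_decomp:
  assumes "subgroup L G" "N \<lhd> G" "x \<in> generate G (L \<union> N)"
  obtains l v where "l \<in> L" "v \<in> N" "x = l \<otimes> v"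
  using assms generate_Un_normal unfolding set_mult_def by blast

text \<open>Two passes with centralizers: the centralizer of \<open>B\<close> is a subgroup
  containing \<open>A\<close>, hence \<open>generate G A\<close>; then the centralizer of
  \<open>generate G A\<close> contains \<open>B\<close>, hence \<open>generate G B\<close>.\<close>

lemma (in group) generate_commute:
  assumes "A \<subseteq> carrier G" "B \<subseteq> carrier G" "\<And>x y. x \<in> A \<Longrightarrow> y \<in> B \<Longrightarrow> x \<otimes> y = y \<otimes> x"
    and "x \<in> generate G A" "y \<in> generate G B"
  shows "x \<otimes> y = y \<otimes> x"
proof -
  have sub: "subgroup {x \<in> carrier G. \<forall>y\<in>B. x \<otimes> y = y \<otimes> x} G" if "B \<subseteq> carrier G" for B
  proof (rule subgroupI)
    fix a assume a: "a \<in> {x \<in> carrier G. \<forall>y\<in>B. x \<otimes> y = y \<otimes> x}"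
    show "inv a \<in> {x \<in> carrier G. \<forall>y\<in>B. x \<otimes> y = y \<otimes> x}"
    proof safe
      fix y assume y: "y \<in> B"
      with a that have [simp]: "a \<in> carrier G" "y \<in> carrier G" and "a \<otimes> y = y \<otimes> a" by auto
      then have "inv a \<otimes> (a \<otimes> y) \<otimes> inv a = inv a \<otimes> (y \<otimes> a) \<otimes> inv a" by simp
      then show "inv a \<otimes> y = y \<otimes> inv a" by (simp add: m_assoc)
    qed (use a in auto)
    fix b assume b: "b \<in> {x \<in> carrier G. \<forall>y\<in>B. x \<otimes> y = y \<otimes> x}"
    show "a \<otimes> b \<in> {x \<in> carrier G. \<forall>y\<in>B. x \<otimes> y = y \<otimes> x}"
    proof safe
      fix y assume y: "y \<in> B"
      with a b that have [simp]: "a \<in> carrier G" "b \<in> carrier G" "y \<in> carrier G"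
        and e: "a \<otimes> y = y \<otimes> a" "b \<otimes> y = y \<otimes> b" by auto
      have "a \<otimes> b \<otimes> y = a \<otimes> y \<otimes> b" using e(2) by (simp add: m_assoc)
      then show "a \<otimes> b \<otimes> y = y \<otimes> (a \<otimes> b)" by (simp add: e flip: m_assoc)
    qed (use a b in auto)
  qed (use that in \<open>auto intro!: exI[of _ \<one>]\<close>)
  have 1: "x \<in> carrier G \<and> (\<forall>y\<in>B. x \<otimes> y = y \<otimes> x)" if "x \<in> generate G A" for x
    using generate_subgroup_incl[OF _ sub[OF assms(2)], of A] assms that by blast
  have "B \<subseteq> {z \<in> carrier G. \<forall>y\<in>generate G A. z \<otimes> y = y \<otimes> z}"
    using 1 assms(2) by auto
  from generate_subgroup_incl[OF this sub[OF generate_incl[OF assms(1)]]]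
  show ?thesis using assms(4,5) by auto
qed

lemma (in group) subgroup_commute:
  assumes "B \<subseteq> carrier G"
  shows "subgroup {x \<in> carrier G. \<forall>y\<in>B. x \<otimes> y = y \<otimes> x} G" (is "subgroup ?C G")
proof -
  have "generate G ?C \<subseteq> ?C"
  proof (intro subsetI CollectI conjI ballI)
    fix x assume x: "x \<in> generate G ?C"
    show "x \<in> carrier G" by (rule generate_in_carrier[OF _ x]) auto
    fix y assume "y \<in> B"
    show "x \<otimes> y = y \<otimes> x"
      by (rule generate_commute[OF _ assms _ x generate.incl[OF \<open>y \<in> B\<close>]]) auto
  qed
  then have "generate G ?C = ?C" using generate.incl[of _ ?C G] by blast
  then show ?thesis using generate_is_subgroup[of ?C] by fastforce
qed

lemma (in group) subnormal_imp_subgroup: "subnormal G K \<Longrightarrow> subgroup K G"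
  by (induction rule: subnormal.induct) (auto simp: subgroup_self normal_restrict_iff)

lemma normal_imp_subnormal:
  assumes "N \<lhd> G" shows "subnormal G N"
  using subnormal.step[OF subnormal.self, of N G] assms by simp

lemma subnormal_trans:
  assumes "subnormal (G \<down> K) L" "subnormal G K"
  shows "subnormal G L"
  using assms by (induction rule: subnormal.induct) (auto intro: subnormal.step)

lemma (in group) subnormal_Int:
  assumes "subnormal G K" "subgroup H G"
  shows "subnormal (G \<down> H) (K \<inter> H)"
  using assms(1)
proof (induction rule: subnormal.induct)
  case self
  have "carrier G \<inter> H = carrier (G \<down> H)"
    using assms(2) subgroup.subset by auto
  then show ?case by (metis subnormal.self)
next
  case (step K L)
  have K: "subgroup K G" using step subnormal_imp_subgroup by blast
  have KH: "subgroup (K \<inter> H) G" using K assms(2) subgroups_Inter_pair by blast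
  have "L \<inter> H \<lhd> (G \<down> K \<inter> H)"
    using step(2) K KH assms(2) subgroups_Inter_pair[of L H]
    by (auto simp: normal_restrict_iff subgroup.m_closed subgroup.m_inv_closed)
  then show ?case using step.IH by (auto intro: subnormal.step)
qed

lemma (in group) subnormal_restrict:
  assumes "subnormal G K" "subgroup H G" "K \<subseteq> H"
  shows "subnormal (G \<down> H) K"
  using subnormal_Int[OF assms(1,2)] assms(3) by (simp add: Int_absorb2)

lemma (in group_hom) normal_image:
  assumes "N \<lhd> G" shows "h ` N \<lhd> (H \<down> h ` carrier G)"
proof -
  have "x \<in> carrier G" if "x \<in> N" for x
    using assms that normal_imp_subgroup subgroup.subset by blast
  moreover have "h k \<otimes>\<^bsub>H\<^esub> h x \<otimes>\<^bsub>H\<^esub> inv\<^bsub>H\<^esub> h k = h (k \<otimes> x \<otimes> inv k)" if "x \<in> carrier G" "k \<in> carrier G" for x k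
    using that by simp
  ultimately show ?thesis
    using assms img_is_subgroup subgroup_img_is_subgroup[OF normal_imp_subgroup[OF assms]] G.normal_conjD(1)[OF assms]
    by (auto simp: H.normal_restrict_iff simp del: hom_mult hom_inv)
qed

lemma (in group_hom) restrict_hom:
  assumes "subgroup K G"
  shows "group_hom (G \<down> K) (H \<down> h ` K) h"
proof (rule group_hom.intro)
  show "group (G \<down> K)" using assms by (rule G.subgroup_imp_group)
  show "group (H \<down> h ` K)"
    using assms subgroup_img_is_subgroup H.subgroup_imp_group by blast
  show "group_hom_axioms (G \<down> K) (H \<down> h ` K) h"
    using assms subgroup.mem_carrier by unfold_locales (fastforce simp: hom_def)
qed

lemma (in group_hom) subnormal_image:
  assumes "subnormal G K" shows "subnormal (H \<down> h ` carrier G) (h ` K)"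
  using assms
proof (induction rule: subnormal.induct)
  case self
  show ?case using subnormal.self[of "H \<down> h ` carrier G"] by simp
next
  case (step K L)
  interpret K: group_hom "G \<down> K" "H \<down> h ` K" h
    using step G.subnormal_imp_subgroup restrict_hom by blast
  show ?case using step.IH K.normal_image[OF step(2)] by (auto intro: subnormal.step)
qed

lemma (in group_hom) subnormal_image':
  assumes "h ` carrier G \<lhd> H" "subnormal G K" shows "subnormal H (h ` K)"
  using subnormal_image[OF assms(2)] normal_imp_subnormal[OF assms(1)] subnormal_trans by blast

lemma (in group) conj_hom:
  assumes "g \<in> carrier G" shows "group_hom G G (\<lambda>x. g \<otimes> x \<otimes> inv g)"
  using assms by unfold_locales (auto simp: hom_def m_assoc)

lemma group_hom_inclusion:
  assumes "group G" "subgroup K G"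
  shows "group_hom (G \<down> K) G (\<lambda>x. x)"
proof -
  interpret group G by fact
  show ?thesis
    using assms subgroup.mem_carrier[OF assms(2)]
    by (auto simp: group_hom_def group_hom_axioms_def hom_def subgroup_imp_group)
qed

lemma (in group_hom) preimage_subgroup:
  assumes "subgroup K H" shows "subgroup {x \<in> carrier G. h x \<in> K} G"
  using assms by (intro G.subgroupI) (auto simp: subgroup.m_closed subgroup.m_inv_closed subgroup.one_closed
      intro!: exI[of _ "\<one>"])

lemma (in group_hom) preimage_normal:
  assumes "N \<lhd> H" shows "{x \<in> carrier G. h x \<in> N} \<lhd> G"
  using assms preimage_subgroup[OF normal_imp_subgroup[OF assms]]
  by (auto simp: G.normal_inv_iff H.normal_conjD)

lemma (in normal) quotient_hom: "group_hom G (G Mod H) (\<lambda>x. H #> x)"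
  using factorgroup_is_group r_coset_hom_Mod is_group by (simp add: group_hom_def group_hom_axioms_def)

lemma (in normal) quotient_surj: "(\<lambda>x. H #> x) ` carrier G = carrier (G Mod H)"
  by (simp add: carrier_FactGroup)

lemma (in group) conj_image_normal:
  assumes N: "N \<lhd> G" and g: "g \<in> carrier G"
  shows "(\<lambda>x. g \<otimes> x \<otimes> inv g) ` N = N"
proof
  show "(\<lambda>x. g \<otimes> x \<otimes> inv g) ` N \<subseteq> N" using normal_conjD(1)[OF N _ g] by blast
  show "N \<subseteq> (\<lambda>x. g \<otimes> x \<otimes> inv g) ` N"
  proof
    fix y assume y: "y \<in> N"
    then have "y = g \<otimes> (inv g \<otimes> y \<otimes> g) \<otimes> inv g"
      using g subgroup.mem_carrier[OF normal_imp_subgroup[OF N] y] by (simp add: m_assoc)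
    then show "y \<in> (\<lambda>x. g \<otimes> x \<otimes> inv g) ` N" using normal_conjD(2)[OF N y g] by blast
  qed
qed

lemmas (in group) conj_hom_surj = conj_image_normal[OF normal_self]

lemma (in normal) coset_eq_iff:
  assumes "x \<in> carrier G" "y \<in> carrier G"
  shows "H #> x = H #> y \<longleftrightarrow> x \<otimes> inv y \<in> H"
  using assms rcos_module[OF is_group assms(2,1)] repr_independence[OF _ assms(2) subgroup_axioms, of x] rcos_self[OF assms(1) subgroup_axioms] by auto

lemma (in normal) coset_eq_self_iff:
  assumes "x \<in> carrier G" shows "H #> x = H \<longleftrightarrow> x \<in> H"
  using coset_eq_iff[OF assms one_closed] assms by (simp add: subset)

text \<open>Restricting the carrier leaves the multiplication untouched, so cosets, product and unit
  agree literally. This turns a series factor into a subgroup of the quotient without any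
  isomorphism.\<close>

lemma restrict_FactGroup:
  "(G \<down> M) Mod N = ((G Mod N) \<down> (\<lambda>x. N #>\<^bsub>G\<^esub> x) ` M)"
  by (auto simp: FactGroup_def RCOSETS_def fun_eq_iff)

section \<open>Radicals\<close>

text \<open>The second condition asks only for a normal image, so it covers conjugations, quotient
  maps and inclusions of normal subgroups at once. Together with the third it yields
  \<open>\<rho> (G \<down> L) = L \<inter> \<rho> G\<close> for normal, and then for subnormal
  \<open>L\<close>.\<close>

definition radical :: "(('a, 'b) monoid_scheme \<Rightarrow> 'a set) \<Rightarrow> bool" where
  "radical \<rho> \<longleftrightarrow>
     (\<forall>G. group G \<and> finite (carrier G) \<longrightarrow> subgroup (\<rho> G) G) \<and>
     (\<forall>A B \<theta>. group_hom A B \<theta> \<and> finite (carrier A) \<and> finite (carrier B) \<and> \<theta> ` carrier A \<lhd> B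
        \<longrightarrow> \<theta> ` \<rho> A \<subseteq> \<rho> B) \<and>
     (\<forall>G L. group G \<and> finite (carrier G) \<and> L \<lhd> G \<longrightarrow> L \<inter> \<rho> G \<subseteq> \<rho> (G \<down> L))"

text \<open>Series arise by iterating in the first argument, so that the type of \<open>G\<close>
  stays fixed while the outer radical is always taken on groups of cosets.\<close>

definition ext_radical ::
    "(('a, 'b) monoid_scheme \<Rightarrow> 'a set) \<Rightarrow> ('a set monoid \<Rightarrow> 'a set set) \<Rightarrow> ('a, 'b) monoid_scheme \<Rightarrow> 'a set"
  where "ext_radical \<rho> \<sigma> G = {x \<in> carrier G. \<rho> G #>\<^bsub>G\<^esub> x \<in> \<sigma> (G Mod \<rho> G)}"

lemma radical_subgroup:
  assumes "radical \<rho>" "group G" "finite (carrier G)" shows "subgroup (\<rho> G) G"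
  using assms unfolding radical_def by blast

lemma radical_image:
  assumes "radical \<rho>" "group_hom A B \<theta>" "finite (carrier A)" "finite (carrier B)" "\<theta> ` carrier A \<lhd> B"
  shows "\<theta> ` \<rho> A \<subseteq> \<rho> B"
  using assms unfolding radical_def by blast

text \<open>Conjugation by \<open>g\<close> is a homomorphism from \<open>G\<close> onto
  \<open>G\<close>, so the image condition applies to it.\<close>

lemma radical_normal:
  assumes "radical \<rho>" "group G" "finite (carrier G)" shows "\<rho> G \<lhd> G"
proof -
  interpret group G by fact
  have "g \<otimes>\<^bsub>G\<^esub> x \<otimes>\<^bsub>G\<^esub> inv\<^bsub>G\<^esub> g \<in> \<rho> G" if "g \<in> carrier G" "x \<in> \<rho> G" for g x
    using radical_image[OF assms(1) conj_hom[OF that(1)] assms(3,3)] that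
    by (auto simp: conj_hom_surj normal_self)
  then show ?thesis using radical_subgroup[OF assms] by (simp add: normal_inv_iff)
qed

lemma radical_restrict:
  assumes "radical \<rho>" "group G" "finite (carrier G)" "L \<lhd> G"
  shows "\<rho> (G \<down> L) = L \<inter> \<rho> G"
proof -
  interpret group G by fact
  have L: "subgroup L G" using assms(4) by (rule normal_imp_subgroup)
  then have fL: "finite L" using assms(3) finite_subset subgroup.subset by blast
  interpret L: group "G \<down> L" using L by (rule subgroup_imp_group)
  have "\<rho> (G \<down> L) \<subseteq> \<rho> G"
    using radical_image[OF assms(1) group_hom_inclusion[OF assms(2) L]] fL assms by simp
  moreover have "\<rho> (G \<down> L) \<subseteq> L"
    using radical_subgroup[OF assms(1) L.is_group] fL subgroup.subset by fastforce
  ultimately show ?thesis using assms unfolding radical_def by blast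
qed

lemma radical_restrict_subnormal:
  assumes "radical \<rho>" "group G" "finite (carrier G)" "subnormal G L"
  shows "\<rho> (G \<down> L) = L \<inter> \<rho> G"
  using assms(4)
proof (induction rule: subnormal.induct)
  case self
  then show ?case using radical_subgroup[OF assms(1-3)] subgroup.subset by auto
next
  case (step K L)
  interpret group G by fact
  have K: "subgroup K G" using step subnormal_imp_subgroup by blast
  then have "finite K" using assms(3) finite_subset subgroup.subset by blast
  then have "\<rho> (G \<down> L) = L \<inter> \<rho> (G \<down> K)"
    using radical_restrict[OF assms(1) subgroup_imp_group[OF K] _ step(2)] by simp
  moreover have "L \<subseteq> K" using step(2) K normal_restrict_iff by blast
  ultimately show ?case using step.IH by blast
qed

lemma (in normal) finite_quotient:
  assumes "finite (carrier G)" shows "finite (carrier (G Mod H))"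
  using assms by (simp flip: quotient_surj)

lemma (in normal) image_in_quotient_normal:
  assumes "L \<lhd> G" shows "(\<lambda>x. H #> x) ` L \<lhd> G Mod H"
  using group_hom.normal_image[OF quotient_hom assms] by (simp add: quotient_surj)

lemma induced_quotient_hom:
  assumes "group_hom A B \<theta>" "N \<lhd> A" "M \<lhd> B" "\<theta> ` N \<subseteq> M"
  obtains \<theta>' where "group_hom (A Mod N) (B Mod M) \<theta>'"
    "\<And>x. x \<in> carrier A \<Longrightarrow> \<theta>' (N #>\<^bsub>A\<^esub> x) = M #>\<^bsub>B\<^esub> \<theta> x"
proof -
  interpret \<theta>: group_hom A B \<theta> by fact
  interpret N: normal N A by fact
  interpret M: normal M B by fact
  have "(\<lambda>x. M #>\<^bsub>B\<^esub> x) \<circ> \<theta> \<in> hom A (B Mod M)"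
    using \<theta>.homh M.r_coset_hom_Mod Group.hom_compose by blast
  moreover have "((\<lambda>x. M #>\<^bsub>B\<^esub> x) \<circ> \<theta>) x = ((\<lambda>x. M #>\<^bsub>B\<^esub> x) \<circ> \<theta>) y"
    if "x \<in> carrier A" "y \<in> carrier A" "N #>\<^bsub>A\<^esub> x = N #>\<^bsub>A\<^esub> y" for x y
  proof -
    have "x \<otimes>\<^bsub>A\<^esub> inv\<^bsub>A\<^esub> y \<in> N" using that N.coset_eq_iff by blast
    then have "\<theta> (x \<otimes>\<^bsub>A\<^esub> inv\<^bsub>A\<^esub> y) \<in> M" using assms(4) by blast
    then show ?thesis using that M.coset_eq_iff by simp
  qed
  ultimately obtain \<theta>' where "\<theta>' \<in> hom (A Mod N) (B Mod M)"
    "\<And>x. x \<in> carrier A \<Longrightarrow> \<theta>' (N #>\<^bsub>A\<^esub> x) = ((\<lambda>x. M #>\<^bsub>B\<^esub> x) \<circ> \<theta>) x"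
    using FactGroup_universal[of "(\<lambda>x. M #>\<^bsub>B\<^esub> x) \<circ> \<theta>" A "B Mod M" N] assms(2) by blast
  then show ?thesis
    using that N.factorgroup_is_group M.factorgroup_is_group
    by (simp add: group_hom_def group_hom_axioms_def)
qed

text \<open>Images pass to the induced map of quotients. For normal \<open>L\<close>, the second
  isomorphism theorem identifies the quotient of \<open>L\<close> by its own radical with the image
  of \<open>L\<close> in \<open>G Mod \<rho> G\<close>; that image is normal, so
  \<open>\<sigma>\<close> restricts to it.\<close>

lemma radical_ext:
  assumes \<rho>: "radical \<rho>" and \<sigma>: "radical \<sigma>"
  shows "radical (ext_radical \<rho> \<sigma>)"
  unfolding radical_def
proof (intro conjI allI impI; elim conjE)
  fix G :: "('a, 'b) monoid_scheme"
  assume G: "group G" "finite (carrier G)"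
  interpret N: normal "\<rho> G" G using radical_normal[OF \<rho> G] .
  show "subgroup (ext_radical \<rho> \<sigma> G) G"
    unfolding ext_radical_def
    by (rule group_hom.preimage_subgroup[OF N.quotient_hom])
      (rule radical_subgroup[OF \<sigma> N.factorgroup_is_group N.finite_quotient[OF G(2)]])
next
  fix A B :: "('a, 'b) monoid_scheme" and \<theta>
  assume \<theta>: "group_hom A B \<theta>" and fin: "finite (carrier A)" "finite (carrier B)"
    and nor: "\<theta> ` carrier A \<lhd> B"
  interpret \<theta>: group_hom A B \<theta> by fact
  interpret N: normal "\<rho> A" A using radical_normal[OF \<rho> \<theta>.G.is_group fin(1)] .
  interpret M: normal "\<rho> B" B using radical_normal[OF \<rho> \<theta>.H.is_group fin(2)] .
  obtain \<theta>' where \<theta>': "group_hom (A Mod \<rho> A) (B Mod \<rho> B) \<theta>'"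
    "\<And>x. x \<in> carrier A \<Longrightarrow> \<theta>' (\<rho> A #>\<^bsub>A\<^esub> x) = \<rho> B #>\<^bsub>B\<^esub> \<theta> x"
    using induced_quotient_hom[OF \<theta> N.normal_axioms M.normal_axioms radical_image[OF \<rho> \<theta> fin nor]]
    by blast
  have "\<theta>' ` carrier (A Mod \<rho> A) = (\<lambda>x. \<rho> B #>\<^bsub>B\<^esub> x) ` \<theta> ` carrier A"
    unfolding N.quotient_surj[symmetric] image_image using \<theta>'(2) by (rule image_cong[OF refl])
  then have "\<theta>' ` carrier (A Mod \<rho> A) \<lhd> B Mod \<rho> B"
    using M.image_in_quotient_normal[OF nor] by simp
  from radical_image[OF \<sigma> \<theta>'(1) N.finite_quotient[OF fin(1)] M.finite_quotient[OF fin(2)] this]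
  show "\<theta> ` ext_radical \<rho> \<sigma> A \<subseteq> ext_radical \<rho> \<sigma> B"
    using \<theta>'(2) unfolding ext_radical_def by fastforce
next
  fix G :: "('a, 'b) monoid_scheme" and L
  assume G: "group G" "finite (carrier G)" and L: "L \<lhd> G"
  interpret group G by fact
  have sL: "subgroup L G" using L by (rule normal_imp_subgroup)
  have LG: "L \<subseteq> carrier G" using sL by (rule subgroup.subset)
  interpret R: normal "\<rho> G" G using radical_normal[OF \<rho> G] .
  let ?L = "G \<down> L" and ?I = "(\<lambda>x. \<rho> G #>\<^bsub>G\<^esub> x) ` L"
  let ?Q = "(G Mod \<rho> G) \<down> ?I"
  interpret L: group ?L using sL by (rule subgroup_imp_group)
  have \<rho>L: "\<rho> ?L = L \<inter> \<rho> G" by (rule radical_restrict[OF \<rho> G L])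
  have finL: "finite (carrier ?L)" using G(2) LG finite_subset by auto
  interpret S: normal "\<rho> ?L" ?L using radical_normal[OF \<rho> L.is_group finL] .
  interpret Q: group "G Mod \<rho> G" by (rule R.factorgroup_is_group)
  have I: "?I \<lhd> G Mod \<rho> G" using R.image_in_quotient_normal[OF L] .
  interpret I: group ?Q using I normal_imp_subgroup Q.subgroup_imp_group by blast
  let ?\<eta> = "\<lambda>A. A \<inter> L"
  \<comment> \<open>The identification is intersection with \<open>L\<close>: for \<open>x\<close>
    in \<open>L\<close>, the coset of \<open>\<rho> G\<close> through \<open>x\<close> meets
    \<open>L\<close> in a coset of \<open>L \<inter> \<rho> G\<close>, which is the radical of
    \<open>L\<close>.\<close>
  have \<eta>: "?\<eta> (\<rho> G #>\<^bsub>G\<^esub> x) = \<rho> ?L #>\<^bsub>?L\<^esub> x" if x: "x \<in> L" for x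
  proof -
    have "r \<in> L" if "r \<in> carrier G" "r \<otimes>\<^bsub>G\<^esub> x \<in> L" for r
    proof -
      have "r \<otimes>\<^bsub>G\<^esub> x \<otimes>\<^bsub>G\<^esub> inv\<^bsub>G\<^esub> x \<in> L" using that x sL by (simp add: subgroup.m_closed subgroup.m_inv_closed)
      then show ?thesis using that x LG by (auto simp: m_assoc)
    qed
    then show ?thesis
      using x R.subset subgroup.m_closed[OF sL] unfolding \<rho>L r_coset_def by auto
  qed
  have "group_hom ?Q (?L Mod \<rho> ?L) ?\<eta>"
  proof (intro group_hom.intro group_hom_axioms.intro homI)
    show "group ?Q" "group (?L Mod \<rho> ?L)" by (rule I.is_group S.factorgroup_is_group)+
    fix U assume "U \<in> carrier ?Q"
    then obtain x where x: "x \<in> L" "U = \<rho> G #>\<^bsub>G\<^esub> x" by auto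
    show "?\<eta> U \<in> carrier (?L Mod \<rho> ?L)"
      using x \<eta> by (simp flip: S.quotient_surj)
    fix V assume "V \<in> carrier ?Q"
    then obtain y where y: "y \<in> L" "V = \<rho> G #>\<^bsub>G\<^esub> y" by auto
    have "U \<otimes>\<^bsub>?Q\<^esub> V = \<rho> G #>\<^bsub>G\<^esub> (x \<otimes>\<^bsub>G\<^esub> y)"
      using R.rcos_sum[of x y] subsetD[OF LG] x y by simp
    moreover have "x \<otimes>\<^bsub>G\<^esub> y \<in> L" using x y subgroup.m_closed[OF sL] by simp
    moreover have "(\<rho> ?L #>\<^bsub>?L\<^esub> x) <#>\<^bsub>?L\<^esub> (\<rho> ?L #>\<^bsub>?L\<^esub> y) = \<rho> ?L #>\<^bsub>?L\<^esub> (x \<otimes>\<^bsub>G\<^esub> y)"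
      using S.rcos_sum[of x y] x y by simp
    ultimately show "?\<eta> (U \<otimes>\<^bsub>?Q\<^esub> V) = ?\<eta> U \<otimes>\<^bsub>?L Mod \<rho> ?L\<^esub> ?\<eta> V"
      using x y \<eta> by simp
  qed
  note hom = this
  have fQ: "finite (carrier ?Q)" using finL by simp
  have "?\<eta> ` carrier ?Q = carrier (?L Mod \<rho> ?L)"
    unfolding S.quotient_surj[symmetric] using \<eta> by (force simp: image_image)
  then have "?\<eta> ` carrier ?Q \<lhd> ?L Mod \<rho> ?L"
    using group.normal_self[OF S.factorgroup_is_group] by simp
  then have im: "?\<eta> ` \<sigma> ?Q \<subseteq> \<sigma> (?L Mod \<rho> ?L)"
    using radical_image[OF \<sigma> hom fQ S.finite_quotient[OF finL]] by blast
  show "L \<inter> ext_radical \<rho> \<sigma> G \<subseteq> ext_radical \<rho> \<sigma> ?L"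
  proof
    fix x assume "x \<in> L \<inter> ext_radical \<rho> \<sigma> G"
    then have x: "x \<in> L" "\<rho> G #>\<^bsub>G\<^esub> x \<in> \<sigma> (G Mod \<rho> G)" by (auto simp: ext_radical_def)
    then have "\<rho> G #>\<^bsub>G\<^esub> x \<in> \<sigma> ?Q"
      using radical_restrict[OF \<sigma> Q.is_group R.finite_quotient[OF G(2)] I] by auto
    then have "?\<eta> (\<rho> G #>\<^bsub>G\<^esub> x) \<in> \<sigma> (?L Mod \<rho> ?L)" using im by blast
    then show "x \<in> ext_radical \<rho> \<sigma> ?L" using x \<eta> by (simp add: ext_radical_def)
  qed
qed

lemma ext_radical_cosets:
  assumes "radical \<rho>" "radical \<sigma>" "group G" "finite (carrier G)"
  shows "(\<lambda>x. \<rho> G #>\<^bsub>G\<^esub> x) ` ext_radical \<rho> \<sigma> G = \<sigma> (G Mod \<rho> G)"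
proof -
  interpret N: normal "\<rho> G" G using radical_normal[OF assms(1,3,4)] .
  have "\<sigma> (G Mod \<rho> G) \<subseteq> carrier (G Mod \<rho> G)"
    using radical_subgroup[OF assms(2) N.factorgroup_is_group N.finite_quotient[OF assms(4)]]
    by (rule subgroup.subset)
  then show ?thesis unfolding ext_radical_def N.quotient_surj[symmetric] by auto
qed

lemma ext_radical_superset:
  assumes "radical \<rho>" "radical \<sigma>" "group G" "finite (carrier G)"
  shows "\<rho> G \<subseteq> ext_radical \<rho> \<sigma> G"
proof
  interpret N: normal "\<rho> G" G using radical_normal[OF assms(1,3,4)] .
  have "\<rho> G \<in> \<sigma> (G Mod \<rho> G)"
    using radical_subgroup[OF assms(2) N.factorgroup_is_group N.finite_quotient[OF assms(4)]]
      subgroup.one_closed by fastforce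
  moreover fix x assume "x \<in> \<rho> G"
  ultimately show "x \<in> ext_radical \<rho> \<sigma> G"
    using N.coset_eq_self_iff[of x] N.subset by (auto simp: ext_radical_def)
qed

section \<open>The Fitting subgroup and the soluble radical\<close>

text \<open>Stronger than the usual notion of a Fitting class: closure is required under all
  subgroups and under surjective images. Nilpotent and soluble groups both satisfy it.\<close>

definition fitting_class :: "(('a, 'b) monoid_scheme \<Rightarrow> bool) \<Rightarrow> bool" where
  "fitting_class P \<longleftrightarrow>
     (\<forall>A B \<theta>. group_hom A B \<theta> \<and> \<theta> ` carrier A = carrier B \<and> P A \<longrightarrow> P B) \<and>
     (\<forall>G K. group G \<and> subgroup K G \<and> P G \<longrightarrow> P (G \<down> K)) \<and>
     (\<forall>G M N. group G \<and> M \<lhd> G \<and> N \<lhd> G \<and> P (G \<down> M) \<and> P (G \<down> N)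
        \<longrightarrow> P ((G \<down> generate G (M \<union> N)))) \<and>
     (\<forall>G. group G \<longrightarrow> P (G \<down> {\<one>\<^bsub>G\<^esub>}))"

definition class_radical :: "(('a, 'b) monoid_scheme \<Rightarrow> bool) \<Rightarrow> ('a, 'b) monoid_scheme \<Rightarrow> 'a set" where
  "class_radical P G = generate G (\<Union>{N. N \<lhd> G \<and> P (G \<down> N)})"

lemma fitting_class_image:
  assumes "fitting_class P" "group_hom A B \<theta>" "\<theta> ` carrier A = carrier B" "P A" shows "P B"
  using assms unfolding fitting_class_def by blast

lemma fitting_class_subgroup:
  assumes "fitting_class P" "group G" "subgroup K G" "P G" shows "P (G \<down> K)"
  using assms unfolding fitting_class_def by blast

text \<open>Finiteness provides a normal subgroup that is maximal with property \<open>P\<close>;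
  closure under products of two such subgroups makes it contain all the others.\<close>

lemma class_radical_greatest:
  assumes P: "fitting_class P" and G: "group G" "finite (carrier G)"
  shows "class_radical P G \<lhd> G" "P (G \<down> class_radical P G)"
    and "\<And>N. N \<lhd> G \<Longrightarrow> P (G \<down> N) \<Longrightarrow> N \<subseteq> class_radical P G"
proof -
  interpret group G by fact
  let ?S = "{N. N \<lhd> G \<and> P (G \<down> N)}"
  have sub: "N \<subseteq> carrier G" if "N \<lhd> G" for N
    using that normal_imp_subgroup subgroup.subset by blast
  have "?S \<subseteq> Pow (carrier G)" using sub by blast
  then have fin: "finite ?S" using G(2) finite_subset by blast
  have "{\<one>\<^bsub>G\<^esub>} \<in> ?S" using P G one_is_normal unfolding fitting_class_def by blast
  then obtain M where M: "M \<in> ?S" "\<And>N. N \<in> ?S \<Longrightarrow> M \<subseteq> N \<Longrightarrow> M = N"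
    using finite_has_maximal[OF fin] by blast
  have N: "N \<subseteq> M" if "N \<in> ?S" for N
  proof -
    have "generate G (M \<union> N) \<in> ?S"
      using M(1) that P G(1) normal_generate_Un unfolding fitting_class_def by blast
    moreover have "M \<union> N \<subseteq> generate G (M \<union> N)" by (auto intro: generate.incl)
    ultimately show ?thesis using M(2) by blast
  qed
  then have "\<Union>?S = M" using M(1) by blast
  then have "class_radical P G = M"
    unfolding class_radical_def
    using generateI[of M M] M(1) normal_imp_subgroup by (metis (no_types, lifting) mem_Collect_eq order_refl)
  then show "class_radical P G \<lhd> G" "P (G \<down> class_radical P G)"
    "\<And>N. N \<lhd> G \<Longrightarrow> P (G \<down> N) \<Longrightarrow> N \<subseteq> class_radical P G"
    using M N by blast+
qed

text \<open>Characteristic in normal is normal: conjugation by an element of \<open>G\<close>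
  restricts to an automorphism of \<open>I\<close>, which preserves the greatest normal
  \<open>P\<close>-subgroup of \<open>I\<close>.\<close>

lemma class_radical_restrict_normal:
  assumes P: "fitting_class P" and G: "group G" "finite (carrier G)" and I: "I \<lhd> G"
  shows "class_radical P (G \<down> I) \<lhd> G"
proof -
  interpret group G by fact
  have sI: "subgroup I G" using I by (rule normal_imp_subgroup)
  let ?I = "G \<down> I" and ?R = "class_radical P (G \<down> I)"
  interpret I: group ?I using sI by (rule subgroup_imp_group)
  have fin: "finite (carrier ?I)" using finite_subgroup[OF sI G(2)] by simp
  note R = class_radical_greatest[OF P I.is_group fin]
  have sR: "subgroup ?R G" "?R \<subseteq> I" using R(1) sI normal_restrict_iff by blast+
  have "g \<otimes>\<^bsub>G\<^esub> x \<otimes>\<^bsub>G\<^esub> inv\<^bsub>G\<^esub> g \<in> ?R" if g: "g \<in> carrier G" and x: "x \<in> ?R" for g x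
  proof -
    let ?c = "\<lambda>x. g \<otimes>\<^bsub>G\<^esub> x \<otimes>\<^bsub>G\<^esub> inv\<^bsub>G\<^esub> g"
    interpret c: group_hom G G ?c using conj_hom[OF g] .
    have cI: "?c ` I = I" using conj_image_normal[OF I g] .
    interpret cI: group_hom ?I ?I ?c using c.restrict_hom[OF sI] unfolding cI .
    have "?c ` ?R \<lhd> ?I" using cI.normal_image[OF R(1)] cI by simp
    moreover have "P (?I \<down> ?c ` ?R)"
      using fitting_class_image[OF P cI.restrict_hom[OF normal_imp_subgroup[OF R(1)]] _ R(2)] by simp
    ultimately show ?thesis using R(3) x by blast
  qed
  then show ?thesis using sR by (simp add: normal_inv_iff)
qed

text \<open>Images are handled inside the image of \<open>\<theta>\<close>: the radical of
  \<open>A\<close> maps to a normal \<open>P\<close>-subgroup of it, and the radical of a normal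
  subgroup of \<open>B\<close> is again normal in \<open>B\<close>. The intersection property uses
  closure under subgroups.\<close>

lemma radical_class_radical:
  assumes P: "fitting_class P"
  shows "radical (class_radical P)"
  unfolding radical_def
proof (intro conjI allI impI; elim conjE)
  fix G :: "('a, 'b) monoid_scheme"
  assume G: "group G" "finite (carrier G)"
  show "subgroup (class_radical P G) G"
    using class_radical_greatest(1)[OF P G] by (rule normal_imp_subgroup)
next
  fix A B :: "('a, 'b) monoid_scheme" and \<theta>
  assume \<theta>: "group_hom A B \<theta>" and fin: "finite (carrier A)" "finite (carrier B)"
    and nor: "\<theta> ` carrier A \<lhd> B"
  interpret \<theta>: group_hom A B \<theta> by fact
  let ?I = "B \<down> \<theta> ` carrier A"
  interpret I: group ?I using \<theta>.img_is_subgroup \<theta>.H.subgroup_imp_group by blast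
  note R = class_radical_greatest[OF P \<theta>.G.is_group fin(1)]
  have "\<theta> ` class_radical P A \<lhd> ?I" using \<theta>.normal_image[OF R(1)] .
  moreover have "P (?I \<down> \<theta> ` class_radical P A)"
    using fitting_class_image[OF P \<theta>.restrict_hom[OF normal_imp_subgroup[OF R(1)]] _ R(2)] by simp
  ultimately have "\<theta> ` class_radical P A \<subseteq> class_radical P ?I"
    using class_radical_greatest(3)[OF P I.is_group] fin(1) by simp
  also have "\<dots> \<subseteq> class_radical P B"
    using class_radical_greatest(3)[OF P \<theta>.H.is_group fin(2)]
      class_radical_restrict_normal[OF P \<theta>.H.is_group fin(2) nor]
      class_radical_greatest(2)[OF P I.is_group] fin(1) by simp
  finally show "\<theta> ` class_radical P A \<subseteq> class_radical P B" .
next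
  fix G :: "('a, 'b) monoid_scheme" and L
  assume G: "group G" "finite (carrier G)" and L: "L \<lhd> G"
  interpret group G by fact
  have sL: "subgroup L G" using L by (rule normal_imp_subgroup)
  let ?L = "G \<down> L" and ?R = "class_radical P G"
  interpret L: group ?L using sL by (rule subgroup_imp_group)
  have fin: "finite (carrier ?L)" using finite_subgroup[OF sL G(2)] by simp
  note R = class_radical_greatest[OF P G]
  have sR: "subgroup ?R G" using R(1) by (rule normal_imp_subgroup)
  interpret R: group "G \<down> ?R" using sR by (rule subgroup_imp_group)
  have "?R \<inter> L \<lhd> ?L" using normal_Int_restrict[OF R(1) sL] .
  moreover have "subgroup (?R \<inter> L) (G \<down> ?R)"
    using sR sL by (simp add: subgroup_restrict_iff subgroups_Inter_pair)
  then have "P (?L \<down> ?R \<inter> L)"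
    using fitting_class_subgroup[OF P R.is_group _ R(2)] by simp
  ultimately show "L \<inter> ?R \<subseteq> class_radical P ?L"
    using class_radical_greatest(3)[OF P L.is_group fin] by blast
qed

subsection \<open>Nilpotent groups\<close>

lemma (in group_hom) hom_group_comm [simp]:
  "x \<in> carrier G \<Longrightarrow> y \<in> carrier G \<Longrightarrow> h (group_comm G x y) = group_comm H (h x) (h y)"
  by (simp add: group_comm_def)

lemma (in group) group_comm_restrict:
  assumes "subgroup K G" "x \<in> K" "y \<in> K"
  shows "group_comm (G \<down> K) x y = group_comm G x y"
  using assms by (simp add: group_comm_def)

lemma (in group) group_comm_closed [simp]:
  "x \<in> carrier G \<Longrightarrow> y \<in> carrier G \<Longrightarrow> group_comm G x y \<in> carrier G"
  by (simp add: group_comm_def)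

lemma (in group) group_comm_eq_one_iff:
  assumes "x \<in> carrier G" "y \<in> carrier G"
  shows "group_comm G x y = \<one> \<longleftrightarrow> x \<otimes> y = y \<otimes> x"
proof -
  have "y \<otimes> x \<otimes> group_comm G x y = x \<otimes> y"
    using assms by (simp add: group_comm_def m_assoc)
  then show ?thesis
    using assms by (metis group_comm_closed m_closed r_one l_cancel_one)
qed

lemma (in group) normal_group_comm:
  assumes "N \<lhd> G" "g \<in> carrier G"
  shows "x \<in> N \<Longrightarrow> group_comm G x g \<in> N" "x \<in> N \<Longrightarrow> group_comm G g x \<in> N"
proof -
  interpret N: normal N G by fact
  assume x: "x \<in> N"
  have "group_comm G x g = inv x \<otimes> (inv g \<otimes> x \<otimes> g)" "group_comm G g x = (inv g \<otimes> inv x \<otimes> g) \<otimes> x"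
    using x assms N.subset by (auto simp: group_comm_def m_assoc)
  then show "group_comm G x g \<in> N" "group_comm G g x \<in> N"
    using x assms(2) normal_conjD(2)[OF assms(1)] by auto
qed

text \<open>Modulo \<open>T\<close> the generators commute elementwise, hence so do the subgroups
  they generate.\<close>

lemma (in group) group_comm_generate:
  assumes T: "T \<lhd> G" and AB: "A \<subseteq> carrier G" "B \<subseteq> carrier G"
    and comm: "\<And>a b. a \<in> A \<Longrightarrow> b \<in> B \<Longrightarrow> group_comm G a b \<in> T"
    and x: "x \<in> generate G A" and y: "y \<in> generate G B"
  shows "group_comm G x y \<in> T"
proof -
  interpret T: normal T G by fact
  interpret q: group_hom G "G Mod T" "\<lambda>x. T #> x" by (rule T.quotient_hom)
  have iff: "group_comm G x y \<in> T \<longleftrightarrow>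
      (T #> x) \<otimes>\<^bsub>G Mod T\<^esub> (T #> y) = (T #> y) \<otimes>\<^bsub>G Mod T\<^esub> (T #> x)"
    if "x \<in> carrier G" "y \<in> carrier G" for x y
    using q.H.group_comm_eq_one_iff[of "T #> x" "T #> y"] q.hom_group_comm[OF that]
      T.coset_eq_self_iff[of "group_comm G x y"] that q.hom_closed by auto
  have "(T #> x) \<otimes>\<^bsub>G Mod T\<^esub> (T #> y) = (T #> y) \<otimes>\<^bsub>G Mod T\<^esub> (T #> x)"
  proof (rule q.H.generate_commute)
    show "(\<lambda>x. T #> x) ` A \<subseteq> carrier (G Mod T)" "(\<lambda>x. T #> x) ` B \<subseteq> carrier (G Mod T)"
      using AB q.hom_closed by blast+
    show "T #> x \<in> generate (G Mod T) ((\<lambda>x. T #> x) ` A)" "T #> y \<in> generate (G Mod T) ((\<lambda>x. T #> x) ` B)"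
      using x y q.generate_img AB by blast+
    fix u v assume "u \<in> (\<lambda>x. T #> x) ` A" "v \<in> (\<lambda>x. T #> x) ` B"
    then show "u \<otimes>\<^bsub>G Mod T\<^esub> v = v \<otimes>\<^bsub>G Mod T\<^esub> u" using iff comm AB by blast
  qed
  then show ?thesis using iff x y generate_in_carrier AB by blast
qed

lemma (in group) lower_central_subgroup: "subgroup (lower_central G i) G"
proof (induction i)
  case (Suc i)
  then show ?case
    using subgroup.mem_carrier[OF Suc] by (auto intro!: generate_is_subgroup)
qed (simp add: subgroup_self)

lemma (in group_hom) lower_central_image:
  assumes "h ` carrier G = carrier H"
  shows "h ` lower_central G i = lower_central H i"
proof (induction i)
  case (Suc i)
  let ?S = "{group_comm G x y |x y. x \<in> lower_central G i \<and> y \<in> carrier G}"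
  have c: "x \<in> carrier G" if "x \<in> lower_central G i" for x
    using subgroup.mem_carrier[OF G.lower_central_subgroup that] .
  have "h ` ?S = {group_comm H x y |x y. x \<in> h ` lower_central G i \<and> y \<in> h ` carrier G}"
    using c by (auto simp: image_iff) (metis c hom_group_comm)+
  moreover have "?S \<subseteq> carrier G" using c by auto
  ultimately show ?case using generate_img[of ?S] Suc assms by simp
qed (simp add: assms)

lemma (in group) lower_central_restrict_subset:
  assumes K: "subgroup K G"
  shows "lower_central (G \<down> K) i \<subseteq> lower_central G i"
proof (induction i)
  case 0
  show ?case using K subgroup.subset by auto
next
  case (Suc i)
  interpret K: group "G \<down> K" using K by (rule subgroup_imp_group)
  let ?S = "{group_comm (G \<down> K) x y |x y. x \<in> lower_central (G \<down> K) i \<and> y \<in> K}"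
  have c: "x \<in> K" if "x \<in> lower_central (G \<down> K) i" for x
    using subgroup.mem_carrier[OF K.lower_central_subgroup that] by simp
  have "?S \<subseteq> K" using c K.group_comm_closed by auto
  then have "generate (G \<down> K) ?S = generate G ?S" using K by (rule generate_consistent)
  also have "?S \<subseteq> {group_comm G x y |x y. x \<in> lower_central G i \<and> y \<in> carrier G}"
    using Suc c subgroup.mem_carrier[OF K] group_comm_restrict[OF K] by blast
  then have "generate G ?S \<subseteq> lower_central G (Suc i)" using mono_generate by simp
  finally show ?case by simp
qed

lemma (in group) nilpotent_iff: "nilpotent_group G \<longleftrightarrow> (\<exists>c. lower_central G c \<subseteq> {\<one>})"
  unfolding nilpotent_group_def
  using subgroup.one_closed[OF lower_central_subgroup] by (metis empty_subsetI insert_subset subset_antisym order_refl)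

lemma (in group) lower_central_normal_subgroup:
  assumes N: "N \<lhd> G"
  shows "lower_central (G \<down> N) i \<lhd> G"
proof -
  have sN: "subgroup N G" using N by (rule normal_imp_subgroup)
  interpret N: group "G \<down> N" using sN by (rule subgroup_imp_group)
  have s: "subgroup (lower_central (G \<down> N) i) G"
    using N.lower_central_subgroup sN subgroup_restrict_iff by blast
  have "g \<otimes> x \<otimes> inv g \<in> lower_central (G \<down> N) i"
    if g: "g \<in> carrier G" and x: "x \<in> lower_central (G \<down> N) i" for g x
  proof -
    let ?c = "\<lambda>x. g \<otimes> x \<otimes> inv g"
    interpret c: group_hom G G ?c using conj_hom[OF g] .
    have cN: "?c ` N = N" using conj_image_normal[OF N g] .
    interpret cN: group_hom "G \<down> N" "G \<down> N" ?c
      using c.restrict_hom[OF sN] unfolding cN .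
    show ?thesis using cN.lower_central_image[of i] x cN by auto
  qed
  then show ?thesis using s by (simp add: normal_inv_iff)
qed

text \<open>The lower central series of a normal subgroup \<open>N\<close>, preceded by the whole group; then
  \<open>[\<gamma>\<^sub>i, N] \<le> \<gamma>\<^sub>i\<^sub>+\<^sub>1\<close> also holds for \<open>i = 0\<close>.\<close>

definition shifted_central :: "('a, 'b) monoid_scheme \<Rightarrow> 'a set \<Rightarrow> nat \<Rightarrow> 'a set" where
  "shifted_central G N i =
     (case i of 0 \<Rightarrow> carrier G | Suc j \<Rightarrow> lower_central (G \<down> N) j)"

lemma (in group) shifted_central_normal:
  "N \<lhd> G \<Longrightarrow> shifted_central G N i \<lhd> G"
  by (auto simp: shifted_central_def lower_central_normal_subgroup normal_self split: nat.split)

lemma (in group) shifted_central_comm: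
  assumes N: "N \<lhd> G" and x: "x \<in> shifted_central G N i" and a: "a \<in> N"
  shows "group_comm G x a \<in> shifted_central G N (Suc i)"
proof (cases i)
  case 0
  then show ?thesis using normal_group_comm(2)[OF N _ a] x by (simp add: shifted_central_def)
next
  case (Suc j)
  have sN: "subgroup N G" using N by (rule normal_imp_subgroup)
  interpret N: group "G \<down> N" using sN by (rule subgroup_imp_group)
  have x: "x \<in> lower_central (G \<down> N) j" using x Suc by (simp add: shifted_central_def)
  then have "x \<in> N" using subgroup.mem_carrier[OF N.lower_central_subgroup] by fastforce
  then have "group_comm G x a = group_comm (G \<down> N) x a"
    using group_comm_restrict[OF sN _ a] by simp
  then show ?thesis
    using x a Suc by (auto simp: shifted_central_def intro!: generate.incl)
qed

lemma (in group) shifted_central_trivial: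
  assumes N: "N \<lhd> G" and "lower_central (G \<down> N) c = {\<one>}" "Suc c \<le> i"
  shows "shifted_central G N i \<subseteq> {\<one>}"
  using assms(3)
proof (induction i rule: dec_induct)
  case base
  show ?case using assms(2) by (simp add: shifted_central_def)
next
  case (step i)
  have sN: "subgroup N G" using N by (rule normal_imp_subgroup)
  interpret N: group "G \<down> N" using sN by (rule subgroup_imp_group)
  obtain j where j: "i = Suc j" using step by (cases i) auto
  then have "lower_central (G \<down> N) j \<subseteq> {\<one>}" using step by (simp add: shifted_central_def)
  then have "{group_comm (G \<down> N) x y |x y. x \<in> lower_central (G \<down> N) j \<and> y \<in> N} \<subseteq> {\<one>}"
    using N.normal_group_comm(1)[OF N.one_is_normal] by auto
  then have "lower_central (G \<down> N) (Suc j) \<subseteq> generate (G \<down> N) {\<one>}"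
    using N.mono_generate by simp
  then show ?case using j N.generate_one by (simp add: shifted_central_def)
qed

text \<open>Fitting's theorem. \<open>T m\<close> is generated by the intersections of an
  \<open>i\<close>-th term for \<open>M\<close> with an \<open>(m - i)\<close>-th term for
  \<open>N\<close>. A commutator with an element of \<open>M\<close> raises the first index, one
  with an element of \<open>N\<close> the second, so commutators of \<open>T m\<close> with the
  product lie in \<open>T (Suc m)\<close>.\<close>

lemma (in group) nilpotent_generate_Un:
  assumes M: "M \<lhd> G" "nilpotent_group (G \<down> M)"
    and N: "N \<lhd> G" "nilpotent_group (G \<down> N)"
  shows "nilpotent_group ((G \<down> generate G (M \<union> N)))"
proof -
  let ?K = "generate G (M \<union> N)"
  let ?S = "\<lambda>m. \<Union>i\<le>m. shifted_central G M i \<inter> shifted_central G N (m - i)"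
  define T where "T = (\<lambda>m. generate G (?S m))"
  have sub: "subgroup M G" "subgroup N G" using M N normal_imp_subgroup by blast+
  have MN: "M \<union> N \<subseteq> carrier G" using sub subgroup.subset by blast
  have sK: "subgroup ?K G" using MN by (rule generate_is_subgroup)
  interpret K: group "G \<down> ?K" using sK by (rule subgroup_imp_group)
  note nor = shifted_central_normal[OF M(1)] shifted_central_normal[OF N(1)]
  have S: "?S m \<subseteq> carrier G" for m
    using nor normal_imp_subgroup subgroup.subset by blast
  have T: "T m \<lhd> G" for m
    unfolding T_def
  proof (rule normal_generateI[OF S])
    fix h g assume "h \<in> ?S m" and g: "g \<in> carrier G"
    then obtain i where i: "i \<le> m" "h \<in> shifted_central G M i" "h \<in> shifted_central G N (m - i)"
      by blast
    then show "g \<otimes> h \<otimes> inv g \<in> ?S m" using normal_conjD(1)[OF nor(1) i(2) g] normal_conjD(1)[OF nor(2) i(3) g] by blast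
  qed
  have step: "group_comm G x y \<in> T (Suc m)" if "x \<in> T m" "y \<in> ?K" for x y m
  proof (rule group_comm_generate[OF T S MN _ that[unfolded T_def]])
    fix a b assume a: "a \<in> ?S m" and b: "b \<in> M \<union> N"
    obtain i where i: "i \<le> m" "a \<in> shifted_central G M i" "a \<in> shifted_central G N (m - i)"
      using a by blast
    have bc: "b \<in> carrier G" using b MN by blast
    have "group_comm G a b \<in> ?S (Suc m)"
    proof (cases "b \<in> M")
      case True
      have "group_comm G a b \<in> shifted_central G M (Suc i) \<inter> shifted_central G N (Suc m - Suc i)"
        using shifted_central_comm[OF M(1) i(2) True] normal_group_comm(1)[OF nor(2) bc i(3)] by simp
      then show ?thesis using i(1) by (intro UN_I[of "Suc i"]) auto
    next
      case False
      then have "b \<in> N" using b by blast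
      then have "group_comm G a b \<in> shifted_central G M i \<inter> shifted_central G N (Suc m - i)"
        using shifted_central_comm[OF N(1) i(3)] normal_group_comm(1)[OF nor(1) bc i(2)] i(1)
        by (simp add: Suc_diff_le)
      then show ?thesis using i(1) by (intro UN_I[of i]) auto
    qed
    then show "group_comm G a b \<in> T (Suc m)" unfolding T_def by (rule generate.incl)
  qed
  have lc: "lower_central (G \<down> ?K) m \<subseteq> T (Suc m)" for m
  proof (induction m)
    case 0
    \<comment> \<open>Here \<open>M\<close> belongs to the pair of indices \<open>(1, 0)\<close> and
      \<open>N\<close> to \<open>(0, 1)\<close>, since term 0 of each shifted series is the whole
      group. So term 0 of the lower central series lies in \<open>T 1\<close>, and the indices stay
      shifted by one.\<close>
    have "M \<subseteq> ?S (Suc 0)" "N \<subseteq> ?S (Suc 0)"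
      using MN by (auto simp: shifted_central_def atMost_Suc)
    then show ?case unfolding T_def using mono_generate[of "M \<union> N" "?S (Suc 0)"] by simp
  next
    case (Suc m)
    have "x \<in> ?K" if "x \<in> lower_central (G \<down> ?K) m" for x
      using subgroup.mem_carrier[OF K.lower_central_subgroup that] by simp
    then have sub: "{group_comm (G \<down> ?K) x y |x y. x \<in> lower_central (G \<down> ?K) m \<and> y \<in> ?K}
        \<subseteq> T (Suc (Suc m)) \<inter> ?K" (is "?C \<subseteq> _")
      using step Suc group_comm_restrict[OF sK] K.group_comm_closed by (fastforce simp del: generate.simps)
    then have "generate (G \<down> ?K) ?C = generate G ?C"
      using generate_consistent[OF _ sK] by blast
    also have "\<dots> \<subseteq> T (Suc (Suc m))"
      using generate_subgroup_incl[OF _ normal_imp_subgroup[OF T]] sub by blast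
    finally show ?case by simp
  qed
  obtain c d where cd: "lower_central (G \<down> M) c = {\<one>}" "lower_central (G \<down> N) d = {\<one>}"
    using M(2) N(2) by (auto simp: nilpotent_group_def)
  \<comment> \<open>Of the indices \<open>i\<close> and \<open>c + d + 2 - i\<close>, either the
    first exceeds \<open>c\<close> or the second exceeds \<open>d\<close>; so one of the two
    intersected terms is trivial.\<close>
  have "?S (Suc (c + Suc d)) \<subseteq> {\<one>}"
  proof
    fix x assume "x \<in> ?S (Suc (c + Suc d))"
    then obtain i where i: "i \<le> Suc (c + Suc d)" "x \<in> shifted_central G M i"
      "x \<in> shifted_central G N (Suc (c + Suc d) - i)" by blast
    show "x \<in> {\<one>}"
    proof (cases "Suc c \<le> i")
      case True
      then show ?thesis using shifted_central_trivial[OF M(1) cd(1)] i by blast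
    next
      case False
      then have "Suc d \<le> Suc (c + Suc d) - i" by simp
      then show ?thesis using shifted_central_trivial[OF N(1) cd(2)] i by blast
    qed
  qed
  then have "T (Suc (c + Suc d)) \<subseteq> {\<one>}"
    unfolding T_def using mono_generate generate_one by metis
  with lc[of "c + Suc d"] have "lower_central (G \<down> ?K) (c + Suc d) \<subseteq> {\<one>}" by (rule order_trans)
  then show ?thesis unfolding K.nilpotent_iff by (intro exI[of _ "c + Suc d"]) simp
qed

lemma fitting_class_nilpotent: "fitting_class nilpotent_group"
  unfolding fitting_class_def
proof (intro conjI allI impI; (elim conjE)?)
  fix A B :: "('a, 'b) monoid_scheme" and \<theta>
  assume \<theta>: "group_hom A B \<theta>" "\<theta> ` carrier A = carrier B" "nilpotent_group A"
  interpret \<theta>: group_hom A B \<theta> by fact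
  obtain c where "lower_central A c = {\<one>\<^bsub>A\<^esub>}" using \<theta>(3) by (auto simp: nilpotent_group_def)
  then show "nilpotent_group B"
    using \<theta>.lower_central_image[OF \<theta>(2), of c] by (auto simp: nilpotent_group_def)
next
  fix G :: "('a, 'b) monoid_scheme" and K
  assume K: "group G" "subgroup K G" "nilpotent_group G"
  interpret group G by fact
  interpret K: group "G \<down> K" using K(2) by (rule subgroup_imp_group)
  show "nilpotent_group (G \<down> K)"
    unfolding K.nilpotent_iff using K(3) lower_central_restrict_subset[OF K(2)]
    by (force simp: nilpotent_iff)
next
  fix G :: "('a, 'b) monoid_scheme" and M N
  assume "group G" "M \<lhd> G" "N \<lhd> G" "nilpotent_group (G \<down> M)" "nilpotent_group (G \<down> N)"
  then show "nilpotent_group ((G \<down> generate G (M \<union> N)))"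
    using group.nilpotent_generate_Un by blast
next
  fix G :: "('a, 'b) monoid_scheme"
  assume "group G"
  then show "nilpotent_group (G \<down> {\<one>\<^bsub>G\<^esub>})"
    unfolding nilpotent_group_def by (intro exI[of _ 0]) simp
qed

lemma fitting_subgroup_class: "fitting_subgroup = class_radical nilpotent_group"
  by (simp add: fun_eq_iff fitting_subgroup_def class_radical_def)

lemma (in comm_group) comm_group_nilpotent: "nilpotent_group G"
proof -
  have "{group_comm G x y |x y. x \<in> carrier G \<and> y \<in> carrier G} \<subseteq> {\<one>}"
    using group_comm_eq_one_iff m_comm by blast
  then have "lower_central G 1 \<subseteq> {\<one>}" using mono_generate[of _ "{\<one>}"] by (simp add: generate_one)
  then show ?thesis unfolding nilpotent_iff by (rule exI)
qed

subsection \<open>Soluble groups\<close>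

lemma (in group) solvable_restrict:
  assumes "subgroup K G" "solvable G" shows "solvable (G \<down> K)"
  using group_hom.inj_hom_imp_solvable[OF group_hom_inclusion[OF is_group assms(1)]] assms(2) by simp

lemma (in group) solvable_extension:
  assumes N: "N \<lhd> G" and "solvable (G \<down> N)" "solvable (G Mod N)"
  shows "solvable G"
proof -
  interpret N: normal N G by fact
  have "kernel G (G Mod N) (\<lambda>x. N #> x) \<subseteq> N"
    using N.coset_eq_self_iff by (auto simp: kernel_def)
  then show ?thesis
    using solvable_condition[OF group_hom_inclusion[OF is_group N.subgroup_axioms] N.quotient_hom N.quotient_surj]
      assms by simp
qed

text \<open>\<open>MN/N\<close> is an image of \<open>M\<close>, so \<open>MN\<close> is an
  extension of a soluble group by a soluble group.\<close>

lemma (in group) solvable_generate_Un: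
  assumes M: "M \<lhd> G" "solvable (G \<down> M)"
    and N: "N \<lhd> G" "solvable (G \<down> N)"
  shows "solvable ((G \<down> generate G (M \<union> N)))"
proof -
  let ?K = "generate G (M \<union> N)"
  have sub: "subgroup M G" "subgroup N G" using M N normal_imp_subgroup by blast+
  have MN: "M \<union> N \<subseteq> carrier G" using sub subgroup.subset by blast
  have sK: "subgroup ?K G" using MN by (rule generate_is_subgroup)
  interpret K: group "G \<down> ?K" using sK by (rule subgroup_imp_group)
  have "N \<subseteq> ?K" "M \<subseteq> ?K" by (auto intro: generate.incl)
  then have nN: "N \<lhd> (G \<down> ?K)" using normal_subgroup_restrict[OF N(1) sK] by simp
  interpret N: normal N "G \<down> ?K" by fact
  let ?q = "\<lambda>x. N #>\<^bsub>G \<down> ?K\<^esub> x"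
  have hom: "group_hom (G \<down> M) ((G \<down> ?K) Mod N) ?q"
  proof (intro group_hom.intro group_hom_axioms.intro homI)
    interpret q: group_hom "G \<down> ?K" "(G \<down> ?K) Mod N" ?q
      by (rule N.quotient_hom)
    show "group (G \<down> M)" using sub(1) by (rule subgroup_imp_group)
    show "group ((G \<down> ?K) Mod N)" by (rule N.factorgroup_is_group)
    fix x assume "x \<in> carrier (G \<down> M)"
    then have x: "x \<in> carrier (G \<down> ?K)" using \<open>M \<subseteq> ?K\<close> by auto
    show "?q x \<in> carrier ((G \<down> ?K) Mod N)" using x by (rule q.hom_closed)
    fix y assume "y \<in> carrier (G \<down> M)"
    then have y: "y \<in> carrier (G \<down> ?K)" using \<open>M \<subseteq> ?K\<close> by auto
    show "?q (x \<otimes>\<^bsub>G \<down> M\<^esub> y) = ?q x \<otimes>\<^bsub>(G \<down> ?K) Mod N\<^esub> ?q y"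
      using q.hom_mult[OF x y] by simp
  qed
  have "?q ` M = carrier ((G \<down> ?K) Mod N)"
  proof
    show "?q ` M \<subseteq> carrier ((G \<down> ?K) Mod N)"
      using \<open>M \<subseteq> ?K\<close> unfolding N.quotient_surj[symmetric] by auto
    show "carrier ((G \<down> ?K) Mod N) \<subseteq> ?q ` M"
    proof
      fix u assume "u \<in> carrier ((G \<down> ?K) Mod N)"
      then obtain x where x: "x \<in> ?K" "u = ?q x" unfolding N.quotient_surj[symmetric] by auto
      have "x \<in> generate G (N \<union> M)" using x(1) by (simp add: Un_commute)
      then obtain v m where vm: "v \<in> N" "m \<in> M" "x = v \<otimes> m"
        using mult_normal_decomp[OF sub(2) M(1)] by blast
      have c: "v \<in> carrier G" "m \<in> carrier G" using vm MN by blast+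
      have "x \<otimes> inv m = v" using vm c by (simp add: m_assoc)
      then have "?q x = ?q m"
        using N.coset_eq_iff[of x m] x vm \<open>M \<subseteq> ?K\<close> sK by (auto simp: subset_iff)
      then show "u \<in> ?q ` M" using x vm by blast
    qed
  qed
  then have "solvable ((G \<down> ?K) Mod N)"
    using group_hom.surj_hom_imp_solvable[OF hom _ M(2)] by simp
  then show ?thesis using K.solvable_extension[OF nN] N(2) by simp
qed

lemma fitting_class_solvable: "fitting_class solvable"
  unfolding fitting_class_def
proof (intro conjI allI impI; (elim conjE)?)
  fix G :: "('a, 'b) monoid_scheme"
  assume "group G"
  then show "solvable (G \<down> {\<one>\<^bsub>G\<^esub>})"
    using solvable_seq.unity[of "G \<down> {\<one>\<^bsub>G\<^esub>}"] by (simp add: solvable_def)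
qed (blast intro: group_hom.surj_hom_imp_solvable group.solvable_restrict group.solvable_generate_Un)+

section \<open>Quasisimple groups and components\<close>

lemma (in group) center_normal: "group_center G \<lhd> G"
proof -
  have eq: "group_center G = {x \<in> carrier G. \<forall>y\<in>carrier G. x \<otimes> y = y \<otimes> x}"
    by (simp add: group_center_def)
  have "g \<otimes> x \<otimes> inv g = x" if "x \<in> group_center G" "g \<in> carrier G" for x g
  proof -
    have "x \<in> carrier G" "x \<otimes> g = g \<otimes> x" using that by (auto simp: group_center_def)
    then show ?thesis using that(2) by (metis m_assoc inv_closed r_inv r_one)
  qed
  then show ?thesis
    using subgroup_commute[of "carrier G"] unfolding eq[symmetric] by (simp add: normal_inv_iff)
qed

text \<open>Two conventions meet here: \<open>derived_set\<close> has the inverses at the end,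
  \<open>group_comm\<close> at the front. Replacing both entries by their inverses exchanges the
  two.\<close>

lemma (in group) derived_subset_iff:
  assumes "subgroup K G" "subgroup N G"
  shows "derived G K \<subseteq> N \<longleftrightarrow> (\<forall>x\<in>K. \<forall>y\<in>K. group_comm G x y \<in> N)"
proof -
  have c: "x \<in> carrier G" if "x \<in> K" for x using subgroup.mem_carrier[OF assms(1) that] .
  have i: "inv x \<in> K" if "x \<in> K" for x using subgroup.m_inv_closed[OF assms(1) that] .
  have gc: "x \<otimes> y \<otimes> inv x \<otimes> inv y = group_comm G (inv x) (inv y)" if "x \<in> K" "y \<in> K" for x y
    using that c by (simp add: group_comm_def)
  have "derived G K \<subseteq> N \<longleftrightarrow> derived_set G K \<subseteq> N"
    unfolding derived_def
    using generate_subgroup_incl[OF _ assms(2), of "derived_set G K"] generate.incl[of _ "derived_set G K" G]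
    by (meson order_trans subsetI)
  also have "\<dots> \<longleftrightarrow> (\<forall>x\<in>K. \<forall>y\<in>K. group_comm G (inv x) (inv y) \<in> N)"
    by (auto simp: subset_iff gc)
  also have "\<dots> \<longleftrightarrow> (\<forall>x\<in>K. \<forall>y\<in>K. group_comm G x y \<in> N)"
    using i c inv_inv by metis
  finally show ?thesis .
qed

lemma (in group) derived_abelian:
  assumes "subgroup K G" "\<And>x y. x \<in> K \<Longrightarrow> y \<in> K \<Longrightarrow> x \<otimes> y = y \<otimes> x"
  shows "derived G K = {\<one>}"
proof
  show "derived G K \<subseteq> {\<one>}"
    using assms subgroup.mem_carrier[OF assms(1)]
    by (simp add: derived_subset_iff triv_subgroup group_comm_eq_one_iff)
  show "{\<one>} \<subseteq> derived G K"
    using subgroup.one_closed[OF derived_is_subgroup[OF subgroup.subset[OF assms(1)]]] by simp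
qed

lemma (in group) nonabelian_simple_iff:
  assumes "finite (carrier G)"
  shows "nonabelian_simple G \<longleftrightarrow>
    (\<exists>x\<in>carrier G. \<exists>y\<in>carrier G. x \<otimes> y \<noteq> y \<otimes> x) \<and> (\<forall>N. N \<lhd> G \<longrightarrow> N = carrier G \<or> N = {\<one>})"
proof -
  have comm: "comm_group G \<longleftrightarrow> (\<forall>x\<in>carrier G. \<forall>y\<in>carrier G. x \<otimes> y = y \<otimes> x)"
    using group_comm_groupI comm_groupE(4)[of G] by auto
  have "order G > 1" if "x \<in> carrier G" "y \<in> carrier G" "x \<otimes> y \<noteq> y \<otimes> x" for x y
  proof -
    have "x \<noteq> \<one>" using that by auto
    then have "{x, \<one>} \<subseteq> carrier G" "card {x, \<one>} = 2" using that by auto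
    then have "2 \<le> order G" unfolding order_def using card_mono[OF assms] by metis
    then show ?thesis by simp
  qed
  then show ?thesis
    unfolding nonabelian_simple_def simple_group_def simple_group_axioms_def comm using is_group by blast
qed

text \<open>If a normal \<open>N\<close> covers the quotient by the centre \<open>Z\<close>, then
  \<open>G = NZ\<close>; commutators with elements of \<open>Z\<close> vanish, so all commutators
  lie in \<open>N\<close>, and perfectness gives \<open>N = G\<close>. Conversely, preimages show
  that the central quotient has no proper nontrivial normal subgroup, and it is nonabelian because
  \<open>G\<close> is perfect and nontrivial.\<close>

lemma (in group) quasisimple_iff:
  assumes "finite (carrier G)"
  shows "quasisimple G \<longleftrightarrow> derived G (carrier G) = carrier G \<and> carrier G \<noteq> {\<one>} \<and>
    (\<forall>N. N \<lhd> G \<longrightarrow> N = carrier G \<or> N \<subseteq> group_center G)"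
proof
  interpret Z: normal "group_center G" G by (rule center_normal)
  interpret q: group_hom G "G Mod group_center G" "\<lambda>x. group_center G #> x" by (rule Z.quotient_hom)
  have finq: "finite (carrier (G Mod group_center G))" using assms by (rule Z.finite_quotient)
  {
    assume Q: "quasisimple G"
    then have perfect: "derived G (carrier G) = carrier G" by (simp add: quasisimple_def)
    have ns: "(\<exists>x\<in>carrier (G Mod group_center G). \<exists>y\<in>carrier (G Mod group_center G).
          x \<otimes>\<^bsub>G Mod group_center G\<^esub> y \<noteq> y \<otimes>\<^bsub>G Mod group_center G\<^esub> x)"
      "\<And>N. N \<lhd> G Mod group_center G \<Longrightarrow> N = carrier (G Mod group_center G) \<or> N = {group_center G}"
      using Q by (simp_all add: quasisimple_def q.H.nonabelian_simple_iff[OF finq] del: mult_FactGroup)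
    have "carrier G \<noteq> {\<one>}"
    proof
      assume "carrier G = {\<one>}"
      then have "\<And>x. x \<in> carrier (G Mod group_center G) \<Longrightarrow> x = \<one>\<^bsub>G Mod group_center G\<^esub>"
        unfolding Z.quotient_surj[symmetric] using q.hom_one by auto
      then show False using ns(1) by (metis q.H.one_closed)
    qed
    moreover have "N = carrier G \<or> N \<subseteq> group_center G" if N: "N \<lhd> G" for N
      using ns(2)[OF Z.image_in_quotient_normal[OF N]]
    proof
      have sN: "subgroup N G" using N by (rule normal_imp_subgroup)
      assume "(\<lambda>x. group_center G #> x) ` N = {group_center G}"
      then have "N \<subseteq> group_center G"
        using Z.coset_eq_self_iff[OF subgroup.mem_carrier[OF sN]] by (metis imageI singletonD subsetI)
      then show ?thesis ..
    next
      have sN: "subgroup N G" using N by (rule normal_imp_subgroup)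
      have NZ: "N \<union> group_center G \<subseteq> carrier G" using subgroup.subset[OF sN] Z.subset by blast
      assume all: "(\<lambda>x. group_center G #> x) ` N = carrier (G Mod group_center G)"
      have gen: "carrier G \<subseteq> generate G (N \<union> group_center G)"
      proof
        fix x assume x: "x \<in> carrier G"
        then obtain y where y: "y \<in> N" "group_center G #> x = group_center G #> y"
          using all q.hom_closed[OF x] by (metis (no_types, lifting) imageE)
        have yc: "y \<in> carrier G" using y subgroup.mem_carrier[OF sN] by blast
        have "x \<otimes> inv y \<in> group_center G" using y x yc Z.coset_eq_iff by blast
        then have "(x \<otimes> inv y) \<otimes> y \<in> generate G (N \<union> group_center G)"
          by (intro generate.eng generate.incl UnI1[OF y(1)] UnI2)
        then show "x \<in> generate G (N \<union> group_center G)" using x yc by (simp add: m_assoc)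
      qed
      have z: "group_comm G a b = \<one>" if "a \<in> group_center G" "b \<in> carrier G" for a b
      proof -
        have "a \<in> carrier G" "a \<otimes> b = b \<otimes> a" using that unfolding group_center_def by blast+
        then show ?thesis using group_comm_eq_one_iff that(2) by blast
      qed
      have "group_comm G a b \<in> N" if a: "a \<in> N \<union> group_center G" and b: "b \<in> N \<union> group_center G" for a b
      proof (cases "a \<in> N")
        case True
        then show ?thesis using normal_group_comm(1)[OF N] b NZ by blast
      next
        case False
        then show ?thesis using z[of a b] a b NZ subgroup.one_closed[OF sN] by auto
      qed
      then have "group_comm G a b \<in> N" if "a \<in> carrier G" "b \<in> carrier G" for a b
        using group_comm_generate[OF N NZ NZ] gen that by blast
      then have "derived G (carrier G) \<subseteq> N" using derived_subset_iff[OF subgroup_self sN] by blast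
      then show ?thesis using perfect subgroup.subset[OF sN] by blast
    qed
    ultimately show "derived G (carrier G) = carrier G \<and> carrier G \<noteq> {\<one>} \<and>
      (\<forall>N. N \<lhd> G \<longrightarrow> N = carrier G \<or> N \<subseteq> group_center G)" using perfect by blast
  }
  assume Q: "derived G (carrier G) = carrier G \<and> carrier G \<noteq> {\<one>} \<and>
    (\<forall>N. N \<lhd> G \<longrightarrow> N = carrier G \<or> N \<subseteq> group_center G)"
  have nonab: "\<not> carrier G \<subseteq> group_center G"
  proof
    assume "carrier G \<subseteq> group_center G"
    then have "derived G (carrier G) = {\<one>}"
      unfolding group_center_def by (intro derived_abelian[OF subgroup_self]) blast
    then show False using Q by blast
  qed
  have "nonabelian_simple (G Mod group_center G)"
    unfolding q.H.nonabelian_simple_iff[OF finq]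
  proof (intro conjI allI impI)
    show "\<exists>x\<in>carrier (G Mod group_center G). \<exists>y\<in>carrier (G Mod group_center G).
          x \<otimes>\<^bsub>G Mod group_center G\<^esub> y \<noteq> y \<otimes>\<^bsub>G Mod group_center G\<^esub> x"
    proof (rule ccontr)
      assume "\<not> ?thesis"
      then have "comm_group (G Mod group_center G)"
        using q.H.group_comm_groupI by blast
      then have "derived G (carrier G) \<subseteq> group_center G"
        using derived_minimal[OF center_normal] by blast
      then show False using Q nonab by blast
    qed
    fix N assume N: "N \<lhd> G Mod group_center G"
    let ?P = "{x \<in> carrier G. group_center G #> x \<in> N}"
    have sN: "subgroup N (G Mod group_center G)" using N by (rule normal_imp_subgroup)
    have NP: "N = (\<lambda>x. group_center G #> x) ` ?P"
      using subgroup.subset[OF sN] unfolding Z.quotient_surj[symmetric] by blast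
    have "?P = carrier G \<or> ?P \<subseteq> group_center G" using q.preimage_normal[OF N] Q by blast
    then show "N = carrier (G Mod group_center G) \<or> N = {\<one>\<^bsub>G Mod group_center G\<^esub>}"
    proof
      assume "?P = carrier G"
      then show ?thesis using NP Z.quotient_surj by simp
    next
      assume "?P \<subseteq> group_center G"
      then have "N \<subseteq> {group_center G}" using NP Z.coset_eq_self_iff by blast
      then show ?thesis using subgroup.one_closed[OF sN] by auto
    qed
  qed
  then show "quasisimple G" using Q by (simp add: quasisimple_def)
qed

text \<open>By \<open>quasisimple_iff\<close>: a normal subgroup of \<open>H\<close> is the image of
  its preimage, which is all of \<open>G\<close> or central, and a surjective map sends central
  elements to central ones.\<close>

lemma (in group_hom) quasisimple_image:
  assumes surj: "h ` carrier G = carrier H" and fin: "finite (carrier G)"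
    and Q: "quasisimple G" and nt: "carrier H \<noteq> {\<one>\<^bsub>H\<^esub>}"
  shows "quasisimple H"
proof -
  have finH: "finite (carrier H)" using surj fin by (metis finite_imageI)
  have Q: "derived G (carrier G) = carrier G" "\<And>N. N \<lhd> G \<Longrightarrow> N = carrier G \<or> N \<subseteq> group_center G"
    using Q G.quasisimple_iff[OF fin] by blast+
  have "derived H (carrier H) = carrier H"
    using derived_img[of "carrier G"] Q(1) surj by simp
  moreover have "N = carrier H \<or> N \<subseteq> group_center H" if N: "N \<lhd> H" for N
  proof -
    have "N \<subseteq> carrier H" using normal_imp_subset[OF N] .
    then have NP: "N = h ` {x \<in> carrier G. h x \<in> N}" unfolding surj[symmetric] by blast
    from Q(2)[OF preimage_normal[OF N]] show ?thesis
    proof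
      assume "{x \<in> carrier G. h x \<in> N} = carrier G"
      then show ?thesis using NP surj by simp
    next
      assume c: "{x \<in> carrier G. h x \<in> N} \<subseteq> group_center G"
      have "h ` group_center G \<subseteq> group_center H"
        unfolding group_center_def surj[symmetric] by (auto simp flip: hom_mult)
      then show ?thesis using c NP by blast
    qed
  qed
  ultimately show ?thesis using nt H.quasisimple_iff[OF finH] by blast
qed

lemma (in group) nonabelian_simple_imp_quasisimple:
  assumes fin: "finite (carrier G)" and s: "nonabelian_simple G"
  shows "quasisimple G"
proof -
  have ns: "\<exists>x\<in>carrier G. \<exists>y\<in>carrier G. x \<otimes> y \<noteq> y \<otimes> x" "\<And>N. N \<lhd> G \<Longrightarrow> N = carrier G \<or> N = {\<one>}"
    using s nonabelian_simple_iff[OF fin] by blast+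
  have "derived G (carrier G) \<noteq> {\<one>}"
    using derived_subset_iff[OF subgroup_self triv_subgroup] ns(1) group_comm_eq_one_iff by auto
  then have "derived G (carrier G) = carrier G" using ns(2) derived_self_is_normal by blast
  moreover have "carrier G \<noteq> {\<one>}" using ns(1) by auto
  moreover have "{\<one>} \<subseteq> group_center G" by (auto simp: group_center_def)
  ultimately show ?thesis using quasisimple_iff[OF fin] ns(2) by blast
qed

lemma (in group) quasisimple_centerless:
  assumes fin: "finite (carrier G)" and Q: "quasisimple G" and Z: "group_center G \<subseteq> {\<one>}"
  shows "nonabelian_simple G"
proof -
  have Q: "derived G (carrier G) = carrier G" "carrier G \<noteq> {\<one>}"
    "\<And>N. N \<lhd> G \<Longrightarrow> N = carrier G \<or> N \<subseteq> group_center G"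
    using Q quasisimple_iff[OF fin] by blast+
  have "\<exists>x\<in>carrier G. \<exists>y\<in>carrier G. x \<otimes> y \<noteq> y \<otimes> x"
    using derived_abelian[OF subgroup_self] Q by metis
  moreover have "N = carrier G \<or> N = {\<one>}" if "N \<lhd> G" for N
    using Q(3)[OF that] Z subgroup.one_closed[OF normal_imp_subgroup[OF that]] by blast
  ultimately show ?thesis using nonabelian_simple_iff[OF fin] by blast
qed

section \<open>Components and what they centralize\<close>

definition commuting :: "('a, 'b) monoid_scheme \<Rightarrow> 'a set \<Rightarrow> 'a set \<Rightarrow> bool" where
  "commuting G A B \<longleftrightarrow> (\<forall>a\<in>A. \<forall>b\<in>B. a \<otimes>\<^bsub>G\<^esub> b = b \<otimes>\<^bsub>G\<^esub> a)"

lemma commuting_sym: "commuting G A B \<Longrightarrow> commuting G B A"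
  by (auto simp: commuting_def)

lemma commuting_mono: "commuting G A B \<Longrightarrow> A' \<subseteq> A \<Longrightarrow> B' \<subseteq> B \<Longrightarrow> commuting G A' B'"
  by (auto simp: commuting_def)

lemma (in group) commuting_generate:
  assumes "A \<subseteq> carrier G" "B \<subseteq> carrier G" "commuting G A B"
  shows "commuting G (generate G A) (generate G B)"
  using generate_commute[OF assms(1,2)] assms(3) unfolding commuting_def by blast

definition component :: "('a, 'b) monoid_scheme \<Rightarrow> 'a set \<Rightarrow> bool" where
  "component G Q \<longleftrightarrow> subnormal G Q \<and> quasisimple (G \<down> Q)"

lemma (in group) componentD:
  assumes "finite (carrier G)" "component G Q"
  shows "subgroup Q G" "derived G Q = Q" "Q \<noteq> {\<one>}"
    and "\<And>N. N \<lhd> (G \<down> Q) \<Longrightarrow> N = Q \<or> commuting G Q N"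
proof -
  show sQ: "subgroup Q G" using assms(2) subnormal_imp_subgroup by (simp add: component_def)
  interpret Q: group "G \<down> Q" using sQ by (rule subgroup_imp_group)
  have fin: "finite (carrier (G \<down> Q))"
    using finite_subgroup[OF sQ assms(1)] by simp
  have *: "quasisimple (G \<down> Q)" using assms(2) by (simp add: component_def)
  show "derived G Q = Q" "Q \<noteq> {\<one>}" 
    using * derived_consistent[OF order_refl sQ] by (simp_all add: Q.quasisimple_iff[OF fin])
  show "N = Q \<or> commuting G Q N" if "N \<lhd> (G \<down> Q)" for N
  proof -
    have "N = Q \<or> N \<subseteq> group_center (G \<down> Q)"
      using * that Q.quasisimple_iff[OF fin] by simp
    then show ?thesis by (auto simp: commuting_def group_center_def)
  qed
qed

lemma (in group) hall_witt:
  assumes "x \<in> carrier G" "y \<in> carrier G" "z \<in> carrier G"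
  shows "(inv y \<otimes> group_comm G (group_comm G x (inv y)) z \<otimes> y) \<otimes>
    (inv z \<otimes> group_comm G (group_comm G y (inv z)) x \<otimes> z) \<otimes>
    (inv x \<otimes> group_comm G (group_comm G z (inv x)) y \<otimes> x) = \<one>"
  using assms by (simp add: group_comm_def group_word)

text \<open>The three subgroup lemma for a perfect group: \<open>[Q, N, Q] = 1\<close> forces \<open>[Q, N] = 1\<close>.\<close>

lemma (in group) perfect_commuting:
  assumes Q: "subgroup Q G" "derived G Q = Q" and N: "subgroup N G"
    and comm: "\<And>q n. q \<in> Q \<Longrightarrow> n \<in> N \<Longrightarrow> commuting G {group_comm G q n} Q"
  shows "commuting G Q N"
  unfolding commuting_def
proof (intro ballI)
  fix q n assume q: "q \<in> Q" and n: "n \<in> N"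
  have c: "x \<in> carrier G" "inv x \<in> Q" if "x \<in> Q" for x
    using subgroup.mem_carrier[OF Q(1) that] subgroup.m_inv_closed[OF Q(1) that] .
  have nc: "n \<in> carrier G" "inv n \<in> N"
    using subgroup.mem_carrier[OF N n] subgroup.m_inv_closed[OF N n] .
  let ?C = "{x \<in> carrier G. \<forall>y\<in>{n}. x \<otimes> y = y \<otimes> x}"
  have sC: "subgroup ?C G" by (rule subgroup_commute) (use nc in simp)
  have w: "w \<otimes> x = x \<otimes> w" if "w \<in> {group_comm G a m, inv (group_comm G a m)}" "a \<in> Q" "x \<in> Q" "m \<in> N" for a x m w
  proof -
    have d: "group_comm G a m \<in> carrier G" using c(1)[OF that(2)] subgroup.mem_carrier[OF N that(4)] by simp
    have s: "subgroup {w \<in> carrier G. \<forall>y\<in>{x}. w \<otimes> y = y \<otimes> w} G"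
      by (rule subgroup_commute) (use c(1)[OF that(3)] in simp)
    have "group_comm G a m \<in> {w \<in> carrier G. \<forall>y\<in>{x}. w \<otimes> y = y \<otimes> w}"
      using comm[OF that(2,4)] d that(3) by (auto simp: commuting_def)
    then show ?thesis using subgroup.m_inv_closed[OF s] that(1) by auto
  qed
  have "group_comm G a b \<in> ?C" if a: "a \<in> Q" and b: "b \<in> Q" for a b
  proof -
    note cs = c(1)[OF a] c(1)[OF b] nc(1)
    have "group_comm G n (inv a) = inv (group_comm G (inv a) n)"
      using cs by (simp add: group_comm_def group_word)
    then have "group_comm G n (inv a) \<otimes> inv b = inv b \<otimes> group_comm G n (inv a)"
      using w[OF _ c(2)[OF a] c(2)[OF b] n] by simp
    then have "group_comm G (group_comm G n (inv a)) (inv b) = \<one>"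
      using cs by (simp add: group_comm_eq_one_iff)
    moreover have "group_comm G (group_comm G (inv b) (inv n)) a = \<one>"
      using w[OF _ c(2)[OF b] a nc(2)] cs by (simp add: group_comm_eq_one_iff)
    ultimately have "b \<otimes> group_comm G (group_comm G a b) n \<otimes> inv b = \<one>"
      using hall_witt[of a "inv b" n] cs by simp
    then have "inv b \<otimes> (b \<otimes> group_comm G (group_comm G a b) n \<otimes> inv b) \<otimes> b = inv b \<otimes> \<one> \<otimes> b" by simp
    then have "group_comm G (group_comm G a b) n = \<one>" using cs by (simp add: m_assoc)
    then show ?thesis using cs group_comm_eq_one_iff by simp
  qed
  then have "derived G Q \<subseteq> ?C" using derived_subset_iff[OF Q(1) sC] by blast
  then show "q \<otimes> n = n \<otimes> q" using Q(2) q by auto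
qed

text \<open>Climbs the subnormal chain from \<open>K\<close> to \<open>G\<close>. If
  \<open>L\<close> is normal in \<open>K\<close> and contains \<open>Q\<close>, then commutators of
  \<open>Q\<close> with \<open>N \<inter> K\<close> fall into \<open>N \<inter> L\<close>, which
  \<open>Q\<close> centralizes; the three subgroup lemma then lets \<open>Q\<close> centralize
  \<open>N \<inter> K\<close>.\<close>

lemma (in group) perfect_commuting_subnormal:
  assumes N: "N \<lhd> G" and "subnormal G K" and "subgroup Q G" "derived G Q = Q" "Q \<subseteq> K"
    and "commuting G Q (N \<inter> K)"
  shows "commuting G Q N"
  using assms(2,5,6)
proof (induction rule: subnormal.induct)
  case self
  moreover have "N \<inter> carrier G = N" using normal_imp_subset[OF N] by blast
  ultimately show ?case by simp
next
  case (step K L)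
  have sK: "subgroup K G" using step(1) subnormal_imp_subgroup by blast
  have L: "subgroup L G" "L \<subseteq> K" "\<And>k x. k \<in> K \<Longrightarrow> x \<in> L \<Longrightarrow> k \<otimes> x \<otimes> inv k \<in> L"
    using step(2) normal_restrict_iff[OF sK] by blast+
  have "commuting G Q (N \<inter> K)"
  proof (rule perfect_commuting[OF assms(3,4)])
    show "subgroup (N \<inter> K) G" using N sK normal_imp_subgroup subgroups_Inter_pair by blast
    fix q n assume q: "q \<in> Q" and n: "n \<in> N \<inter> K"
    interpret K: group "G \<down> K" using sK by (rule subgroup_imp_group)
    have qc: "q \<in> carrier G" "q \<in> L" using subgroup.mem_carrier[OF assms(3) q] q step.prems by auto
    have "group_comm G q n \<in> N" using normal_group_comm(2)[OF N qc(1)] n by blast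
    moreover have "group_comm (G \<down> K) q n \<in> L"
      using K.normal_group_comm(1)[OF step(2) _ qc(2), of n] n by simp
    then have "group_comm G q n \<in> L" using group_comm_restrict[OF sK] qc L n by auto
    ultimately show "commuting G {group_comm G q n} Q"
      using step.prems commuting_sym[of G Q] by (auto simp: commuting_def)
  qed
  then show ?case using step.IH step.prems L by blast
qed

text \<open>\<open>N \<inter> Q\<close> is normal in the quasisimple group \<open>Q\<close>, so it
  is \<open>Q\<close> or central in \<open>Q\<close>. In the second case the subnormal chain from
  \<open>Q\<close> to \<open>G\<close> spreads the commutation to all of \<open>N\<close>.\<close>

lemma (in group) component_normal_cases:
  assumes "finite (carrier G)" "component G Q" "N \<lhd> G"
  shows "Q \<subseteq> N \<or> commuting G Q N"
proof -
  note Q = componentD[OF assms(1,2)]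
  have "N \<inter> Q \<lhd> (G \<down> Q)" using normal_Int_restrict[OF assms(3) Q(1)] .
  then have "N \<inter> Q = Q \<or> commuting G Q (N \<inter> Q)" by (rule Q(4))
  then show ?thesis
    using perfect_commuting_subnormal[OF assms(3) _ Q(1,2) order_refl] assms(2) by (auto simp: component_def)
qed

lemma (in group) component_restrict:
  assumes "component G Q" "subgroup H G" "Q \<subseteq> H"
  shows "component (G \<down> H) Q"
  using assms subnormal_restrict by (simp add: component_def)

lemma component_subnormal_trans:
  assumes "component (G \<down> H) Q" "subnormal G H"
  shows "component G Q"
  using assms subnormal_trans by (auto simp: component_def)

text \<open>Descends along the chain: while \<open>Q\<close> lies in the current term it is a
  component there and the normal case decides; once it commutes with a term, it commutes with
  everything below.\<close>

lemma (in group) component_subnormal_cases: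
  assumes fin: "finite (carrier G)" and Q: "component G Q" and "subnormal G K"
  shows "Q \<subseteq> K \<or> commuting G Q K"
  using assms(3)
proof (induction rule: subnormal.induct)
  case self
  show ?case using subgroup.subset[OF componentD(1)[OF fin Q]] by blast
next
  case (step K L)
  have sK: "subgroup K G" using step(1) subnormal_imp_subgroup by blast
  interpret K: group "G \<down> K" using sK by (rule subgroup_imp_group)
  have L: "L \<subseteq> K" using step(2) normal_restrict_iff[OF sK] by blast
  from step.IH show ?case
  proof
    assume "Q \<subseteq> K"
    then have "component (G \<down> K) Q" using component_restrict[OF Q sK] by blast
    moreover have "finite (carrier (G \<down> K))"
      using finite_subgroup[OF sK fin] by simp
    ultimately show ?thesis
      using K.component_normal_cases[OF _ _ step(2)] by (auto simp: commuting_def)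
  qed (use L commuting_mono in blast)
qed

text \<open>Distinct components cannot each contain the other, so for at least one order of the two
  the alternative for subnormal subgroups leaves only commutation.\<close>

lemma (in group) components_commuting:
  assumes "finite (carrier G)" "component G Q" "component G R" "Q \<noteq> R"
  shows "commuting G Q R"
proof (cases "Q \<subseteq> R")
  case True
  then have "\<not> R \<subseteq> Q" using assms(4) by blast
  then show ?thesis
    using component_subnormal_cases[OF assms(1,3)] assms(2) commuting_sym by (auto simp: component_def)
next
  case False
  then show ?thesis
    using component_subnormal_cases[OF assms(1,2)] assms(3) by (auto simp: component_def)
qed

lemma (in group) perfect_not_solvable:
  assumes Q: "subgroup Q G" "derived G Q = Q" "Q \<noteq> {\<one>}"
  shows "\<not> solvable (G \<down> Q)"
proof
  interpret Q: group "G \<down> Q" using Q(1) by (rule subgroup_imp_group)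
  assume "solvable (G \<down> Q)"
  then obtain n where n: "(derived (G \<down> Q) ^^ n) Q = {\<one>}"
    using Q.solvable_iff_trivial_derived_seq by auto
  have "(derived (G \<down> Q) ^^ n) Q = Q" for n
    using derived_consistent[OF order_refl Q(1)] Q(2) by (induction n) simp_all
  then show False using n Q(3) by simp
qed

lemma (in group) nilpotent_imp_solvable:
  assumes "nilpotent_group G" shows "solvable G"
proof -
  have "(derived G ^^ i) (carrier G) \<subseteq> lower_central G i" for i
  proof (induction i)
    case (Suc i)
    let ?D = "(derived G ^^ i) (carrier G)"
    have sD: "subgroup ?D G" using exp_of_derived_is_subgroup[OF subgroup_self] .
    have "group_comm G x y \<in> lower_central G (Suc i)" if "x \<in> ?D" "y \<in> ?D" for x y
      using that Suc subgroup.mem_carrier[OF sD] by (auto intro!: generate.incl)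
    then show ?case using derived_subset_iff[OF sD lower_central_subgroup[of "Suc i"]] by simp
  qed simp
  then obtain n where "(derived G ^^ n) (carrier G) \<subseteq> {\<one>}"
    using assms nilpotent_iff by blast
  moreover have "\<one> \<in> (derived G ^^ n) (carrier G)"
    using subgroup.one_closed[OF exp_of_derived_is_subgroup[OF subgroup_self]] .
  ultimately show ?thesis using solvable_iff_trivial_derived_seq by blast
qed

lemma (in group) component_commuting_solvable:
  assumes fin: "finite (carrier G)" and Q: "component G Q" and N: "N \<lhd> G" "solvable (G \<down> N)"
  shows "commuting G Q N"
proof -
  note Q' = componentD[OF fin Q]
  have sN: "subgroup N G" using N(1) by (rule normal_imp_subgroup)
  have "\<not> Q \<subseteq> N"
  proof
    assume "Q \<subseteq> N"
    then have "subgroup Q (G \<down> N)" using Q'(1) sN subgroup_restrict_iff by blast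
    then have "solvable (G \<down> Q)"
      using group.solvable_restrict[OF subgroup_imp_group[OF sN] _ N(2)] by simp
    then show False using perfect_not_solvable[OF Q'(1-3)] by blast
  qed
  then show ?thesis using component_normal_cases[OF fin Q N(1)] by blast
qed

lemma (in group_hom) component_image:
  assumes fin: "finite (carrier G)" and nor: "h ` carrier G \<lhd> H" and Q: "component G Q"
    and nt: "h ` Q \<noteq> {\<one>\<^bsub>H\<^esub>}"
  shows "component H (h ` Q)"
proof -
  have sQ: "subgroup Q G" using G.componentD(1)[OF fin Q] .
  interpret Q: group_hom "G \<down> Q" "H \<down> h ` Q" h using restrict_hom[OF sQ] .
  have "quasisimple (H \<down> h ` Q)"
    by (rule Q.quasisimple_image)
      (use Q nt finite_subgroup[OF sQ fin] in \<open>simp_all add: component_def\<close>)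
  then show ?thesis using subnormal_image'[OF nor] Q by (simp add: component_def)
qed

lemma (in group) conj_component:
  assumes "finite (carrier G)" "component G Q" "g \<in> carrier G"
  shows "component G ((\<lambda>x. g \<otimes> x \<otimes> inv g) ` Q)"
proof -
  interpret c: group_hom G G "\<lambda>x. g \<otimes> x \<otimes> inv g" using conj_hom[OF assms(3)] .
  have "\<exists>x\<in>Q. x \<noteq> \<one>"
    using componentD(1,3)[OF assms(1,2)] subgroup.one_closed by blast
  then obtain x where x: "x \<in> Q" "x \<noteq> \<one>" by blast
  have xc: "x \<in> carrier G" using subgroup.mem_carrier[OF componentD(1)[OF assms(1,2)] x(1)] .
  have "g \<otimes> x \<otimes> inv g \<noteq> \<one>"
  proof
    assume "g \<otimes> x \<otimes> inv g = \<one>"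
    then have "inv g \<otimes> (g \<otimes> x \<otimes> inv g) \<otimes> g = inv g \<otimes> \<one> \<otimes> g" by simp
    then show False using assms(3) xc x(2) by (simp add: m_assoc)
  qed
  then have nt: "(\<lambda>x. g \<otimes> x \<otimes> inv g) ` Q \<noteq> {\<one>}" using x by blast
  have "(\<lambda>x. g \<otimes> x \<otimes> inv g) ` carrier G \<lhd> G"
    using conj_hom_surj[OF assms(3)] normal_self by simp
  then show ?thesis using c.component_image[OF assms(1) _ assms(2) nt] by blast
qed

section \<open>The generalized Fitting subgroup\<close>

lemma gen_fitting_subgroup_component:
  "gen_fitting_subgroup G = generate G (fitting_subgroup G \<union> \<Union>{Q. component G Q})"
  by (simp add: gen_fitting_subgroup_def component_def)

lemmas fitting_greatest = class_radical_greatest[OF fitting_class_nilpotent, folded fitting_subgroup_class]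

lemma (in group) union_components_subset:
  assumes "finite (carrier G)"
  shows "\<Union>{Q. component G Q} \<subseteq> carrier G"
  using componentD(1)[OF assms] subgroup.subset by blast

lemma radical_fitting: "radical fitting_subgroup"
  unfolding fitting_subgroup_class by (rule radical_class_radical[OF fitting_class_nilpotent])

lemma (in group) subset_gen_fitting:
  assumes "finite (carrier G)"
  shows "fitting_subgroup G \<subseteq> gen_fitting_subgroup G" "component G Q \<Longrightarrow> Q \<subseteq> gen_fitting_subgroup G"
    "subgroup (gen_fitting_subgroup G) G"
proof -
  have "fitting_subgroup G \<subseteq> carrier G"
    using fitting_greatest(1)[OF is_group assms] normal_imp_subgroup subgroup.subset by blast
  then show "subgroup (gen_fitting_subgroup G) G"
    unfolding gen_fitting_subgroup_component using union_components_subset[OF assms]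
    by (intro generate_is_subgroup) blast
  show "fitting_subgroup G \<subseteq> gen_fitting_subgroup G" "component G Q \<Longrightarrow> Q \<subseteq> gen_fitting_subgroup G"
    unfolding gen_fitting_subgroup_component by (auto intro: generate.incl)
qed

text \<open>Write an element of \<open>L \<inter> F*(G)\<close> as \<open>f e\<^sub>1 e\<^sub>2\<close>, where \<open>e\<^sub>1\<close> comes from the components
  inside \<open>L\<close> and \<open>e\<^sub>2\<close> from the others. The latter centralize \<open>L\<close>, so \<open>e\<^sub>2\<close> is central in their
  product and hence lies in the Fitting subgroup.\<close>

lemma (in group) gen_fitting_Int:
  assumes fin: "finite (carrier G)" and L: "L \<lhd> G"
  shows "L \<inter> gen_fitting_subgroup G \<subseteq> gen_fitting_subgroup (G \<down> L)"
proof
  let ?L = "G \<down> L"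
  define F where "F = fitting_subgroup G"
  define C1 where "C1 = \<Union>{Q. component G Q \<and> Q \<subseteq> L}"
  define C2 where "C2 = \<Union>{Q. component G Q \<and> \<not> Q \<subseteq> L}"
  have sL: "subgroup L G" using L by (rule normal_imp_subgroup)
  have LG: "L \<subseteq> carrier G" using sL by (rule subgroup.subset)
  interpret L: group ?L using sL by (rule subgroup_imp_group)
  have finL: "finite (carrier ?L)" using finite_subset[OF LG fin] by simp
  have F: "F \<lhd> G" "nilpotent_group (G \<down> F)"
    unfolding F_def using fitting_greatest(1,2)[OF is_group fin] by auto
  have sF: "subgroup F G" using F(1) by (rule normal_imp_subgroup)
  have FG: "F \<subseteq> carrier G" using sF by (rule subgroup.subset)
  have solF: "solvable (G \<down> F)"
    using group.nilpotent_imp_solvable[OF subgroup_imp_group[OF sF] F(2)] .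
  have C: "C1 \<subseteq> carrier G" "C2 \<subseteq> carrier G"
    unfolding C1_def C2_def using union_components_subset[OF fin] by blast+
  have "commuting G C2 F"
    unfolding commuting_def C2_def
    using component_commuting_solvable[OF fin _ F(1) solF] by (auto simp: commuting_def)
  then have c2F: "commuting G (generate G C2) F"
    using commuting_generate[OF C(2) FG] commuting_mono[OF _ order_refl] generate.incl[of _ F G] by blast
  have "commuting G C2 L"
    unfolding commuting_def C2_def
    using component_normal_cases[OF fin _ L] by (fastforce simp: commuting_def)
  then have c2L: "commuting G (generate G C2) L"
    using commuting_generate[OF C(2) LG] commuting_mono[OF _ order_refl] generate.incl[of _ L G] by blast
  have nC: "generate G C2 \<lhd> G"
  proof (rule normal_generateI[OF C(2)])
    fix h g assume "h \<in> C2" and g: "g \<in> carrier G"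
    then obtain Q where Q: "component G Q" "\<not> Q \<subseteq> L" "h \<in> Q" unfolding C2_def by blast
    let ?Q = "(\<lambda>x. g \<otimes> x \<otimes> inv g) ` Q"
    have "\<not> ?Q \<subseteq> L"
    proof
      assume s: "?Q \<subseteq> L"
      have "x \<in> L" if "x \<in> Q" for x
      proof -
        have xc: "x \<in> carrier G" using subgroup.mem_carrier[OF componentD(1)[OF fin Q(1)] that] .
        have "inv g \<otimes> (g \<otimes> x \<otimes> inv g) \<otimes> g \<in> L"
          using normal_conjD(2)[OF L _ g] s that by blast
        then show ?thesis using g xc by (simp add: m_assoc)
      qed
      then show False using Q(2) by blast
    qed
    then show "g \<otimes> h \<otimes> inv g \<in> C2"
      unfolding C2_def using conj_component[OF fin Q(1) g] Q(3) by blast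
  qed
  fix x assume "x \<in> L \<inter> gen_fitting_subgroup G"
  then have x: "x \<in> L" "x \<in> generate G (F \<union> \<Union>{Q. component G Q})"
    by (simp_all add: gen_fitting_subgroup_component F_def)
  have eq: "F \<union> \<Union>{Q. component G Q} = (F \<union> C1) \<union> C2" unfolding C1_def C2_def by blast
  let ?FC = "generate G (F \<union> C1)"
  have FC: "F \<union> C1 \<subseteq> carrier G" using FG C by blast
  have "(F \<union> C1) \<union> C2 \<subseteq> ?FC \<union> generate G C2" by (auto intro: generate.incl)
  then have "x \<in> generate G (?FC \<union> generate G C2)"
    using x(2) mono_generate unfolding eq by blast
  then obtain y e2 where y: "y \<in> ?FC" "e2 \<in> generate G C2" "x = y \<otimes> e2"
    using mult_normal_decomp[OF generate_is_subgroup[OF FC] nC] by blast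
  have sC1: "subgroup (generate G C1) G" using generate_is_subgroup[OF C(1)] .
  have "F \<union> C1 \<subseteq> generate G C1 \<union> F" by (auto intro: generate.incl)
  then have "y \<in> generate G (generate G C1 \<union> F)" using y(1) mono_generate by blast
  then obtain e1 f where e: "e1 \<in> generate G C1" "f \<in> F" "y = e1 \<otimes> f"
    using mult_normal_decomp[OF sC1 F(1)] by blast
  have cc [simp]: "e1 \<in> carrier G" "e2 \<in> carrier G" "f \<in> carrier G" "x \<in> carrier G"
    using e y x LG FG generate_in_carrier C by blast+
  have "C1 \<subseteq> L" unfolding C1_def by blast
  then have e1L: "e1 \<in> L" using generate_subgroup_incl[OF _ sL] e(1) by blast
  have xe: "x = e1 \<otimes> (f \<otimes> e2)" using y e by (simp add: m_assoc)
  have "f \<otimes> e2 = inv e1 \<otimes> x" using xe by simp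
  then have feL: "f \<otimes> e2 \<in> L" using e1L x(1) sL subgroup.m_closed subgroup.m_inv_closed by fastforce
  have "e2 \<otimes> z = z \<otimes> e2" if z: "z \<in> generate G C2" for z
  proof -
    have zc: "z \<in> carrier G" using generate_in_carrier[OF C(2) z] .
    have 1: "z \<otimes> (f \<otimes> e2) = (f \<otimes> e2) \<otimes> z" using c2L z feL unfolding commuting_def by blast
    have 2: "z \<otimes> f = f \<otimes> z" using c2F z e(2) unfolding commuting_def by blast
    have "f \<otimes> (z \<otimes> e2) = f \<otimes> (e2 \<otimes> z)" using 1 2 zc by (metis cc(2,3) m_assoc)
    then show ?thesis using zc by simp
  qed
  then have e2Z: "e2 \<in> group_center (G \<down> generate G C2)"
    using y(2) by (simp add: group_center_def)
  let ?Z = "group_center (G \<down> generate G C2)"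
  have sC2: "subgroup (generate G C2) G" using nC by (rule normal_imp_subgroup)
  interpret C2: group "G \<down> generate G C2" using sC2 by (rule subgroup_imp_group)
  have sZ: "subgroup ?Z G"
    using normal_imp_subgroup[OF C2.center_normal] subgroup_restrict_iff[OF sC2] by blast
  have "?Z \<lhd> G"
  proof -
    have "g \<otimes> z \<otimes> inv g \<in> ?Z" if z: "z \<in> ?Z" and g: "g \<in> carrier G" for g z
    proof -
      have zC: "z \<in> generate G C2" "\<And>w. w \<in> generate G C2 \<Longrightarrow> z \<otimes> w = w \<otimes> z"
        using z by (auto simp: group_center_def)
      have zc: "z \<in> carrier G" using generate_in_carrier[OF C(2) zC(1)] .
      have "g \<otimes> z \<otimes> inv g \<otimes> w = w \<otimes> (g \<otimes> z \<otimes> inv g)" if w: "w \<in> generate G C2" for w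
      proof -
        have wc: "w \<in> carrier G" using generate_in_carrier[OF C(2) w] .
        have "z \<otimes> (inv g \<otimes> w \<otimes> g) = (inv g \<otimes> w \<otimes> g) \<otimes> z"
          using zC(2) normal_conjD(2)[OF nC w g] by blast
        then have "g \<otimes> (z \<otimes> (inv g \<otimes> w \<otimes> g)) \<otimes> inv g = g \<otimes> ((inv g \<otimes> w \<otimes> g) \<otimes> z) \<otimes> inv g" by simp
        then show ?thesis using g wc zc by (simp add: m_assoc)
      qed
      then show ?thesis using normal_conjD(1)[OF nC zC(1) g] by (simp add: group_center_def)
    qed
    then show ?thesis using sZ by (simp add: normal_inv_iff)
  qed
  moreover have "nilpotent_group (G \<down> ?Z)"
  proof -
    interpret Z: group "G \<down> ?Z" using sZ by (rule subgroup_imp_group)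
    have "comm_group (G \<down> ?Z)"
    proof (rule Z.group_comm_groupI)
      fix a b assume "a \<in> carrier (G \<down> ?Z)" "b \<in> carrier (G \<down> ?Z)"
      then have "b \<in> generate G C2" "\<And>w. w \<in> generate G C2 \<Longrightarrow> a \<otimes> w = w \<otimes> a"
        by (auto simp: group_center_def)
      then show "a \<otimes>\<^bsub>G \<down> ?Z\<^esub> b = b \<otimes>\<^bsub>G \<down> ?Z\<^esub> a" by simp
    qed
    then show ?thesis by (rule comm_group.comm_group_nilpotent)
  qed
  ultimately have "e2 \<in> F"
    using fitting_greatest(3)[OF is_group fin] e2Z unfolding F_def by blast
  then have "f \<otimes> e2 \<in> L \<inter> F" using feL subgroup.m_closed[OF sF e(2)] by simp
  then have "f \<otimes> e2 \<in> fitting_subgroup ?L"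
    using radical_restrict[OF radical_fitting is_group fin L] unfolding F_def by simp
  then have "f \<otimes> e2 \<in> gen_fitting_subgroup ?L" using L.subset_gen_fitting(1)[OF finL] by blast
  moreover have "C1 \<subseteq> gen_fitting_subgroup ?L"
    unfolding C1_def using component_restrict[OF _ sL] L.subset_gen_fitting(2)[OF finL] by blast
  then have "generate G C1 \<subseteq> gen_fitting_subgroup ?L"
    using generate_subgroup_incl L.subset_gen_fitting(3)[OF finL] subgroup_restrict_iff[OF sL] by blast
  then have "e1 \<in> gen_fitting_subgroup ?L" using e(1) by blast
  ultimately show "x \<in> gen_fitting_subgroup ?L"
    using xe subgroup.m_closed[OF L.subset_gen_fitting(3)[OF finL]] by simp
qed

text \<open>Under a map with normal image, components go to components or become trivial, and the
  Fitting subgroup is itself a radical. The intersection property is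
  \<open>gen_fitting_Int\<close>.\<close>

lemma radical_gen_fitting: "radical gen_fitting_subgroup"
  unfolding radical_def
proof (intro conjI allI impI; elim conjE)
  fix G :: "('a, 'b) monoid_scheme"
  assume "group G" "finite (carrier G)"
  then show "subgroup (gen_fitting_subgroup G) G" by (rule group.subset_gen_fitting(3))
next
  fix A B :: "('a, 'b) monoid_scheme" and \<theta>
  assume \<theta>: "group_hom A B \<theta>" and fin: "finite (carrier A)" "finite (carrier B)"
    and nor: "\<theta> ` carrier A \<lhd> B"
  interpret \<theta>: group_hom A B \<theta> by fact
  note B = \<theta>.H.subset_gen_fitting[OF fin(2)]
  have "\<theta> ` fitting_subgroup A \<subseteq> gen_fitting_subgroup B"
    using radical_image[OF radical_fitting \<theta> fin nor] B(1) by blast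
  moreover have "\<theta> ` Q \<subseteq> gen_fitting_subgroup B" if "component A Q" for Q
    using \<theta>.component_image[OF fin(1) nor that] B(2) subgroup.one_closed[OF B(3)]
    by (cases "\<theta> ` Q = {\<one>\<^bsub>B\<^esub>}") auto
  ultimately have "\<theta> ` (fitting_subgroup A \<union> \<Union>{Q. component A Q}) \<subseteq> gen_fitting_subgroup B" by blast
  then have "generate B (\<theta> ` (fitting_subgroup A \<union> \<Union>{Q. component A Q})) \<subseteq> gen_fitting_subgroup B"
    using \<theta>.H.generate_subgroup_incl B(3) by blast
  moreover have "fitting_subgroup A \<union> \<Union>{Q. component A Q} \<subseteq> carrier A"
    using \<theta>.G.union_components_subset[OF fin(1)]
      normal_imp_subset[OF fitting_greatest(1)[OF \<theta>.G.is_group fin(1)]] by blast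
  ultimately show "\<theta> ` gen_fitting_subgroup A \<subseteq> gen_fitting_subgroup B"
    unfolding gen_fitting_subgroup_component[of A] using \<theta>.generate_img by blast
next
  fix G :: "('a, 'b) monoid_scheme" and L
  assume "group G" "finite (carrier G)" "L \<lhd> G"
  then show "L \<inter> gen_fitting_subgroup G \<subseteq> gen_fitting_subgroup (G \<down> L)"
    by (rule group.gen_fitting_Int)
qed

section \<open>Radical series\<close>

text \<open>A nontrivial subnormal subgroup of least order is simple; if abelian it lies in the
  Fitting subgroup, otherwise it is a component. This is what makes every generalized Fitting layer
  nontrivial below the top.\<close>

lemma (in group) subnormal_socle_cases:
  assumes fin: "finite (carrier G)" and nt: "carrier G \<noteq> {\<one>}"
  shows "fitting_subgroup G \<noteq> {\<one>} \<or> (\<exists>Q. component G Q)"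
proof -
  let ?P = "\<lambda>S. subnormal G S \<and> S \<noteq> {\<one>}"
  have "?P (carrier G)" using nt subnormal.self by blast
  then obtain S where S: "?P S" "\<And>T. ?P T \<Longrightarrow> card S \<le> card T"
    using ex_has_least_nat[of ?P "carrier G" card] by blast
  have sS: "subgroup S G" using S(1) subnormal_imp_subgroup by blast
  have finS: "finite S" using finite_subgroup[OF sS fin] .
  interpret S: group "G \<down> S" using sS by (rule subgroup_imp_group)
  have min: "N = S \<or> N = {\<one>}" if N: "N \<lhd> (G \<down> S)" for N
  proof (rule ccontr)
    assume n: "\<not> (N = S \<or> N = {\<one>})"
    have "N \<subseteq> S" using N normal_restrict_iff[OF sS] by blast
    then have "card N < card S" using n finS by (simp add: psubset_card_mono psubset_eq)
    moreover have "subnormal G N" using subnormal.step[OF _ N] S(1) by blast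
    ultimately show False using S(2)[of N] n by auto
  qed
  show ?thesis
  proof (cases "\<forall>x\<in>S. \<forall>y\<in>S. x \<otimes> y = y \<otimes> x")
    case True
    have "comm_group (G \<down> S)"
      using True by (intro S.group_comm_groupI) simp
    then have "nilpotent_group (G \<down> S)" by (rule comm_group.comm_group_nilpotent)
    then have "S \<subseteq> fitting_subgroup (G \<down> S)"
      using fitting_greatest(3)[OF S.is_group _ S.normal_self] finS by simp
    also have "\<dots> = S \<inter> fitting_subgroup G"
      using radical_restrict_subnormal[OF radical_fitting is_group fin] S(1) by blast
    finally have "S \<subseteq> fitting_subgroup G" by blast
    then show ?thesis using S(1) subgroup.one_closed[OF sS] by auto
  next
    case False
    have "nonabelian_simple (G \<down> S)"
      using False min finS by (subst S.nonabelian_simple_iff) auto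
    then have "component G S"
      using S.nonabelian_simple_imp_quasisimple finS S(1) by (simp add: component_def)
    then show ?thesis by blast
  qed
qed

lemma (in group) gen_fitting_nontrivial:
  assumes fin: "finite (carrier G)" and nt: "carrier G \<noteq> {\<one>}"
  shows "gen_fitting_subgroup G \<noteq> {\<one>}"
  using subnormal_socle_cases[OF assms]
proof
  assume "fitting_subgroup G \<noteq> {\<one>}"
  then show ?thesis
    using subset_gen_fitting(1)[OF fin] subgroup.one_closed[OF radical_subgroup[OF radical_fitting is_group fin]]
    by auto
next
  assume "\<exists>Q. component G Q"
  then obtain Q where Q: "component G Q" by blast
  then show ?thesis
    using subset_gen_fitting(2)[OF fin Q] componentD(1,3)[OF fin Q] subgroup.one_closed by blast
qed

lemma radical_trivial: "radical (\<lambda>G. {\<one>\<^bsub>G\<^esub>})"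
  unfolding radical_def
proof (intro conjI allI impI; elim conjE)
  fix G :: "('a, 'b) monoid_scheme"
  assume "group G"
  then show "subgroup {\<one>\<^bsub>G\<^esub>} G" by (rule group.triv_subgroup)
next
  fix A B :: "('a, 'b) monoid_scheme" and \<theta>
  assume "group_hom A B \<theta>"
  then show "\<theta> ` {\<one>\<^bsub>A\<^esub>} \<subseteq> {\<one>\<^bsub>B\<^esub>}" by (simp add: group_hom.hom_one)
qed simp

lemma radical_gen_fitting_series:
  "radical (\<lambda>G :: ('a, 'b) monoid_scheme. gen_fitting_series G i)"
proof (induction i)
  case 0
  show ?case using radical_trivial by simp
next
  case (Suc i)
  have "(\<lambda>G :: ('a, 'b) monoid_scheme. gen_fitting_series G (Suc i))
      = ext_radical (\<lambda>G. gen_fitting_series G i) gen_fitting_subgroup"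
    by (simp add: fun_eq_iff ext_radical_def)
  then show ?case by (simp only: radical_ext[OF Suc radical_gen_fitting])
qed

text \<open>Each step adds a generalized Fitting layer and then a soluble radical. Starting with the
  soluble radical keeps every quotient by a term free of nontrivial soluble normal subgroups, so the
  added Fitting layer is a direct product of nonabelian simple groups. Term \<open>j\<close> turns
  out to be \<open>R_j(G)\<close>.\<close>

primrec nonsoluble_series :: "nat \<Rightarrow> ('a, 'b) monoid_scheme \<Rightarrow> 'a set" where
  "nonsoluble_series 0 = class_radical solvable"
| "nonsoluble_series (Suc j) =
     ext_radical (ext_radical (nonsoluble_series j) gen_fitting_subgroup) (class_radical solvable)"

lemmas solvable_greatest = class_radical_greatest[OF fitting_class_solvable]
lemmas radical_solvable = radical_class_radical[OF fitting_class_solvable]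

lemma radical_nonsoluble_series: "radical (nonsoluble_series j)"
  by (induction j) (simp_all add: radical_solvable radical_ext radical_gen_fitting)

lemma ext_gen_fitting_psubset:
  assumes \<rho>: "radical \<rho>" and G: "group G" "finite (carrier G)" and ne: "\<rho> G \<noteq> carrier G"
  shows "\<rho> G \<subset> ext_radical \<rho> gen_fitting_subgroup G"
proof -
  interpret N: normal "\<rho> G" G using radical_normal[OF \<rho> G] .
  interpret Q: group "G Mod \<rho> G" by (rule N.factorgroup_is_group)
  have fin: "finite (carrier (G Mod \<rho> G))" using N.finite_quotient[OF G(2)] .
  have eq: "(\<lambda>x. \<rho> G #>\<^bsub>G\<^esub> x) ` ext_radical \<rho> gen_fitting_subgroup G = gen_fitting_subgroup (G Mod \<rho> G)"
    by (rule ext_radical_cosets[OF \<rho> radical_gen_fitting G])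
  have "carrier (G Mod \<rho> G) \<noteq> {\<one>\<^bsub>G Mod \<rho> G\<^esub>}"
  proof
    assume t: "carrier (G Mod \<rho> G) = {\<one>\<^bsub>G Mod \<rho> G\<^esub>}"
    have "x \<in> \<rho> G" if "x \<in> carrier G" for x
      using that t N.coset_eq_self_iff[OF that] N.quotient_surj by auto
    then show False using ne N.subset by blast
  qed
  then have ntF: "gen_fitting_subgroup (G Mod \<rho> G) \<noteq> {\<one>\<^bsub>G Mod \<rho> G\<^esub>}" by (rule Q.gen_fitting_nontrivial[OF fin])
  have "\<rho> G \<noteq> ext_radical \<rho> gen_fitting_subgroup G"
  proof
    assume e: "\<rho> G = ext_radical \<rho> gen_fitting_subgroup G"
    have "(\<lambda>x. \<rho> G #>\<^bsub>G\<^esub> x) ` \<rho> G \<subseteq> {\<rho> G}"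
      using N.coset_eq_self_iff N.subset by auto
    moreover have "\<one>\<^bsub>G Mod \<rho> G\<^esub> \<in> gen_fitting_subgroup (G Mod \<rho> G)"
      using subgroup.one_closed[OF Q.subset_gen_fitting(3)[OF fin]] .
    ultimately show False using ntF eq e by auto
  qed
  then show ?thesis using ext_radical_superset[OF \<rho> radical_gen_fitting G] by blast
qed

text \<open>Only a generalized Fitting layer is demanded in each step, so the lemma serves both
  series. Strict growth below the top is bounded by the order of \<open>G\<close>.\<close>

lemma radical_series_reaches:
  assumes \<rho>: "\<And>i. radical (\<rho> i)" and G: "group G" "finite (carrier G)"
    and grow: "\<And>i. ext_radical (\<rho> i) gen_fitting_subgroup G \<subseteq> \<rho> (Suc i) G"
  shows "\<exists>i. \<rho> i G = carrier G"
proof (rule ccontr)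
  assume ne: "\<nexists>i. \<rho> i G = carrier G"
  have sub: "\<rho> i G \<subseteq> carrier G" for i
    using subgroup.subset[OF radical_subgroup[OF \<rho> G]] .
  have "i \<le> card (\<rho> i G)" for i
  proof (induction i)
    case (Suc i)
    have "\<rho> i G \<subset> \<rho> (Suc i) G"
      using ext_gen_fitting_psubset[OF \<rho> G] ne grow[of i] by blast
    then have "card (\<rho> i G) < card (\<rho> (Suc i) G)"
      using psubset_card_mono finite_subset[OF sub G(2)] by blast
    then show ?case using Suc by simp
  qed simp
  from this[of "Suc (card (carrier G))"] show False
    using card_mono[OF G(2) sub] by (metis Suc_n_not_le_n order_trans)
qed

lemma gen_fitting_height_series:
  assumes "group G" "finite (carrier G)"
  shows "gen_fitting_series G (gen_fitting_height G) = carrier G"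
proof -
  have "\<exists>i. gen_fitting_series G i = carrier G"
    by (rule radical_series_reaches[of "\<lambda>i G. gen_fitting_series G i", OF radical_gen_fitting_series assms])
      (simp add: ext_radical_def)
  then show ?thesis unfolding gen_fitting_height_def by (rule LeastI_ex)
qed

section \<open>Internal direct products\<close>

text \<open>The order of the factors is fixed because \<open>G\<close> need not be commutative; only
  elements of different direct factors will be known to commute.\<close>

primrec ordered_prod :: "('a, 'b) monoid_scheme \<Rightarrow> (nat \<Rightarrow> 'a) \<Rightarrow> nat \<Rightarrow> 'a" where
  "ordered_prod G x 0 = \<one>\<^bsub>G\<^esub>"
| "ordered_prod G x (Suc k) = ordered_prod G x k \<otimes>\<^bsub>G\<^esub> x k"

lemma (in group) ordered_prod_closed:
  assumes "subgroup H G" "\<And>i. i < k \<Longrightarrow> x i \<in> H" shows "ordered_prod G x k \<in> H"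
  using assms(2)
  by (induction k) (use subgroup.one_closed[OF assms(1)] subgroup.m_closed[OF assms(1)] in auto)

lemma (in group) ordered_prod_commute:
  assumes "\<And>i. i < k \<Longrightarrow> x i \<in> carrier G" "w \<in> carrier G" "\<And>i. i < k \<Longrightarrow> w \<otimes> x i = x i \<otimes> w"
  shows "w \<otimes> ordered_prod G x k = ordered_prod G x k \<otimes> w"
proof -
  have "ordered_prod G x k \<in> {y \<in> carrier G. \<forall>z\<in>{w}. y \<otimes> z = z \<otimes> y}"
    by (rule ordered_prod_closed[OF subgroup_commute]) (use assms in auto)
  then show ?thesis by simp
qed

text \<open>The factors are given by embeddings of external groups rather than as subgroups. One
  instance takes the inclusions of simple components, the other takes copies of them on natural
  numbers. Mutual commutation and trivial centres make the product direct.\<close>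

locale internal_direct_product = group +
  fixes r :: nat and T :: "nat \<Rightarrow> ('c, 'd) monoid_scheme" and f :: "nat \<Rightarrow> 'c \<Rightarrow> 'a"
  assumes factor_hom: "i < r \<Longrightarrow> group_hom (T i) G (f i)"
    and factor_inj: "i < r \<Longrightarrow> inj_on (f i) (carrier (T i))"
    and factor_centerless: "i < r \<Longrightarrow> x \<in> f i ` carrier (T i) \<Longrightarrow>
      (\<And>y. y \<in> f i ` carrier (T i) \<Longrightarrow> x \<otimes> y = y \<otimes> x) \<Longrightarrow> x = \<one>"
    and factors_commute: "i < r \<Longrightarrow> j < r \<Longrightarrow> i \<noteq> j \<Longrightarrow>
      commuting G (f i ` carrier (T i)) (f j ` carrier (T j))"
begin

abbreviation "factor_product \<equiv> product_group {..<r} T"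
abbreviation "part i \<equiv> f i ` carrier (T i)"

definition "multiply x = ordered_prod G (\<lambda>i. f i (x i)) r"

lemma factor_group: "i < r \<Longrightarrow> group (T i)"
  using factor_hom group_hom.axioms(1) by blast

lemma group_factor_product: "group factor_product"
  using factor_group by (intro product_group) simp

lemma factor_closed: "i < r \<Longrightarrow> s \<in> part i \<Longrightarrow> s \<in> carrier G"
  using group_hom.hom_closed[OF factor_hom] by blast

lemma component_in_part:
  assumes "x \<in> carrier factor_product" "i < r"
  shows "x i \<in> carrier (T i)" "f i (x i) \<in> part i" "f i (x i) \<in> carrier G"
proof -
  show *: "x i \<in> carrier (T i)" using assms by auto
  then show "f i (x i) \<in> part i" by blast
  then show "f i (x i) \<in> carrier G" by (rule factor_closed[OF assms(2)])
qed

lemma multiply_hom: "group_hom factor_product G multiply"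
proof (intro group_hom.intro group_hom_axioms.intro homI group_factor_product is_group)
  fix x assume x: "x \<in> carrier factor_product"
  note x = component_in_part[OF x]
  show "multiply x \<in> carrier G"
    unfolding multiply_def by (rule ordered_prod_closed[OF subgroup_self]) (rule x(3))
  fix y assume "y \<in> carrier factor_product"
  note y = component_in_part[OF this]
  have "ordered_prod G (\<lambda>i. f i ((x \<otimes>\<^bsub>factor_product\<^esub> y) i)) k
      = ordered_prod G (\<lambda>i. f i (x i)) k \<otimes> ordered_prod G (\<lambda>i. f i (y i)) k" (is "_ = ?x k \<otimes> ?y k")
    if "k \<le> r" for k
    using that
  proof (induction k)
    case (Suc k)
    then have k: "k < r" "k \<le> r" by auto
    have c: "?x k \<in> carrier G" "?y k \<in> carrier G" "f k (x k) \<in> carrier G" "f k (y k) \<in> carrier G"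
      using k x(3) y(3) by (simp_all add: ordered_prod_closed[OF subgroup_self])
    have "f k (x k) \<otimes> ?y k = ?y k \<otimes> f k (x k)"
    proof (rule ordered_prod_commute)
      fix i assume "i < k"
      then have i: "i < r" "k \<noteq> i" using k by auto
      show "f i (y i) \<in> carrier G" using y(3)[OF i(1)] .
      show "f k (x k) \<otimes> f i (y i) = f i (y i) \<otimes> f k (x k)"
        using factors_commute[OF k(1) i] x(2)[OF k(1)] y(2)[OF i(1)] unfolding commuting_def by blast
    qed (rule c)
    moreover have "a \<otimes> u \<otimes> (b \<otimes> v) = a \<otimes> b \<otimes> (u \<otimes> v)" if "u \<otimes> b = b \<otimes> u"
      "a \<in> carrier G" "b \<in> carrier G" "u \<in> carrier G" "v \<in> carrier G" for a b u v
      using that by (metis m_assoc m_closed)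
    ultimately have "?x k \<otimes> f k (x k) \<otimes> (?y k \<otimes> f k (y k)) = ?x k \<otimes> ?y k \<otimes> (f k (x k) \<otimes> f k (y k))"
      using c by blast
    then show ?case
      using Suc.IH[OF k(2)] k group_hom.hom_mult[OF factor_hom[OF k(1)] x(1)[OF k(1)] y(1)[OF k(1)]] by simp
  qed simp
  then show "multiply (x \<otimes>\<^bsub>factor_product\<^esub> y) = multiply x \<otimes> multiply y"
    unfolding multiply_def by blast
qed

definition embed :: "nat \<Rightarrow> 'c \<Rightarrow> nat \<Rightarrow> 'c" where
  "embed i s = (\<lambda>j\<in>{..<r}. if j = i then s else \<one>\<^bsub>T j\<^esub>)"

lemma embed_closed: "s \<in> carrier (T i) \<Longrightarrow> embed i s \<in> carrier factor_product"
  using factor_group by (auto simp: embed_def group.is_monoid)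

lemma multiply_embed:
  assumes "i < r" "s \<in> carrier (T i)" shows "multiply (embed i s) = f i s"
proof -
  have s: "f i s \<in> carrier G" using assms factor_closed by blast
  have "ordered_prod G (\<lambda>j. f j (embed i s j)) k = (if i < k then f i s else \<one>)" if "k \<le> r" for k
    using that s group_hom.hom_one[OF factor_hom] by (induction k) (auto simp: embed_def less_Suc_eq)
  then show ?thesis using assms(1) by (simp add: multiply_def)
qed

text \<open>If the product is one, the \<open>i\<close>-th entry is the inverse of the product of
  the other entries. It therefore commutes with its own factor too, and the trivial centre forces it
  to be one.\<close>

lemma multiply_inj: "inj_on multiply (carrier factor_product)"
proof -
  interpret h: group_hom factor_product G multiply by (rule multiply_hom)
  show ?thesis
    unfolding h.inj_on_one_iff
  proof (intro allI impI)
    fix x assume x: "x \<in> carrier factor_product" and one: "multiply x = \<one>"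
    note xf = component_in_part[OF x]
    have "x i = \<one>\<^bsub>T i\<^esub>" if i: "i < r" for i
    proof -
      interpret fi: group_hom "T i" G "f i" by (rule factor_hom[OF i])
      let ?x = "x(i := \<one>\<^bsub>T i\<^esub>)"
      have x': "?x \<in> carrier factor_product"
        using x i by (auto simp: PiE_iff extensional_def)
      have "embed i (x i) \<otimes>\<^bsub>factor_product\<^esub> ?x = x"
      proof
        fix j show "(embed i (x i) \<otimes>\<^bsub>factor_product\<^esub> ?x) j = x j"
          using x xf(1)[of j] factor_group[of j] monoid.l_one[OF group.is_monoid, of "T j" "x j"]
          by (auto simp: embed_def PiE_iff extensional_def)
      qed
      then have "f i (x i) \<otimes> multiply ?x = \<one>"
        using h.hom_mult[OF embed_closed[OF xf(1)[OF i]] x'] one multiply_embed[OF i xf(1)[OF i]] by simp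
      then have inv: "f i (x i) = inv (multiply ?x)"
        using inv_equality h.hom_closed[OF x'] xf(3)[OF i] by auto
      have "f i (x i) = \<one>"
      proof (rule factor_centerless[OF i xf(2)[OF i]])
        fix s assume s: "s \<in> part i"
        have sc: "s \<in> carrier G" using factor_closed[OF i s] .
        have "s \<otimes> multiply ?x = multiply ?x \<otimes> s"
          unfolding multiply_def
        proof (rule ordered_prod_commute)
          fix j assume j: "j < r"
          show "f j (?x j) \<in> carrier G" using component_in_part(3)[OF x' j] .
          show "s \<otimes> f j (?x j) = f j (?x j) \<otimes> s"
            using factors_commute[OF i j] s xf(2)[OF j] sc by (cases "j = i") (auto simp: commuting_def)
        qed (rule sc)
        then have "inv (multiply ?x) \<otimes> (s \<otimes> multiply ?x) \<otimes> inv (multiply ?x)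
            = inv (multiply ?x) \<otimes> (multiply ?x \<otimes> s) \<otimes> inv (multiply ?x)" by simp
        then show "f i (x i) \<otimes> s = s \<otimes> f i (x i)"
          unfolding inv using h.hom_closed[OF x'] sc by (simp add: m_assoc)
      qed
      then show ?thesis
        using inj_onD[OF factor_inj[OF i] _ xf(1)[OF i] fi.G.one_closed] by simp
    qed
    then show "x = \<one>\<^bsub>factor_product\<^esub>"
      using x by (auto simp: PiE_iff extensional_def)
  qed
qed

lemma multiply_image: "multiply ` carrier factor_product = generate G (\<Union>i<r. part i)"
proof
  interpret h: group_hom factor_product G multiply by (rule multiply_hom)
  have sub: "(\<Union>i<r. part i) \<subseteq> carrier G" using factor_closed by blast
  have "multiply x \<in> generate G (\<Union>i<r. part i)" if x: "x \<in> carrier factor_product" for x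
    unfolding multiply_def by (rule ordered_prod_closed[OF generate_is_subgroup[OF sub]])
      (use component_in_part(2)[OF x] in \<open>auto intro!: generate.incl\<close>)
  then show "multiply ` carrier factor_product \<subseteq> generate G (\<Union>i<r. part i)" by blast
  have "f i s \<in> multiply ` carrier factor_product" if "i < r" "s \<in> carrier (T i)" for i s
    using embed_closed[OF that(2)] multiply_embed[OF that] by (metis image_eqI)
  then have "(\<Union>i<r. part i) \<subseteq> multiply ` carrier factor_product" by blast
  then show "generate G (\<Union>i<r. part i) \<subseteq> multiply ` carrier factor_product"
    using generate_subgroup_incl h.img_is_subgroup by blast
qed

lemma multiply_direct_factor:
  assumes i: "i < r"
  shows "multiply ` direct_factor {..<r} T i = part i"
proof -
  have "multiply x \<in> part i" if x: "x \<in> direct_factor {..<r} T i" for x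
  proof -
    have "x i \<in> carrier (T i)" "x = embed i (x i)"
      using x i by (auto simp: direct_factor_def embed_def PiE_iff extensional_def fun_eq_iff)
    then show ?thesis using multiply_embed[OF i] by (metis image_eqI)
  qed
  moreover have "f i s \<in> multiply ` direct_factor {..<r} T i" if "s \<in> carrier (T i)" for s
  proof -
    have "embed i s \<in> direct_factor {..<r} T i"
      using embed_closed[OF that] by (auto simp: direct_factor_def embed_def)
    then show ?thesis using multiply_embed[OF i that] by (metis image_eqI)
  qed
  ultimately show ?thesis by blast
qed

end

text \<open>Distinct components commute, and the centre of a nonabelian simple group is a proper
  normal subgroup, hence trivial.\<close>

lemma (in group) internal_direct_productI:
  assumes fin: "finite (carrier G)"
    and f: "\<And>i. i < r \<Longrightarrow> group_hom (T i) G (f i)" "\<And>i. i < r \<Longrightarrow> inj_on (f i) (carrier (T i))"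
    and S: "\<And>i. i < r \<Longrightarrow> f i ` carrier (T i) = S i" "\<And>i. i < r \<Longrightarrow> component G (S i)"
      "\<And>i. i < r \<Longrightarrow> nonabelian_simple (G \<down> S i)" "inj_on S {..<r}"
  shows "internal_direct_product G r T f"
proof (intro internal_direct_product.intro internal_direct_product_axioms.intro is_group f)
  fix i x assume i: "i < r" and x: "x \<in> f i ` carrier (T i)"
    and c: "\<And>y. y \<in> f i ` carrier (T i) \<Longrightarrow> x \<otimes> y = y \<otimes> x"
  have sS: "subgroup (S i) G" using componentD(1)[OF fin S(2)[OF i]] .
  interpret S: group "G \<down> S i" using sS by (rule subgroup_imp_group)
  have finS: "finite (carrier (G \<down> S i))" using finite_subgroup[OF sS fin] by simp
  have ns: "\<exists>x\<in>S i. \<exists>y\<in>S i. x \<otimes> y \<noteq> y \<otimes> x"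
    "\<And>N. N \<lhd> (G \<down> S i) \<Longrightarrow> N = S i \<or> N = {\<one>}"
    using S(3)[OF i] S.nonabelian_simple_iff[OF finS] by simp_all
  have "group_center (G \<down> S i) \<noteq> S i"
    using ns(1) unfolding group_center_def by fastforce
  then have "group_center (G \<down> S i) = {\<one>}" using ns(2)[OF S.center_normal] by blast
  moreover have "x \<in> group_center (G \<down> S i)"
    using x c unfolding S(1)[OF i] by (simp add: group_center_def)
  ultimately show "x = \<one>" by blast
next
  fix i j assume ij: "i < r" "j < r" "i \<noteq> j"
  then show "commuting G (f i ` carrier (T i)) (f j ` carrier (T j))"
    using components_commuting[OF fin S(2)[OF ij(1)] S(2)[OF ij(2)]] inj_onD[OF S(4), of i j] S(1) by auto
qed

section \<open>Nonsoluble length\<close>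

lemma (in group_hom) quotient_image_solvable:
  assumes M: "M \<lhd> G" and N: "N \<lhd> G" "N \<subseteq> M" and sol: "solvable ((G \<down> M) Mod N)"
  shows "solvable ((H \<down> h ` M) Mod h ` N)"
proof -
  have sM: "subgroup M G" using M by (rule normal_imp_subgroup)
  let ?M = "G \<down> M" and ?M' = "H \<down> h ` M"
  interpret M: group_hom ?M ?M' h using restrict_hom[OF sM] .
  interpret N: normal N ?M using G.normal_subgroup_restrict[OF N(1) sM N(2)] .
  have "h ` N \<lhd> ?M'" using M.normal_image[OF N.normal_axioms] by simp
  then interpret N': normal "h ` N" ?M' .
  obtain \<theta> where \<theta>: "group_hom (?M Mod N) (?M' Mod h ` N) \<theta>"
    "\<And>x. x \<in> carrier ?M \<Longrightarrow> \<theta> (N #>\<^bsub>?M\<^esub> x) = h ` N #>\<^bsub>?M'\<^esub> h x"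
    using induced_quotient_hom[OF M.group_hom_axioms N.normal_axioms N'.normal_axioms order_refl] by blast
  have "\<theta> ` carrier (?M Mod N) = (\<lambda>x. h ` N #>\<^bsub>?M'\<^esub> x) ` carrier ?M'"
    unfolding N.quotient_surj[symmetric] image_image using \<theta>(2) by (auto simp: image_image)
  then have "\<theta> ` carrier (?M Mod N) = carrier (?M' Mod h ` N)"
    unfolding N'.quotient_surj .
  then show ?thesis using group_hom.surj_hom_imp_solvable[OF \<theta>(1) _ sol] by blast
qed

text \<open>In effect: the quotient of \<open>G\<close> by its radical has no nontrivial soluble
  normal subgroup. The form with a pair \<open>N \<subseteq> M\<close> fits a single soluble factor
  of a normal series.\<close>

definition solvable_closed :: "(('a, 'b) monoid_scheme \<Rightarrow> 'a set) \<Rightarrow> bool" where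
  "solvable_closed \<rho> \<longleftrightarrow>
     (\<forall>G M N. group G \<and> finite (carrier G) \<and> M \<lhd> G \<and> N \<lhd> G \<and> N \<subseteq> M \<and> N \<subseteq> \<rho> G \<and>
        solvable ((G \<down> M) Mod N) \<longrightarrow> M \<subseteq> \<rho> G)"

lemma solvable_closedD:
  assumes "solvable_closed \<rho>" "group G" "finite (carrier G)" "M \<lhd> G" "N \<lhd> G" "N \<subseteq> M" "N \<subseteq> \<rho> G"
    "solvable ((G \<down> M) Mod N)"
  shows "M \<subseteq> \<rho> G"
  using assms unfolding solvable_closed_def by blast

lemma solvable_closed_radical: "solvable_closed (class_radical solvable)"
  unfolding solvable_closed_def
proof (intro allI impI; elim conjE)
  fix G :: "('a, 'b) monoid_scheme" and M N
  assume G: "group G" "finite (carrier G)" and M: "M \<lhd> G" and N: "N \<lhd> G" "N \<subseteq> M"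
    and sub: "N \<subseteq> class_radical solvable G" and sol: "solvable ((G \<down> M) Mod N)"
  interpret group G by fact
  note R = solvable_greatest[OF G]
  have sM: "subgroup M G" "subgroup N G" "subgroup (class_radical solvable G) G"
    using M N R(1) normal_imp_subgroup by blast+
  interpret M: group "G \<down> M" using sM(1) by (rule subgroup_imp_group)
  interpret R: group "G \<down> class_radical solvable G" using sM(3) by (rule subgroup_imp_group)
  have "subgroup N (G \<down> class_radical solvable G)"
    using sM sub subgroup_restrict_iff by blast
  then have "solvable (G \<down> N)" using R.solvable_restrict[OF _ R(2)] by simp
  moreover have "N \<lhd> (G \<down> M)" using normal_subgroup_restrict[OF N(1) sM(1) N(2)] .
  ultimately have "solvable (G \<down> M)"
    using M.solvable_extension[of N] sol by simp
  then show "M \<subseteq> class_radical solvable G" using R(3)[OF M] by blast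
qed

text \<open>The factor \<open>M/N\<close> has a soluble image in \<open>G Mod \<rho> G\<close>,
  where the outer radical absorbs it.\<close>

lemma solvable_closed_ext:
  assumes \<rho>: "radical \<rho>" and \<sigma>: "radical \<sigma>" "solvable_closed \<sigma>"
  shows "solvable_closed (ext_radical \<rho> \<sigma>)"
  unfolding solvable_closed_def
proof (intro allI impI; elim conjE)
  fix G :: "('a, 'b) monoid_scheme" and M N
  assume G: "group G" "finite (carrier G)" and M: "M \<lhd> G" and N: "N \<lhd> G" "N \<subseteq> M"
    and sub: "N \<subseteq> ext_radical \<rho> \<sigma> G" and sol: "solvable ((G \<down> M) Mod N)"
  interpret R: normal "\<rho> G" G using radical_normal[OF \<rho> G] .
  let ?q = "\<lambda>x. \<rho> G #>\<^bsub>G\<^esub> x"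
  interpret q: group_hom G "G Mod \<rho> G" ?q by (rule R.quotient_hom)
  have "solvable (((G Mod \<rho> G) \<down> ?q ` M) Mod ?q ` N)"
    using q.quotient_image_solvable[OF M N sol] .
  moreover have "?q ` N \<subseteq> \<sigma> (G Mod \<rho> G)"
    using sub ext_radical_cosets[OF \<rho> \<sigma>(1) G] by blast
  ultimately have "?q ` M \<subseteq> \<sigma> (G Mod \<rho> G)"
    using solvable_closedD[OF \<sigma>(2) R.factorgroup_is_group R.finite_quotient[OF G(2)]
        R.image_in_quotient_normal[OF M] R.image_in_quotient_normal[OF N(1)]] N(2) by blast
  moreover have "M \<subseteq> carrier G" using normal_imp_subset[OF M] .
  ultimately show "M \<subseteq> ext_radical \<rho> \<sigma> G" unfolding ext_radical_def by blast
qed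

lemma solvable_closed_nonsoluble_series: "solvable_closed (nonsoluble_series j)"
  by (cases j) (simp_all add: solvable_closed_radical solvable_closed_ext radical_ext
      radical_nonsoluble_series radical_gen_fitting radical_solvable)

section \<open>Direct products of simple groups and the generalized Fitting subgroup\<close>

lemma (in group) component_of_simple_image:
  assumes "group_hom T G h" "nonabelian_simple T" "finite (carrier T)" "inj_on h (carrier T)"
    "h ` carrier T \<lhd> G"
  shows "component G (h ` carrier T)"
proof -
  interpret h: group_hom T G h by fact
  have "component T (carrier T)"
    using h.G.nonabelian_simple_imp_quasisimple assms(2,3) subnormal.self by (simp add: component_def)
  moreover have "carrier T \<noteq> {\<one>\<^bsub>T\<^esub>}"
    using assms(2) simple_group.simple_not_triv by (auto simp: nonabelian_simple_def)
  then have "h ` carrier T \<noteq> {\<one>}"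
    using assms(4) h.hom_one h.G.one_closed by (metis h.G.triv_subgroup inj_on_image_eq_iff image_empty image_insert subgroup.subset order_refl)
  ultimately show ?thesis using h.component_image[OF assms(3,5)] by blast
qed

text \<open>Each coordinate subgroup is normal and simple, hence a component, and the coordinate
  subgroups together generate the product.\<close>

lemma direct_product_gen_fitting:
  assumes "group K" "finite (carrier K)" "direct_product_of_nonabelian_simples K"
  shows "gen_fitting_subgroup K = carrier K"
proof -
  interpret K: group K by fact
  obtain r and T :: "nat \<Rightarrow> 'a monoid" where T: "\<And>i. i < r \<Longrightarrow> nonabelian_simple (T i)"
    and iso: "K \<cong> product_group {..<r} T"
    using assms(3) unfolding direct_product_of_nonabelian_simples_def by blast
  have grT: "group (T i)" if "i < r" for i
    using T[OF that] simple_group.axioms(1) by (auto simp: nonabelian_simple_def)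
  have finT: "finite (carrier (T i))" if "i < r" for i
    using T[OF that] simple_group.order_gt_one card.infinite by (fastforce simp: nonabelian_simple_def order_def)
  let ?P = "product_group {..<r} T"
  interpret P: group ?P using grT by (intro product_group) simp
  obtain f where f: "f \<in> iso ?P K"
    using K.iso_sym[OF iso] by (auto simp: is_iso_def)
  interpret f: group_hom ?P K f
    using f by (simp add: group_hom_def group_hom_axioms_def iso_def)
  have finj: "inj_on f (carrier ?P)" and fsurj: "f ` carrier ?P = carrier K"
    using f by (auto simp: iso_def bij_betw_def)
  define e where "e = (\<lambda>i s. \<lambda>j\<in>{..<r}. if j = i then s else \<one>\<^bsub>T j\<^esub>)"
  have eP: "e i s \<in> carrier ?P" if "i < r" "s \<in> carrier (T i)" for i s
    using that grT by (auto simp: e_def group.is_monoid)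
  have comp: "f (e i s) \<in> gen_fitting_subgroup K" if i: "i < r" and s: "s \<in> carrier (T i)" for i s
  proof -
    have e_hom: "group_hom (T i) ?P (e i)"
    proof (intro group_hom.intro group_hom_axioms.intro homI grT[OF i] P.is_group eP[OF i])
      fix x y assume "x \<in> carrier (T i)" "y \<in> carrier (T i)"
      then show "e i (x \<otimes>\<^bsub>T i\<^esub> y) = e i x \<otimes>\<^bsub>?P\<^esub> e i y"
        using grT by (auto simp: e_def fun_eq_iff group.is_monoid)
    qed
    interpret e: group_hom "T i" ?P "e i" by (rule e_hom)
    have "e i ` carrier (T i) \<lhd> ?P"
      unfolding P.normal_inv_iff
    proof (intro conjI ballI e.img_is_subgroup)
      fix x z assume x: "x \<in> carrier ?P" and "z \<in> e i ` carrier (T i)"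
      then obtain s where s: "s \<in> carrier (T i)" "z = e i s" by blast
      have xi: "x j \<in> carrier (T j)" if "j < r" for j using x that by auto
      have "x \<otimes>\<^bsub>?P\<^esub> z \<otimes>\<^bsub>?P\<^esub> inv\<^bsub>?P\<^esub> x = e i (x i \<otimes>\<^bsub>T i\<^esub> s \<otimes>\<^bsub>T i\<^esub> inv\<^bsub>T i\<^esub> x i)"
      proof
        fix j
        have gj: "group (T j)" if "j < r" using grT that .
        have "(inv\<^bsub>?P\<^esub> x) j = (if j < r then inv\<^bsub>T j\<^esub> x j else undefined)"
          using inv_product_group[of x "{..<r}" T] x grT by simp
        then show "(x \<otimes>\<^bsub>?P\<^esub> z \<otimes>\<^bsub>?P\<^esub> inv\<^bsub>?P\<^esub> x) j = e i (x i \<otimes>\<^bsub>T i\<^esub> s \<otimes>\<^bsub>T i\<^esub> inv\<^bsub>T i\<^esub> x i) j"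
          using xi[of j] gj group.r_inv[of "T j" "x j"] monoid.r_one[of "T j" "x j"] group.is_monoid[of "T j"]
          by (cases "j < r") (simp_all add: e_def s(2))
      qed
      moreover interpret Ti: group "T i" by (rule grT[OF i])
      have "x i \<otimes>\<^bsub>T i\<^esub> s \<otimes>\<^bsub>T i\<^esub> inv\<^bsub>T i\<^esub> x i \<in> carrier (T i)" using xi[OF i] s(1) by blast
      ultimately show "x \<otimes>\<^bsub>?P\<^esub> z \<otimes>\<^bsub>?P\<^esub> inv\<^bsub>?P\<^esub> x \<in> e i ` carrier (T i)"
        by (metis imageI)
    qed
    then have nor: "f ` e i ` carrier (T i) \<lhd> K"
      using f.normal_image[of "e i ` carrier (T i)"] unfolding fsurj by simp
    have inj: "inj_on (f \<circ> e i) (carrier (T i))"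
    proof (rule comp_inj_on)
      show "inj_on (e i) (carrier (T i))"
        using i by (intro inj_on_inverseI[of _ "\<lambda>x. x i"]) (simp add: e_def)
      show "inj_on f (e i ` carrier (T i))" by (rule inj_on_subset[OF finj image_subsetI[OF eP[OF i]]])
    qed
    have "group_hom (T i) K (f \<circ> e i)"
      using Group.hom_compose[OF e.homh f.homh] by (simp add: group_hom_def group_hom_axioms_def grT[OF i] assms(1))
    then have "component K ((f \<circ> e i) ` carrier (T i))"
      using K.component_of_simple_image[OF _ T[OF i] finT[OF i] inj] nor by (simp add: image_comp)
    from K.subset_gen_fitting(2)[OF assms(2) this] show ?thesis using s by auto
  qed
  have sF: "subgroup (gen_fitting_subgroup K) K" using K.subset_gen_fitting(3)[OF assms(2)] .
  have "f x \<in> gen_fitting_subgroup K" if x: "x \<in> carrier ?P" for x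
  proof -
    have xi: "x j \<in> carrier (T j)" if "j < r" for j using x that by auto
    \<comment> \<open>\<open>?y k\<close> keeps the first \<open>k\<close> coordinates of
      \<open>x\<close> and sets the others to one, so that \<open>x = ?y r\<close> is assembled from
      one component at a time.\<close>
    let ?y = "\<lambda>k. \<lambda>j\<in>{..<r}. if j < k then x j else \<one>\<^bsub>T j\<^esub>"
    have yP: "?y k \<in> carrier ?P" for k using xi grT by (auto simp: group.is_monoid)
    have "f (?y k) \<in> gen_fitting_subgroup K" if "k \<le> r" for k
      using that
    proof (induction k)
      case 0
      have "?y 0 = \<one>\<^bsub>?P\<^esub>" by (auto simp: fun_eq_iff)
      then have "f (?y 0) = \<one>\<^bsub>K\<^esub>" using f.hom_one by (simp only:)
      then show ?case using subgroup.one_closed[OF sF] by (simp only:)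
    next
      case (Suc k)
      then have k: "k < r" by simp
      have "?y (Suc k) = ?y k \<otimes>\<^bsub>?P\<^esub> e k (x k)"
        using xi grT by (auto simp: e_def fun_eq_iff less_Suc_eq group.is_monoid)
      then have "f (?y (Suc k)) = f (?y k) \<otimes>\<^bsub>K\<^esub> f (e k (x k))"
        using f.hom_mult[OF yP eP[OF k xi[OF k]]] by simp
      moreover have "f (?y k) \<in> gen_fitting_subgroup K" using Suc.IH k by (simp only: less_imp_le)
      ultimately show ?case
        using subgroup.m_closed[OF sF _ comp[OF k xi[OF k]]] by (simp only:)
    qed
    moreover have "?y r = x" using x by (auto simp: fun_eq_iff PiE_iff extensional_def)
    ultimately show ?thesis by (metis order_refl)
  qed
  then have "f ` carrier ?P \<subseteq> gen_fitting_subgroup K" by (rule image_subsetI)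
  then show ?thesis using subgroup.subset[OF sF] unfolding fsurj by (rule subset_antisym[rotated])
qed

text \<open>The centre of \<open>Q\<close> is abelian and subnormal in \<open>G\<close>, so it lies
  in the Fitting subgroup, which is trivial here.\<close>

lemma (in group) component_nonabelian_simple:
  assumes fin: "finite (carrier G)" and fit: "fitting_subgroup G = {\<one>}" and Q: "component G Q"
  shows "nonabelian_simple (G \<down> Q)"
proof -
  have sQ: "subgroup Q G" using componentD(1)[OF fin Q] .
  interpret Q: group "G \<down> Q" using sQ by (rule subgroup_imp_group)
  let ?Z = "group_center (G \<down> Q)"
  have finQ: "finite (carrier (G \<down> Q))" using finite_subgroup[OF sQ fin] by simp
  have snZ: "subnormal G ?Z" using subnormal.step[OF _ Q.center_normal] Q by (simp add: component_def)
  then have sZ: "subgroup ?Z G" by (rule subnormal_imp_subgroup)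
  interpret Z: group "G \<down> ?Z" using sZ by (rule subgroup_imp_group)
  have finZ: "finite (carrier (G \<down> ?Z))" using finite_subgroup[OF sZ fin] by simp
  have "comm_group (G \<down> ?Z)"
  proof (rule Z.group_comm_groupI)
    fix a b assume "a \<in> carrier (G \<down> ?Z)" "b \<in> carrier (G \<down> ?Z)"
    then have "b \<in> Q" "\<And>w. w \<in> Q \<Longrightarrow> a \<otimes> w = w \<otimes> a"
      by (auto simp: group_center_def)
    then show "a \<otimes>\<^bsub>G \<down> ?Z\<^esub> b = b \<otimes>\<^bsub>G \<down> ?Z\<^esub> a" by simp
  qed
  then have "nilpotent_group (G \<down> ?Z)" by (rule comm_group.comm_group_nilpotent)
  then have "?Z \<subseteq> fitting_subgroup (G \<down> ?Z)"
    using fitting_greatest(3)[OF Z.is_group finZ Z.normal_self] by simp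
  then have "?Z \<subseteq> {\<one>}"
    using radical_restrict_subnormal[OF radical_fitting is_group fin snZ] fit by auto
  then show ?thesis
    using Q.quasisimple_centerless[OF finQ] Q by (simp add: component_def)
qed

text \<open>A trivial soluble radical forces a trivial Fitting subgroup, so the components are
  simple and generate the generalized Fitting subgroup; as distinct ones commute, their product is
  direct. \<open>G\<close> is a plain monoid so that its own subgroups can serve as the factors; it
  will be a quotient.\<close>

lemma gen_fitting_direct_product:
  fixes G :: "'a monoid" (structure)
  assumes G: "group G" and fin: "finite (carrier G)" and triv: "class_radical solvable G = {\<one>}"
  shows "direct_product_of_nonabelian_simples (G \<down> gen_fitting_subgroup G)"
proof -
  interpret group G by fact
  have sF: "subgroup (fitting_subgroup G) G"
    using radical_subgroup[OF radical_fitting G fin] .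
  have "solvable (G \<down> fitting_subgroup G)"
    using group.nilpotent_imp_solvable[OF subgroup_imp_group[OF sF] fitting_greatest(2)[OF G fin]] .
  then have "fitting_subgroup G \<subseteq> {\<one>}"
    using solvable_greatest(3)[OF G fin fitting_greatest(1)[OF G fin]] triv by simp
  then have fit: "fitting_subgroup G = {\<one>}" using subgroup.one_closed[OF sF] by blast
  note simple = component_nonabelian_simple[OF fin fit]
  let ?C = "{Q. component G Q}"
  have "?C \<subseteq> Pow (carrier G)" using union_components_subset[OF fin] by blast
  then have "finite ?C" using fin finite_subset by blast
  then obtain S where "bij_betw S {0..<card ?C} ?C" using ex_bij_betw_nat_finite by blast
  then obtain r :: nat where bij: "bij_betw S {..<r} ?C" by (metis atLeast0LessThan)
  have SC: "component G (S i)" if "i < r" for i using bij that by (auto simp: bij_betw_def)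
  interpret S: internal_direct_product G r "\<lambda>i. (G \<down> S i)" "\<lambda>_ x. x"
  proof (rule internal_direct_productI[OF fin, of r _ _ S])
    show "group_hom (G \<down> S i) G (\<lambda>x. x)" if "i < r" for i
      using group_hom_inclusion[OF G componentD(1)[OF fin SC[OF that]]] .
  qed (use SC simple bij in \<open>auto simp: bij_betw_def\<close>)
  have un: "(\<Union>i<r. S i) = \<Union>?C" using bij by (auto simp: bij_betw_def)
  have "{\<one>} \<union> \<Union>?C \<subseteq> generate G (\<Union>?C)" by (auto intro: generate.one generate.incl)
  then have "gen_fitting_subgroup G = generate G (\<Union>?C)"
    unfolding gen_fitting_subgroup_component fit
    using generate_subgroup_incl[OF _ generate_is_subgroup[OF union_components_subset[OF fin]]]
      mono_generate[of "\<Union>?C" "{\<one>} \<union> \<Union>?C"] by blast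
  then have im: "S.multiply ` carrier S.factor_product = gen_fitting_subgroup G"
    using S.multiply_image un by simp
  interpret m: group_hom S.factor_product G S.multiply by (rule S.multiply_hom)
  have "S.multiply \<in> iso S.factor_product (G \<down> gen_fitting_subgroup G)"
    using m.homh im S.multiply_inj by (auto simp: iso_def bij_betw_def hom_def)
  then have "S.factor_product \<cong> (G \<down> gen_fitting_subgroup G)" by (rule is_isoI)
  then have "(G \<down> gen_fitting_subgroup G) \<cong> S.factor_product"
    by (rule group.iso_sym[OF S.group_factor_product])
  then show ?thesis
    unfolding direct_product_of_nonabelian_simples_def using simple[OF SC]
    by (intro exI[of _ r] exI[of _ "\<lambda>i. (G \<down> S i)"]) simp
qed

section \<open>Arbitrary normal series against the canonical one\<close>

lemma nonsoluble_series_le: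
  assumes G: "group G" "finite (carrier G)"
  shows "ext_radical (nonsoluble_series j) gen_fitting_subgroup G \<subseteq> nonsoluble_series (Suc j) G"
    and "nonsoluble_series j G \<subseteq> nonsoluble_series (Suc j) G"
proof -
  have r: "radical (ext_radical (nonsoluble_series j) gen_fitting_subgroup)"
    using radical_ext[OF radical_nonsoluble_series radical_gen_fitting] .
  show 1: "ext_radical (nonsoluble_series j) gen_fitting_subgroup G \<subseteq> nonsoluble_series (Suc j) G"
    using ext_radical_superset[OF r radical_solvable G] by simp
  show "nonsoluble_series j G \<subseteq> nonsoluble_series (Suc j) G"
    using ext_radical_superset[OF radical_nonsoluble_series radical_gen_fitting G] 1 by blast
qed

lemma nonsoluble_series_mono:
  assumes "group G" "finite (carrier G)" "i \<le> j"
  shows "nonsoluble_series i G \<subseteq> nonsoluble_series j G"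
  by (rule lift_Suc_mono_le[of "\<lambda>i. nonsoluble_series i G"])
    (use nonsoluble_series_le(2)[OF assms(1,2)] assms(3) in blast)+

text \<open>The natural map from \<open>M/N\<close> to \<open>G Mod \<rho> G\<close> has normal
  image, and \<open>M/N\<close> is its own generalized Fitting subgroup; so the image property puts
  all of \<open>M\<close> into the next generalized Fitting layer.\<close>

lemma direct_product_factor_subset:
  assumes G: "group G" "finite (carrier G)" and M: "M \<lhd> G" and N: "N \<lhd> G" "N \<subseteq> M"
    and \<rho>: "radical \<rho>" and sub: "N \<subseteq> \<rho> G"
    and prod: "direct_product_of_nonabelian_simples ((G \<down> M) Mod N)"
  shows "M \<subseteq> ext_radical \<rho> gen_fitting_subgroup G"
proof -
  interpret group G by fact
  interpret R: normal "\<rho> G" G using radical_normal[OF \<rho> G] .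
  have sM: "subgroup M G" using M by (rule normal_imp_subgroup)
  let ?M = "G \<down> M"
  have finM: "finite (carrier ?M)" using finite_subgroup[OF sM G(2)] by simp
  interpret N: normal N ?M using normal_subgroup_restrict[OF N(1) sM N(2)] .
  obtain \<theta> where \<theta>: "group_hom (?M Mod N) (G Mod \<rho> G) \<theta>"
    "\<And>x. x \<in> carrier ?M \<Longrightarrow> \<theta> (N #>\<^bsub>?M\<^esub> x) = \<rho> G #>\<^bsub>G\<^esub> x"
    using induced_quotient_hom[OF group_hom_inclusion[OF G(1) sM] N.normal_axioms R.normal_axioms] sub by auto
  have "\<theta> ` carrier (?M Mod N) = (\<lambda>x. \<rho> G #>\<^bsub>G\<^esub> x) ` M"
    unfolding N.quotient_surj[symmetric] image_image using \<theta>(2) by (intro image_cong) auto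
  moreover from this have "\<theta> ` carrier (?M Mod N) \<lhd> G Mod \<rho> G"
    using R.image_in_quotient_normal[OF M] by simp
  ultimately have "(\<lambda>x. \<rho> G #>\<^bsub>G\<^esub> x) ` M \<subseteq> gen_fitting_subgroup (G Mod \<rho> G)"
    using radical_image[OF radical_gen_fitting \<theta>(1) N.finite_quotient[OF finM] R.finite_quotient[OF G(2)]]
      direct_product_gen_fitting[OF N.factorgroup_is_group N.finite_quotient[OF finM] prod] by simp
  then show ?thesis using subgroup.subset[OF sM] unfolding ext_radical_def by blast
qed

text \<open>A soluble factor is absorbed without raising the index; a nonsoluble one is a direct
  product of simple groups and costs one step. The index counts the nonsoluble factors passed so
  far.\<close>

lemma normal_series_subset_nonsoluble_series:
  assumes G: "group G" "finite (carrier G)" and N: "normal_series G m N"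
    and factors: "\<And>i. i < m \<Longrightarrow> solvable (series_factor G N i) \<or>
      direct_product_of_nonabelian_simples (series_factor G N i)"
    and "i \<le> m"
  shows "N i \<subseteq> nonsoluble_series (card {k. k < i \<and> \<not> solvable (series_factor G N k)}) G"
  using assms(5)
proof (induction i)
  case 0
  have "\<one>\<^bsub>G\<^esub> \<in> nonsoluble_series j G" for j
    using subgroup.one_closed[OF radical_subgroup[OF radical_nonsoluble_series G]] .
  moreover have "N 0 = {\<one>\<^bsub>G\<^esub>}" using N unfolding normal_series_def by (elim conjE)
  ultimately show ?case by (simp del: nonsoluble_series.simps)
next
  case (Suc i)
  let ?c = "card {k. k < i \<and> \<not> solvable (series_factor G N k)}"
  have nor: "N (Suc i) \<lhd> G" "N i \<lhd> G" "N i \<subseteq> N (Suc i)" using N Suc.prems by (auto simp: normal_series_def)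
  have IH: "N i \<subseteq> nonsoluble_series ?c G" using Suc by simp
  show ?case
  proof (cases "solvable (series_factor G N i)")
    case True
    then have "{k. k < Suc i \<and> \<not> solvable (series_factor G N k)} = {k. k < i \<and> \<not> solvable (series_factor G N k)}"
      by (auto simp: less_Suc_eq)
    then show ?thesis
      using solvable_closedD[OF solvable_closed_nonsoluble_series G nor IH] True
      by (simp add: series_factor_def)
  next
    case False
    then have "{k. k < Suc i \<and> \<not> solvable (series_factor G N k)}
        = insert i {k. k < i \<and> \<not> solvable (series_factor G N k)}"
      by (auto simp: less_Suc_eq)
    then have c: "card {k. k < Suc i \<and> \<not> solvable (series_factor G N k)} = Suc ?c" by simp
    have "direct_product_of_nonabelian_simples ((G \<down> N (Suc i)) Mod N i)"
      using factors[of i] False Suc.prems by (simp add: series_factor_def)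
    then have "N (Suc i) \<subseteq> ext_radical (nonsoluble_series ?c) gen_fitting_subgroup G"
      using direct_product_factor_subset[OF G nor radical_nonsoluble_series IH] by blast
    then show ?thesis unfolding c using nonsoluble_series_le(1)[OF G] by blast
  qed
qed

text \<open>The preimage of the soluble radical of the quotient has a soluble factor over
  \<open>\<rho> G\<close>, so \<open>solvable_closed\<close> pushes it back into
  \<open>\<rho> G\<close>.\<close>

lemma class_radical_solvable_quotient:
  assumes \<rho>: "radical \<rho>" "solvable_closed \<rho>" and G: "group G" "finite (carrier G)"
  shows "class_radical solvable (G Mod \<rho> G) = {\<one>\<^bsub>G Mod \<rho> G\<^esub>}"
proof -
  interpret R: normal "\<rho> G" G using radical_normal[OF \<rho>(1) G] .
  interpret Q: group "G Mod \<rho> G" by (rule R.factorgroup_is_group)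
  note finQ = R.finite_quotient[OF G(2)]
  note S = solvable_greatest[OF Q.is_group finQ]
  let ?M = "ext_radical \<rho> (class_radical solvable) G"
  have M: "?M \<lhd> G" using radical_normal[OF radical_ext[OF \<rho>(1) radical_solvable] G] .
  have sub: "\<rho> G \<subseteq> ?M" using ext_radical_superset[OF \<rho>(1) radical_solvable G] .
  have im: "(\<lambda>x. \<rho> G #>\<^bsub>G\<^esub> x) ` ?M = class_radical solvable (G Mod \<rho> G)"
    using ext_radical_cosets[OF \<rho>(1) radical_solvable G] .
  have "(G \<down> ?M) Mod \<rho> G = ((G Mod \<rho> G) \<down> class_radical solvable (G Mod \<rho> G))"
    using restrict_FactGroup[of ?M G "\<rho> G"] im by simp
  then have "?M \<subseteq> \<rho> G"
    using solvable_closedD[OF \<rho>(2) G M R.normal_axioms sub order_refl] S(2) by simp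
  then have "class_radical solvable (G Mod \<rho> G) \<subseteq> {\<rho> G}"
    unfolding im[symmetric] using R.coset_eq_self_iff R.subset by auto
  then show ?thesis using subgroup.one_closed[OF normal_imp_subgroup[OF S(1)]] by auto
qed

text \<open>The witness \<open>N\<close> has \<open>N\<^sub>2\<^sub>j\<^sub>+\<^sub>1\<close> as the \<open>j\<close>-th canonical term and \<open>N\<^sub>2\<^sub>j\<^sub>+\<^sub>2/N\<^sub>2\<^sub>j\<^sub>+\<^sub>1\<close> as the generalized
  Fitting subgroup of \<open>G/N\<^sub>2\<^sub>j\<^sub>+\<^sub>1\<close>, which has trivial soluble radical.\<close>

lemma nonsoluble_series_normal_series:
  assumes G: "group G" "finite (carrier G)" and top: "nonsoluble_series k G = carrier G"
  shows "\<exists>l\<le>k. \<exists>m N. normal_series G m N \<and>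
        (\<forall>i<m. solvable (series_factor G N i) \<or>
               direct_product_of_nonabelian_simples (series_factor G N i)) \<and>
        l = card {i. i < m \<and> \<not> solvable (series_factor G N i)}"
proof -
  define N where "N = (\<lambda>i. if i = 0 then {\<one>\<^bsub>G\<^esub>} else if odd i then nonsoluble_series (i div 2) G
    else ext_radical (nonsoluble_series (i div 2 - 1)) gen_fitting_subgroup G)"
  have odd: "N (Suc (2 * j)) = nonsoluble_series j G" for j by (simp add: N_def)
  have even: "N (Suc (Suc (2 * j))) = ext_radical (nonsoluble_series j) gen_fitting_subgroup G" for j
    by (simp add: N_def)
  have N0: "N 0 = {\<one>\<^bsub>G\<^esub>}" by (simp add: N_def)
  interpret group G by fact
  have cases: "i = 0 \<or> (\<exists>j. i = Suc (2 * j)) \<or> (\<exists>j. i = Suc (Suc (2 * j)))" for i :: nat by presburger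
  have re: "radical (ext_radical (nonsoluble_series j) gen_fitting_subgroup)" for j
    using radical_ext[OF radical_nonsoluble_series radical_gen_fitting] .
  have nor: "N i \<lhd> G" for i
    using cases[of i] radical_normal[OF radical_nonsoluble_series G] radical_normal[OF re G] one_is_normal
    by (auto simp: odd even N0)
  have sub: "N i \<subseteq> N (Suc i)" for i
    using cases[of i]
  proof (elim disjE exE)
    assume "i = 0"
    then show ?thesis using N0 odd[of 0] subgroup.one_closed[OF normal_imp_subgroup[OF nor[of 1]]] by simp
  next
    fix j assume "i = Suc (2 * j)"
    then show ?thesis
      using odd even ext_radical_superset[OF radical_nonsoluble_series radical_gen_fitting G] by simp
  next
    fix j assume i: "i = Suc (Suc (2 * j))"
    then show ?thesis using odd[of "Suc j"] even nonsoluble_series_le(1)[OF G] by simp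
  qed
  have sol0: "solvable (series_factor G N 0)"
  proof -
    interpret S: group "G \<down> class_radical solvable G"
      using subgroup_imp_group[OF radical_subgroup[OF radical_solvable G]] .
    interpret one: normal "{\<one>\<^bsub>G\<^esub>}" "G \<down> class_radical solvable G"
      using S.one_is_normal by simp
    have "solvable ((G \<down> class_radical solvable G) Mod {\<one>\<^bsub>G\<^esub>})"
      using group_hom.surj_hom_imp_solvable[OF one.quotient_hom one.quotient_surj solvable_greatest(2)[OF G]] .
    then show ?thesis using N0 odd[of 0] by (simp add: series_factor_def)
  qed
  have sol_even: "solvable (series_factor G N (Suc (Suc (2 * j))))" for j
  proof -
    let ?\<rho> = "ext_radical (nonsoluble_series j) gen_fitting_subgroup"
    interpret R: normal "?\<rho> G" G using radical_normal[OF re G] .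
    have "series_factor G N (Suc (Suc (2 * j))) =
        ((G Mod ?\<rho> G) \<down> class_radical solvable (G Mod ?\<rho> G))"
      unfolding series_factor_def even using odd[of "Suc j"] restrict_FactGroup[of _ G "?\<rho> G"]
        ext_radical_cosets[OF re radical_solvable G, of j] by simp
    then show ?thesis
      using solvable_greatest(2)[OF R.factorgroup_is_group R.finite_quotient[OF G(2)]] by simp
  qed
  have prod_odd: "direct_product_of_nonabelian_simples (series_factor G N (Suc (2 * j)))" for j
  proof -
    let ?\<rho> = "nonsoluble_series j"
    interpret R: normal "?\<rho> G" G using radical_normal[OF radical_nonsoluble_series G] .
    have "series_factor G N (Suc (2 * j)) =
        ((G Mod ?\<rho> G) \<down> gen_fitting_subgroup (G Mod ?\<rho> G))"
      unfolding series_factor_def even odd using restrict_FactGroup[of _ G "?\<rho> G"]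
        ext_radical_cosets[OF radical_nonsoluble_series radical_gen_fitting G, of j] by simp
    then show ?thesis
      using gen_fitting_direct_product[OF R.factorgroup_is_group R.finite_quotient[OF G(2)]
          class_radical_solvable_quotient[OF radical_nonsoluble_series solvable_closed_nonsoluble_series G]]
      by simp
  qed
  let ?m = "Suc (2 * k)"
  have "normal_series G ?m N"
    unfolding normal_series_def using N0 odd top nor sub by simp
  moreover have "solvable (series_factor G N i) \<or> direct_product_of_nonabelian_simples (series_factor G N i)" for i
    using cases[of i] sol0 sol_even prod_odd by auto
  moreover have "{i. i < ?m \<and> \<not> solvable (series_factor G N i)} \<subseteq> (\<lambda>j. Suc (2 * j)) ` {..<k}"
  proof
    fix i assume i: "i \<in> {i. i < ?m \<and> \<not> solvable (series_factor G N i)}"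
    then obtain j where "i = Suc (2 * j)" using cases[of i] sol0 sol_even by auto
    then show "i \<in> (\<lambda>j. Suc (2 * j)) ` {..<k}" using i by auto
  qed
  then have "card {i. i < ?m \<and> \<not> solvable (series_factor G N i)} \<le> card ((\<lambda>j. Suc (2 * j)) ` {..<k})"
    by (intro card_mono) auto
  then have "card {i. i < ?m \<and> \<not> solvable (series_factor G N i)} \<le> k"
    using card_image_le[of "{..<k}" "\<lambda>j. Suc (2 * j)"] by simp
  ultimately show ?thesis by blast
qed

text \<open>The canonical series bounds the length from above; from below, it dominates every
  admissible series. That it reaches \<open>G\<close> also ensures that the \<open>LEAST\<close> in
  the definition is attained.\<close>

lemma nonsoluble_length_le_iff:
  assumes G: "group G" "finite (carrier G)"
  shows "nonsoluble_length G \<le> k \<longleftrightarrow> nonsoluble_series k G = carrier G"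
proof
  let ?P = "\<lambda>l. \<exists>m N. normal_series G m N \<and>
        (\<forall>i<m. solvable (series_factor G N i) \<or>
               direct_product_of_nonabelian_simples (series_factor G N i)) \<and>
        l = card {i. i < m \<and> \<not> solvable (series_factor G N i)}"
  have len: "nonsoluble_length G = (LEAST l. ?P l)" by (simp add: nonsoluble_length_def)
  {
    assume "nonsoluble_series k G = carrier G"
    then obtain l where "l \<le> k" "?P l" using nonsoluble_series_normal_series[OF G] by blast
    then show "nonsoluble_length G \<le> k" unfolding len using Least_le[of ?P l] order_trans by blast
  }
  assume le: "nonsoluble_length G \<le> k"
  have "\<exists>i. nonsoluble_series i G = carrier G"
    by (rule radical_series_reaches[of nonsoluble_series, OF radical_nonsoluble_series G nonsoluble_series_le(1)[OF G]])
  then have "\<exists>l. ?P l" using nonsoluble_series_normal_series[OF G] by blast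
  then have "?P (nonsoluble_length G)" unfolding len by (rule LeastI_ex)
  then obtain m N where N: "normal_series G m N"
    "\<And>i. i < m \<Longrightarrow> solvable (series_factor G N i) \<or> direct_product_of_nonabelian_simples (series_factor G N i)"
    "nonsoluble_length G = card {i. i < m \<and> \<not> solvable (series_factor G N i)}" by blast
  have "carrier G \<subseteq> nonsoluble_series (nonsoluble_length G) G"
    using normal_series_subset_nonsoluble_series[OF G N(1,2) order_refl] N(1,3) by (simp add: normal_series_def)
  also have "\<dots> \<subseteq> nonsoluble_series k G" using nonsoluble_series_mono[OF G le] .
  finally show "nonsoluble_series k G = carrier G"
    using subgroup.subset[OF radical_subgroup[OF radical_nonsoluble_series G]] by blast
qed

text \<open>A normal subgroup meets the canonical term of \<open>G\<close> in its own canonical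
  term, so it has length at most \<open>k\<close> exactly if it lies in the term of index
  \<open>k\<close>. That term is normal itself, hence the \<open>GREATEST\<close> exists.\<close>

lemma nonsoluble_radical_eq:
  assumes G: "group G" "finite (carrier G)"
  shows "nonsoluble_radical G k = nonsoluble_series k G"
proof -
  interpret group G by fact
  have iff: "nonsoluble_length (G \<down> N) \<le> k \<longleftrightarrow> N \<subseteq> nonsoluble_series k G" if N: "N \<lhd> G" for N
  proof -
    have sN: "subgroup N G" using N by (rule normal_imp_subgroup)
    have "finite (carrier (G \<down> N))" using finite_subgroup[OF sN G(2)] by simp
    then show ?thesis
      using nonsoluble_length_le_iff[OF subgroup_imp_group[OF sN]]
        radical_restrict[OF radical_nonsoluble_series G N] by auto
  qed
  have nor: "nonsoluble_series k G \<lhd> G" using radical_normal[OF radical_nonsoluble_series G] .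
  show ?thesis
    unfolding nonsoluble_radical_def
    by (rule Greatest_equality) (use iff nor in auto)
qed

section \<open>Engel subgroups\<close>

lemma (in group) engel_comm_closed [simp]:
  "x \<in> carrier G \<Longrightarrow> g \<in> carrier G \<Longrightarrow> engel_comm G x g n \<in> carrier G"
  by (induction n) auto

lemma (in group_hom) hom_engel_comm:
  "x \<in> carrier G \<Longrightarrow> g \<in> carrier G \<Longrightarrow> h (engel_comm G x g n) = engel_comm H (h x) (h g) n"
  by (induction n) auto

lemma (in group) engel_subgroup_subgroup:
  "g \<in> carrier G \<Longrightarrow> subgroup (engel_subgroup G n g) G"
  unfolding engel_subgroup_def by (intro generate_is_subgroup) auto

lemma (in group_hom) engel_subgroup_image:
  assumes "h ` carrier G = carrier H" "g \<in> carrier G"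
  shows "h ` engel_subgroup G n g = engel_subgroup H n (h g)"
proof -
  let ?S = "{engel_comm G x g n |x. x \<in> carrier G}"
  have "h ` ?S = {engel_comm H x (h g) n |x. x \<in> h ` carrier G}"
    using assms(2) by (auto simp: image_iff) (metis hom_engel_comm)+
  moreover have "?S \<subseteq> carrier G" using assms(2) by auto
  ultimately show ?thesis
    unfolding engel_subgroup_def using generate_img[of ?S] assms(1) by simp
qed

lemma (in group) engel_subgroup_restrict:
  assumes K: "subgroup K G" "g \<in> K"
  shows "engel_subgroup (G \<down> K) n g \<subseteq> engel_subgroup G n g"
proof -
  interpret K: group "G \<down> K" using K(1) by (rule subgroup_imp_group)
  interpret i: group_hom "G \<down> K" G "\<lambda>x. x" by (rule group_hom_inclusion[OF is_group K(1)])
  let ?S = "{engel_comm (G \<down> K) x g n |x. x \<in> K}"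
  have "?S \<subseteq> K" using K.engel_comm_closed K(2) by auto
  then have "engel_subgroup (G \<down> K) n g = generate G ?S"
    unfolding engel_subgroup_def using generate_consistent[OF _ K(1)] by simp
  also have "?S \<subseteq> {engel_comm G x g n |x. x \<in> carrier G}"
    using i.hom_engel_comm K(2) subgroup.mem_carrier[OF K(1)] by fastforce
  then have "generate G ?S \<subseteq> engel_subgroup G n g" unfolding engel_subgroup_def by (rule mono_generate)
  finally show ?thesis .
qed

lemma (in group) engel_subgroup_conj:
  assumes "g \<in> carrier G" "c \<in> carrier G" "c \<otimes> g = g \<otimes> c" "x \<in> engel_subgroup G n g"
  shows "c \<otimes> x \<otimes> inv c \<in> engel_subgroup G n g"
proof -
  interpret c: group_hom G G "\<lambda>x. c \<otimes> x \<otimes> inv c" using conj_hom[OF assms(2)] .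
  have "c \<otimes> g \<otimes> inv c = g" using assms by (simp add: m_assoc)
  then have "(\<lambda>x. c \<otimes> x \<otimes> inv c) ` engel_subgroup G n g = engel_subgroup G n g"
    using c.engel_subgroup_image[OF conj_hom_surj[OF assms(2)] assms(1)] by simp
  then show ?thesis using assms(4) by blast
qed

text \<open>The normalizer of \<open>L\<close>. Both conjugations are required, so that it is closed
  under inverses for every subset \<open>L\<close> of the carrier, finite or not.\<close>

definition normalizing :: "('a, 'b) monoid_scheme \<Rightarrow> 'a set \<Rightarrow> 'a set" where
  "normalizing G L = {k \<in> carrier G. \<forall>x\<in>L. k \<otimes>\<^bsub>G\<^esub> x \<otimes>\<^bsub>G\<^esub> inv\<^bsub>G\<^esub> k \<in> L \<and> inv\<^bsub>G\<^esub> k \<otimes>\<^bsub>G\<^esub> x \<otimes>\<^bsub>G\<^esub> k \<in> L}"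

lemma (in group) subgroup_normalizing:
  assumes "L \<subseteq> carrier G" shows "subgroup (normalizing G L) G"
proof (rule subgroupI)
  show "normalizing G L \<noteq> {}" using assms by (auto simp: normalizing_def intro!: exI[of _ \<one>])
  show "normalizing G L \<subseteq> carrier G" by (auto simp: normalizing_def)
  fix a assume a: "a \<in> normalizing G L"
  then show "inv a \<in> normalizing G L" by (auto simp: normalizing_def)
  fix b assume b: "b \<in> normalizing G L"
  have "a \<otimes> b \<otimes> x \<otimes> inv (a \<otimes> b) = a \<otimes> (b \<otimes> x \<otimes> inv b) \<otimes> inv a"
    "inv (a \<otimes> b) \<otimes> x \<otimes> (a \<otimes> b) = inv b \<otimes> (inv a \<otimes> x \<otimes> a) \<otimes> b" if "x \<in> L" for x
    using a b subsetD[OF assms that] by (simp_all add: normalizing_def group_word)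
  then show "a \<otimes> b \<in> normalizing G L" using a b by (simp add: normalizing_def)
qed

lemma (in group) subgroup_subset_normalizing:
  assumes "subgroup L G" shows "L \<subseteq> normalizing G L"
  using subgroup.mem_carrier[OF assms] subgroup.m_closed[OF assms] subgroup.m_inv_closed[OF assms]
  by (auto simp: normalizing_def)

lemma (in group) normal_of_normalizing:
  assumes "subgroup L G" "carrier G \<subseteq> normalizing G L" shows "L \<lhd> G"
  using assms unfolding normal_inv_iff normalizing_def by blast

lemma (in group) normalizing_generate:
  assumes S: "S \<subseteq> carrier G" and c: "c \<in> carrier G"
    and "\<And>s. s \<in> S \<Longrightarrow> c \<otimes> s \<otimes> inv c \<in> generate G S" "\<And>s. s \<in> S \<Longrightarrow> inv c \<otimes> s \<otimes> c \<in> generate G S"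
  shows "c \<in> normalizing G (generate G S)"
proof -
  have "c \<otimes> x \<otimes> inv c \<in> generate G S"
    if c: "c \<in> carrier G" and "\<And>s. s \<in> S \<Longrightarrow> c \<otimes> s \<otimes> inv c \<in> generate G S" and x: "x \<in> generate G S" for c x
  proof -
    interpret h: group_hom G G "\<lambda>x. c \<otimes> x \<otimes> inv c" using conj_hom[OF c] .
    have "(\<lambda>x. c \<otimes> x \<otimes> inv c) ` S \<subseteq> generate G S" using that(2) by blast
    then have "(\<lambda>x. c \<otimes> x \<otimes> inv c) ` generate G S \<subseteq> generate G S"
      using h.generate_img[OF S] generate_subgroup_incl[OF _ generate_is_subgroup[OF S]] by blast
    then show ?thesis using x by blast
  qed
  from this[of c] this[of "inv c"] show ?thesis
    using assms by (simp add: normalizing_def)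
qed

text \<open>Conjugation by \<open>c\<close> is an automorphism fixing \<open>g\<close>, hence it
  permutes the Engel commutators. In this way the parts of a chief factor that commute with
  \<open>g\<close> normalize the generated subgroup without having to lie in it.\<close>

lemma (in group) centralizer_normalizing_engel:
  assumes g: "g \<in> carrier G" and c: "c \<in> carrier G" "c \<otimes> g = g \<otimes> c"
  shows "c \<in> normalizing G (generate G (engel_subgroup G n g \<union> {g}))" (is "c \<in> normalizing G (generate G ?S)")
proof (rule normalizing_generate)
  show "?S \<subseteq> carrier G" using engel_subgroup_subgroup[OF g] subgroup.subset g by blast
  show "c \<in> carrier G" by (rule c(1))
  have ic: "inv c \<in> carrier G" "inv c \<otimes> g = g \<otimes> inv c"
  proof -
    have "inv c \<otimes> (c \<otimes> g) \<otimes> inv c = inv c \<otimes> (g \<otimes> c) \<otimes> inv c" using c by simp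
    then show "inv c \<otimes> g = g \<otimes> inv c" using c(1) g by (simp add: m_assoc)
  qed (use c in simp)
  have cg: "c \<otimes> g \<otimes> inv c = g" "inv c \<otimes> g \<otimes> c = g"
    using c g ic by (simp_all add: m_assoc)
  fix s assume s: "s \<in> ?S"
  show "c \<otimes> s \<otimes> inv c \<in> generate G ?S" "inv c \<otimes> s \<otimes> c \<in> generate G ?S"
    using s cg engel_subgroup_conj[OF g c] engel_subgroup_conj[OF g ic] c(1)
    by (auto intro: generate.incl)
qed

section \<open>The hypothesis on simple products, applied inside \<open>G\<close>\<close>

lemma nonabelian_simple_iso:
  assumes "f \<in> iso G H" "group G" "group H" "nonabelian_simple G"
  shows "nonabelian_simple H"
proof -
  have "simple_group H"
    using assms simple_group.iso_simple by (auto simp: nonabelian_simple_def)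
  moreover have "\<not> comm_group H"
  proof
    assume "comm_group H"
    moreover have "H \<cong> G" using group.iso_sym[OF assms(2)] is_isoI[OF assms(1)] by blast
    ultimately have "comm_group G"
      using comm_group.iso_imp_comm_group assms(2) group.is_monoid by blast
    then show False using assms(4) by (simp add: nonabelian_simple_def)
  qed
  ultimately show ?thesis by (simp add: nonabelian_simple_def)
qed

text \<open>The hypothesis speaks of simple groups on natural numbers; a finite group is moved there
  along an injection of its carrier.\<close>

lemma (in group) nat_copy:
  assumes "finite (carrier G)"
  obtains T :: "nat monoid" and f where "group T" "f \<in> iso T G"
proof -
  obtain b :: "'a \<Rightarrow> nat" where b: "inj_on b (carrier G)"
    using finite_imp_inj_to_nat_seg[OF assms] by blast
  let ?c = "inv_into (carrier G) b"
  let ?H = "\<lparr>carrier = UNIV, monoid.mult = \<lambda>x y. b (?c x \<otimes> ?c y), one = b \<one>\<rparr> :: nat monoid"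
  have hom: "b \<in> hom G ?H" using b by (auto simp: hom_def)
  let ?T = "?H\<lparr>carrier := b ` carrier G, one := b \<one>\<rparr>"
  have T: "group ?T" using hom_imp_img_group[OF hom] .
  moreover have "b \<in> iso G ?T" using hom b by (auto simp: iso_def hom_def bij_betw_def)
  ultimately show ?thesis using that iso_set_sym by blast
qed

definition engel_generates_simple_products :: bool where
  "engel_generates_simple_products \<longleftrightarrow>
    (\<forall>(r :: nat) (T :: nat \<Rightarrow> nat monoid) \<phi> (m :: nat).
       1 \<le> r \<longrightarrow>
       (\<forall>i<r. nonabelian_simple (T i)) \<longrightarrow>
       \<phi> \<in> auto (product_group {..<r} T) \<longrightarrow>
       (\<exists>x\<in>carrier (product_group {..<r} T). \<phi> x \<noteq> x) \<longrightarrow>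
       permutes_factors_transitively r T \<phi> \<longrightarrow>
       1 \<le> m \<longrightarrow>
       aut_engel_subgroup (product_group {..<r} T) m \<phi> = carrier (product_group {..<r} T))"

text \<open>The components of an orbit generate a direct product, on which conjugation by
  \<open>g\<close> permutes the factors transitively. The hypothesis concerns external products, so
  this automorphism is transported along the multiplication map \<open>\<Phi>\<close>; the
  generating commutators it yields are sent by \<open>\<Phi>\<close> to Engel commutators of
  \<open>g\<close>.\<close>

lemma (in group) simple_orbit_engel:
  fixes S :: "nat \<Rightarrow> 'a set" and r :: nat
  assumes hyp: engel_generates_simple_products
    and fin: "finite (carrier G)" and g: "g \<in> carrier G" and n: "1 \<le> n" and r: "1 \<le> r"
    and S: "\<And>i. i < r \<Longrightarrow> component G (S i)" "\<And>i. i < r \<Longrightarrow> nonabelian_simple (G \<down> S i)"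
    and inj: "inj_on S {..<r}"
    and perm: "\<And>i. i < r \<Longrightarrow> \<exists>j<r. (\<lambda>x. inv g \<otimes> x \<otimes> g) ` S i = S j"
    and trans: "\<And>i j. i < r \<Longrightarrow> j < r \<Longrightarrow> \<exists>m. ((\<lambda>x. inv g \<otimes> x \<otimes> g) ^^ m) ` S i = S j"
    and nontriv: "i0 < r" "s0 \<in> S i0" "s0 \<otimes> g \<noteq> g \<otimes> s0"
  shows "(\<Union>i<r. S i) \<subseteq> engel_subgroup G n g"
proof -
  let ?c = "\<lambda>x. inv g \<otimes> x \<otimes> g"
  interpret c: group_hom G G ?c using conj_hom[of "inv g"] g by simp
  have grS: "group (G \<down> S i)" if "i < r" for i
    using subgroup_imp_group[OF componentD(1)[OF fin S(1)[OF that]]] .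
  have finS: "finite (carrier (G \<down> S i))" if "i < r" for i
    using finite_subgroup[OF componentD(1)[OF fin S(1)[OF that]] fin] by simp
  have "\<exists>(T :: nat monoid) f. i < r \<longrightarrow> group T \<and> f \<in> iso T (G \<down> S i)" for i
  proof (cases "i < r")
    case True
    show ?thesis by (rule group.nat_copy[OF grS[OF True] finS[OF True]]) blast
  qed simp
  then have "\<exists>(T :: nat \<Rightarrow> nat monoid) f. \<forall>i. i < r \<longrightarrow> group (T i) \<and> f i \<in> iso (T i) (G \<down> S i)"
    by metis
  then obtain T :: "nat \<Rightarrow> nat monoid" and f
    where T: "\<And>i. i < r \<Longrightarrow> group (T i)" "\<And>i. i < r \<Longrightarrow> f i \<in> iso (T i) (G \<down> S i)"
    by blast
  have simple: "nonabelian_simple (T i)" if "i < r" for i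
    using nonabelian_simple_iso[OF _ grS T(1) S(2)] group.iso_set_sym[OF T(1) T(2)] that by blast
  have fS: "f i ` carrier (T i) = S i" if "i < r" for i
    using T(2)[OF that] by (simp add: iso_def bij_betw_def)
  have SG: "S i \<subseteq> carrier G" if "i < r" for i
    using subgroup.subset[OF componentD(1)[OF fin S(1)[OF that]]] .
  interpret S: internal_direct_product G r T f
  proof (rule internal_direct_productI[OF fin _ _ fS S inj])
    fix i assume i: "i < r"
    show "group_hom (T i) G (f i)"
      using T(1)[OF i] T(2)[OF i] SG[OF i] by (auto simp: group_hom_def group_hom_axioms_def iso_def hom_def)
    show "inj_on (f i) (carrier (T i))" using T(2)[OF i] by (simp add: iso_def bij_betw_def)
  qed
  let ?P = "product_group {..<r} T"
  interpret P: group ?P by (rule S.group_factor_product)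
  define \<Phi> where "\<Phi> = S.multiply"
  interpret \<Phi>: group_hom ?P G \<Phi> unfolding \<Phi>_def by (rule S.multiply_hom)
  let ?W = "generate G (\<Union>i<r. S i)"
  have \<Phi>inj: "inj_on \<Phi> (carrier ?P)" unfolding \<Phi>_def by (rule S.multiply_inj)
  have \<Phi>im: "\<Phi> ` carrier ?P = ?W" unfolding \<Phi>_def S.multiply_image using fS by simp
  have \<Phi>df: "\<Phi> ` direct_factor {..<r} T i = S i" if "i < r" for i
    unfolding \<Phi>_def using S.multiply_direct_factor[OF that] fS[OF that] by simp
  have SG: "(\<Union>i<r. S i) \<subseteq> carrier G" using SG by blast
  have cS: "?c ` (\<Union>i<r. S i) \<subseteq> (\<Union>i<r. S i)" using perm by blast
  have cW: "?c w \<in> ?W" if "w \<in> ?W" for w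
  proof -
    have "?c ` ?W = generate G (?c ` (\<Union>i<r. S i))" using c.generate_img[OF SG] by simp
    also have "\<dots> \<subseteq> ?W" using mono_generate[OF cS] .
    finally show ?thesis using that by blast
  qed
  have finP: "finite (carrier ?P)"
    using \<Phi>im \<Phi>inj finite_imageD finite_subset[OF generate_incl[OF SG] fin] by metis
  \<comment> \<open>Conjugation by \<open>g\<close>, pulled back along \<open>\<Phi>\<close>. It is
    restricted to the carrier because the members of \<open>auto\<close> are extensional
    functions.\<close>
  define \<phi> where "\<phi> = (\<lambda>x\<in>carrier ?P. inv_into (carrier ?P) \<Phi> (?c (\<Phi> x)))"
  have \<phi>: "\<phi> x \<in> carrier ?P" "\<Phi> (\<phi> x) = ?c (\<Phi> x)" if "x \<in> carrier ?P" for x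
  proof -
    have "?c (\<Phi> x) \<in> \<Phi> ` carrier ?P" using cW \<Phi>im that by blast
    then show "\<phi> x \<in> carrier ?P" "\<Phi> (\<phi> x) = ?c (\<Phi> x)"
      using that by (simp_all add: \<phi>_def inv_into_into f_inv_into_f del: carrier_product_group)
  qed
  have \<phi>hom: "\<phi> \<in> hom ?P ?P"
  proof (rule homI)
    fix x y assume x: "x \<in> carrier ?P" and y: "y \<in> carrier ?P"
    have "\<Phi> (\<phi> (x \<otimes>\<^bsub>?P\<^esub> y)) = \<Phi> (\<phi> x \<otimes>\<^bsub>?P\<^esub> \<phi> y)"
      using \<phi> x y P.m_closed[OF x y] \<Phi>.hom_mult c.hom_mult[of "\<Phi> x" "\<Phi> y"] by (simp del: carrier_product_group mult_product_group c.hom_mult)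
    then show "\<phi> (x \<otimes>\<^bsub>?P\<^esub> y) = \<phi> x \<otimes>\<^bsub>?P\<^esub> \<phi> y"
      using inj_onD[OF \<Phi>inj] \<phi>(1) x y P.m_closed by blast
  qed (rule \<phi>(1))
  have "inj_on \<phi> (carrier ?P)"
  proof (rule inj_onI)
    fix x y assume x: "x \<in> carrier ?P" and y: "y \<in> carrier ?P" and eq: "\<phi> x = \<phi> y"
    have "?c (\<Phi> x) = ?c (\<Phi> y)" using \<phi>(2)[OF x] \<phi>(2)[OF y] eq by simp
    then have "g \<otimes> ?c (\<Phi> x) \<otimes> inv g = g \<otimes> ?c (\<Phi> y) \<otimes> inv g" by simp
    then have "\<Phi> x = \<Phi> y"
      using g \<Phi>.hom_closed[OF x] \<Phi>.hom_closed[OF y] by (simp add: m_assoc del: carrier_product_group)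
    then show "x = y" using inj_onD[OF \<Phi>inj] x y by blast
  qed
  moreover have "\<phi> ` carrier ?P \<subseteq> carrier ?P" using \<phi>(1) by blast
  ultimately have "bij_betw \<phi> (carrier ?P) (carrier ?P)"
    using endo_inj_surj[OF finP] by (simp only: bij_betw_def)
  then have auto: "\<phi> \<in> auto ?P" using \<phi>hom by (simp add: auto_def Bij_def \<phi>_def)
  have nt: "\<exists>x\<in>carrier ?P. \<phi> x \<noteq> x"
  proof -
    have "s0 \<in> \<Phi> ` carrier ?P" unfolding \<Phi>im using nontriv by (auto intro: generate.incl)
    then obtain x where x: "x \<in> carrier ?P" "\<Phi> x = s0" by blast
    have s: "s0 \<in> carrier G" using nontriv(1,2) SG by blast
    have "\<phi> x \<noteq> x"
    proof
      assume "\<phi> x = x"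
      then have "inv g \<otimes> s0 \<otimes> g = s0" using \<phi>(2)[OF x(1)] x(2) by simp
      then have "g \<otimes> (inv g \<otimes> s0 \<otimes> g) = g \<otimes> s0" by simp
      then show False using nontriv(3) g s by (simp add: m_assoc)
    qed
    then show ?thesis using x(1) by blast
  qed
  have pow: "(\<phi> ^^ m) ` A \<subseteq> carrier ?P \<and> \<Phi> ` (\<phi> ^^ m) ` A = (?c ^^ m) ` \<Phi> ` A"
    if A: "A \<subseteq> carrier ?P" for A m
  proof (induction m)
    case (Suc m)
    have "\<phi> ` (\<phi> ^^ m) ` A \<subseteq> carrier ?P" using Suc \<phi>(1) by blast
    moreover have eq: "\<Phi> ` \<phi> ` B = ?c ` \<Phi> ` B" if "B \<subseteq> carrier ?P" for B
      unfolding image_image by (rule image_cong[OF refl \<phi>(2)[OF subsetD[OF that]]])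
    have "\<Phi> ` \<phi> ` (\<phi> ^^ m) ` A = ?c ` (?c ^^ m) ` \<Phi> ` A"
      unfolding eq[OF conjunct1[OF Suc]] conjunct2[OF Suc] ..
    ultimately show ?case by (simp add: image_comp del: carrier_product_group)
  qed (use A in simp)
  have dfP: "direct_factor {..<r} T i \<subseteq> carrier ?P" for i by (auto simp: direct_factor_def)
  have df_eq: "(\<phi> ^^ m) ` direct_factor {..<r} T i = direct_factor {..<r} T j"
    if "i < r" "j < r" "(?c ^^ m) ` S i = S j" for i j m
  proof -
    have "\<Phi> ` (\<phi> ^^ m) ` direct_factor {..<r} T i = \<Phi> ` direct_factor {..<r} T j"
      using pow[OF dfP] \<Phi>df that by simp
    then show ?thesis
      using inj_on_image_eq_iff[OF \<Phi>inj conjunct1[OF pow[OF dfP]] dfP] by (rule iffD1[rotated])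
  qed
  have permutes: "permutes_factors_transitively r T \<phi>"
    unfolding permutes_factors_transitively_def
  proof (intro conjI allI impI)
    fix i assume i: "i < r"
    then obtain j where "j < r" "?c ` S i = S j" using perm by blast
    then show "\<exists>j<r. \<phi> ` direct_factor {..<r} T i = direct_factor {..<r} T j"
      using df_eq[OF i, of j 1] by auto
  next
    fix i j assume ij: "i < r" "j < r"
    obtain k where "(?c ^^ k) ` S i = S j" using trans[OF ij] by blast
    then show "\<exists>m. (\<phi> ^^ m) ` direct_factor {..<r} T i = direct_factor {..<r} T j"
      by (intro exI[of _ k] df_eq[OF ij])
  qed
  have "aut_engel_subgroup ?P n \<phi> = carrier ?P"
    using hyp[unfolded engel_generates_simple_products_def, rule_format, OF r simple auto nt permutes n] .
  then have gen: "carrier ?P = generate ?P {aut_engel_comm ?P x \<phi> n |x. x \<in> carrier ?P}"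
    by (simp add: aut_engel_subgroup_def)
  \<comment> \<open>\<open>\<phi>\<close> corresponds to
    \<open>u \<mapsto> inv g \<otimes> u \<otimes> g\<close>, so \<open>\<Phi>\<close> sends
    \<open>inv u \<otimes> \<phi> u\<close> to the commutator of \<open>\<Phi> u\<close> with
    \<open>g\<close>, and this iterates.\<close>
  have comm: "aut_engel_comm ?P x \<phi> k \<in> carrier ?P \<and> \<Phi> (aut_engel_comm ?P x \<phi> k) = engel_comm G (\<Phi> x) g k"
    if x: "x \<in> carrier ?P" for x k
  proof (induction k)
    case (Suc k)
    let ?e = "aut_engel_comm ?P x \<phi> k"
    have e: "?e \<in> carrier ?P" "\<Phi> ?e = engel_comm G (\<Phi> x) g k"
      using conjunct1[OF Suc] conjunct2[OF Suc] .
    have i: "inv\<^bsub>?P\<^esub> ?e \<in> carrier ?P" using P.inv_closed[OF e(1)] .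
    have "\<Phi> (inv\<^bsub>?P\<^esub> ?e \<otimes>\<^bsub>?P\<^esub> \<phi> ?e) = inv (\<Phi> ?e) \<otimes> ?c (\<Phi> ?e)"
      using \<Phi>.hom_mult[OF i \<phi>(1)[OF e(1)]] \<Phi>.hom_inv[OF e(1)] \<phi>(2)[OF e(1)] by (simp only:)
    also have "\<dots> = group_comm G (\<Phi> ?e) g"
      using \<Phi>.hom_closed[OF e(1)] g by (simp add: group_comm_def m_assoc del: carrier_product_group)
    finally show ?case
      using P.m_closed[OF i \<phi>(1)[OF e(1)]] e(2) by (simp only: aut_engel_comm.simps engel_comm.simps)
  qed (use x in \<open>simp del: carrier_product_group\<close>)
  have "?W = \<Phi> ` generate ?P {aut_engel_comm ?P x \<phi> n |x. x \<in> carrier ?P}"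
    using \<Phi>im gen by simp
  also have "\<dots> = generate G (\<Phi> ` {aut_engel_comm ?P x \<phi> n |x. x \<in> carrier ?P})"
    by (rule \<Phi>.generate_img[symmetric]) (use comm in blast)
  also have "\<dots> \<subseteq> engel_subgroup G n g"
    unfolding engel_subgroup_def
    by (rule mono_generate) (use comm \<Phi>.hom_closed in blast)
  finally show ?thesis by (auto intro: generate.incl)
qed

lemma (in group) conj_nonabelian_simple:
  assumes g: "g \<in> carrier G" and Q: "subgroup Q G" "nonabelian_simple (G \<down> Q)"
  shows "nonabelian_simple ((G \<down> (\<lambda>x. g \<otimes> x \<otimes> inv g) ` Q))"
proof -
  let ?c = "\<lambda>x. g \<otimes> x \<otimes> inv g"
  interpret c: group_hom G G ?c using conj_hom[OF g] .
  interpret Q: group_hom "G \<down> Q" "G \<down> ?c ` Q" ?c using c.restrict_hom[OF Q(1)] .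
  have "inj_on ?c (carrier G)"
  proof (rule inj_onI)
    fix x y assume xy: "x \<in> carrier G" "y \<in> carrier G" and "?c x = ?c y"
    then have "inv g \<otimes> ?c x \<otimes> g = inv g \<otimes> ?c y \<otimes> g" by simp
    then show "x = y" using g xy by (simp add: m_assoc)
  qed
  then have "inj_on ?c Q" using subgroup.subset[OF Q(1)] by (rule inj_on_subset)
  then have "?c \<in> iso (G \<down> Q) (G \<down> ?c ` Q)"
    using Q.homh by (simp add: iso_def bij_betw_def)
  then show ?thesis using nonabelian_simple_iso[OF _ Q.G.is_group Q.H.is_group Q(2)] by blast
qed

text \<open>If \<open>g\<close> fails to centralize \<open>Q\<close>, then its action on the product
  of the conjugates of \<open>Q\<close> under powers of \<open>g\<close> is nontrivial and the orbit
  lemma applies. This includes the case that \<open>g\<close> normalizes \<open>Q\<close>, where the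
  orbit has length one.\<close>

lemma (in group) simple_component_engel:
  assumes hyp: engel_generates_simple_products
    and fin: "finite (carrier G)" and g: "g \<in> carrier G" and n: "1 \<le> n"
    and Q: "component G Q" "nonabelian_simple (G \<down> Q)"
  shows "Q \<subseteq> engel_subgroup G n g \<or> (\<forall>x\<in>Q. x \<otimes> g = g \<otimes> x)"
proof (rule disjCI)
  assume "\<not> (\<forall>x\<in>Q. x \<otimes> g = g \<otimes> x)"
  then obtain s where s: "s \<in> Q" "s \<otimes> g \<noteq> g \<otimes> s" by blast
  let ?c = "\<lambda>x. inv g \<otimes> x \<otimes> g"
  define S where "S = (\<lambda>i. (?c ^^ i) ` Q)"
  have ig: "inv g \<in> carrier G" using g by simp
  have cS: "?c ` S i = S (Suc i)" for i by (simp add: S_def image_comp)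
  have S0: "S 0 = Q" by (simp add: S_def)
  have SS: "component G (S i) \<and> nonabelian_simple (G \<down> S i)" for i
  proof (induction i)
    case 0
    show ?case using S0 Q by simp
  next
    case (Suc i)
    have "component G (?c ` S i)" using conj_component[OF fin conjunct1[OF Suc] ig] g by simp
    moreover have "nonabelian_simple (G \<down> ?c ` S i)"
      using conj_nonabelian_simple[OF ig componentD(1)[OF fin conjunct1[OF Suc]] conjunct2[OF Suc]] g by simp
    ultimately show ?case unfolding cS by blast
  qed
  have add: "(?c ^^ i) ` S j = S (i + j)" for i j by (simp add: S_def funpow_add image_comp)
  have cpow: "(?c ^^ i) x = inv (g [^] i) \<otimes> x \<otimes> g [^] i" if x: "x \<in> carrier G" for i :: nat and x
  proof (induction i)
    case (Suc i)
    have "g [^] Suc i = g [^] i \<otimes> g" by simp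
    then show ?case using Suc g x by (simp add: group_word)
  qed (use x in simp)
  have "(?c ^^ order G) x = x" if "x \<in> Q" for x
  proof -
    have x: "x \<in> carrier G" using subgroup.mem_carrier[OF componentD(1)[OF fin Q(1)] that] .
    show ?thesis using cpow[OF x] pow_order_eq_1[OF g] x by simp
  qed
  then have "S (order G) = Q" unfolding S_def by (simp add: image_def)
  moreover have "0 < order G" using order_gt_0_iff_finite fin by blast
  ultimately have ex: "\<exists>r. 0 < r \<and> S r = Q" by blast
  \<comment> \<open>The least period of \<open>Q\<close> under conjugation by \<open>g\<close>; one
    exists since \<open>g [^] order G\<close> is one. Minimality makes
    \<open>S 0, ..., S (r - 1)\<close> distinct, and they form the whole orbit.\<close>
  define r where "r = (LEAST r. 0 < r \<and> S r = Q)"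
  have r: "0 < r" "S r = Q" using LeastI_ex[OF ex] by (simp_all add: r_def)
  have least: "\<not> (0 < k \<and> S k = Q)" if "k < r" for k using not_less_Least that unfolding r_def by blast
  have per: "S (i + r) = S i" for i using add[of i r] r(2) by (simp add: S_def)
  have ne: "S i \<noteq> S j" if "i < j" "j < r" for i j
  proof
    assume "S i = S j"
    \<comment> \<open>After \<open>r - j\<close> further conjugations \<open>S j\<close> becomes
      \<open>S r = Q\<close>, so \<open>Q\<close> would already recur after
      \<open>r - j + i < r\<close> steps.\<close>
    then have "S (r - j + i) = S (r - j + j)" using add[of "r - j"] by metis
    then have "S (r - j + i) = Q" using that r(2) by simp
    moreover have "r - j + i < r" "0 < r - j + i" using that by linarith+
    ultimately show False using least[of "r - j + i"] by blast
  qed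
  have inj: "inj_on S {..<r}"
  proof (rule inj_onI)
    fix i j assume "i \<in> {..<r}" "j \<in> {..<r}" "S i = S j"
    then show "i = j" using ne[of i j] ne[of j i] by (metis lessThan_iff linorder_neqE_nat)
  qed
  have perm: "\<exists>j<r. ?c ` S i = S j" if "i < r" for i
  proof (cases "Suc i < r")
    case False
    then have "Suc i = r" using that by simp
    then have "?c ` S i = S 0" using cS r(2) S0 by simp
    then show ?thesis using r(1) by blast
  qed (use cS in blast)
  have trans: "\<exists>m. (?c ^^ m) ` S i = S j" if "i < r" "j < r" for i j
  proof
    \<comment> \<open>\<open>r - i\<close> steps lead from \<open>S i\<close> back to
      \<open>Q\<close>, and \<open>j\<close> more lead to \<open>S j\<close>; going round through
      \<open>Q\<close> keeps the exponent a natural number also for \<open>j < i\<close>.\<close>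
    have "r - i + j + i = j + r" using that by simp
    then show "(?c ^^ (r - i + j)) ` S i = S j" unfolding add by (simp only: per)
  qed
  have "(\<Union>i<r. S i) \<subseteq> engel_subgroup G n g"
    by (rule simple_orbit_engel[OF hyp fin g n _ conjunct1[OF SS] conjunct2[OF SS] inj perm trans r(1) _ s(2)])
      (use r(1) s(1) S0 in auto)
  then show "Q \<subseteq> engel_subgroup G n g" using S0 r(1) by blast
qed

section \<open>Descent along chief factors\<close>

text \<open>The Fitting subgroup of \<open>V\<close> is normal in \<open>G\<close>, so it is
  \<open>V\<close> or trivial. If it is \<open>V\<close>, then \<open>V\<close> is soluble and its
  derived subgroup is a smaller normal subgroup of \<open>G\<close>, hence trivial. Otherwise
  \<open>V\<close> has a simple component, and the simple components of \<open>G\<close> inside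
  \<open>V\<close> generate a nontrivial normal subgroup, which must be \<open>V\<close>.\<close>

lemma (in group) minimal_normal_cases:
  assumes fin: "finite (carrier G)" and V: "V \<lhd> G" "V \<noteq> {\<one>}"
    and min: "\<And>N. N \<lhd> G \<Longrightarrow> N \<subseteq> V \<Longrightarrow> N = {\<one>} \<or> N = V"
  shows "(\<forall>x\<in>V. \<forall>y\<in>V. x \<otimes> y = y \<otimes> x) \<or>
    V \<subseteq> generate G (\<Union>{Q. component G Q \<and> nonabelian_simple (G \<down> Q) \<and> Q \<subseteq> V})"
proof -
  have sV: "subgroup V G" using V(1) by (rule normal_imp_subgroup)
  interpret V: group "G \<down> V" using sV by (rule subgroup_imp_group)
  have finV: "finite (carrier (G \<down> V))" using finite_subgroup[OF sV fin] by simp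
  have nF: "fitting_subgroup (G \<down> V) \<lhd> G"
    unfolding fitting_subgroup_class
    by (rule class_radical_restrict_normal[OF fitting_class_nilpotent is_group fin V(1)])
  have FV: "fitting_subgroup (G \<down> V) \<subseteq> V"
    using subgroup.subset[OF radical_subgroup[OF radical_fitting V.is_group finV]] by simp
  from min[OF nF FV] show ?thesis
  proof
    assume F: "fitting_subgroup (G \<down> V) = V"
    then have "nilpotent_group (G \<down> V)"
      using fitting_greatest(2)[OF V.is_group finV] by simp
    then have "solvable (G \<down> V)" by (rule V.nilpotent_imp_solvable)
    then have "derived G V \<noteq> V" using perfect_not_solvable[OF sV _ V(2)] by blast
    moreover have "derived G V \<subseteq> V" using derived_incl[OF order_refl sV] .
    ultimately have "derived G V \<subseteq> {\<one>}" using min[OF derived_is_normal[OF V(1)]] by blast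
    then have "\<forall>x\<in>V. \<forall>y\<in>V. group_comm G x y \<in> {\<one>}"
      using derived_subset_iff[OF sV triv_subgroup] by blast
    then show ?thesis using group_comm_eq_one_iff subgroup.mem_carrier[OF sV] by blast
  next
    assume F: "fitting_subgroup (G \<down> V) = {\<one>}"
    have "carrier (G \<down> V) \<noteq> {\<one>\<^bsub>G \<down> V\<^esub>}" using V(2) by simp
    then obtain Q where Q: "component (G \<down> V) Q"
      using V.subnormal_socle_cases[OF finV] F by auto
    have QV: "Q \<subseteq> V" using subgroup.subset[OF V.componentD(1)[OF finV Q]] by simp
    have simple: "nonabelian_simple (G \<down> Q)"
      using V.component_nonabelian_simple[OF finV _ Q] F by simp
    have QG: "component G Q" using component_subnormal_trans[OF Q normal_imp_subnormal[OF V(1)]] .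
    note Q' = componentD[OF fin QG]
    let ?A = "\<Union>{Q. component G Q \<and> nonabelian_simple (G \<down> Q) \<and> Q \<subseteq> V}"
    have A: "?A \<subseteq> carrier G" using subgroup.subset[OF sV] by blast
    have "generate G ?A \<lhd> G"
    proof (rule normal_generateI[OF A])
      fix h k assume "h \<in> ?A" and k: "k \<in> carrier G"
      then obtain R where R: "component G R" "nonabelian_simple (G \<down> R)" "R \<subseteq> V" "h \<in> R" by blast
      let ?R = "(\<lambda>x. k \<otimes> x \<otimes> inv k) ` R"
      have "component G ?R" using conj_component[OF fin R(1) k] .
      moreover have "nonabelian_simple (G \<down> ?R)"
        using conj_nonabelian_simple[OF k componentD(1)[OF fin R(1)] R(2)] .
      moreover have "?R \<subseteq> V" using normal_conjD(1)[OF V(1) _ k] R(3) by blast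
      ultimately show "k \<otimes> h \<otimes> inv k \<in> ?A" using R(4) by blast
    qed
    moreover have "generate G ?A \<subseteq> V" by (rule generate_subgroup_incl[OF _ sV]) blast
    moreover have "Q \<subseteq> generate G ?A" using QG simple QV by (blast intro: generate.incl)
    then have "generate G ?A \<noteq> {\<one>}" using Q'(3) subgroup.one_closed[OF Q'(1)] by blast
    ultimately show ?thesis using min by blast
  qed
qed

text \<open>If \<open>C\<^sub>V(g) = 1\<close>, then \<open>v \<mapsto> [v, g]\<close> permutes \<open>V\<close>, and hence \<open>V\<close> consists of
  Engel commutators. Otherwise \<open>C\<^sub>V(g)\<close> normalizes \<open>L = \<langle>E\<^sub>n(g), g\<rangle>\<close> and meets it trivially, so
  it is central, and minimality of \<open>V\<close> makes \<open>L\<close> normal.\<close>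

lemma (in group) abelian_chief_step:
  assumes fin: "finite (carrier G)" and g: "g \<in> carrier G"
    and gen: "\<And>N. N \<lhd> G \<Longrightarrow> g \<in> N \<Longrightarrow> N = carrier G"
    and V: "V \<lhd> G" and min: "\<And>N. N \<lhd> G \<Longrightarrow> N \<subseteq> V \<Longrightarrow> N = {\<one>} \<or> N = V"
    and abel: "\<And>x y. x \<in> V \<Longrightarrow> y \<in> V \<Longrightarrow> x \<otimes> y = y \<otimes> x"
    and L: "L = generate G (engel_subgroup G n g \<union> {g})"
    and top: "generate G (L \<union> V) = carrier G"
  shows "L = carrier G"
proof -
  have EG: "engel_subgroup G n g \<union> {g} \<subseteq> carrier G"
    using subgroup.subset[OF engel_subgroup_subgroup[OF g]] g by blast
  have sL: "subgroup L G" unfolding L using EG by (rule generate_is_subgroup)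
  have sV: "subgroup V G" using V by (rule normal_imp_subgroup)
  have EL: "engel_subgroup G n g \<subseteq> L" "g \<in> L" unfolding L by (auto intro: generate.incl)
  have Lc: "x \<in> carrier G" if "x \<in> L" for x using subgroup.mem_carrier[OF sL that] .
  have Vc: "x \<in> carrier G" if "x \<in> V" for x using subgroup.mem_carrier[OF sV that] .
  have VL: "L = carrier G" if "V \<subseteq> L"
    using top generate_subgroup_incl[of "L \<union> V", OF _ sL] that subgroup.subset[OF sL] by blast
  have normal_of: "L = carrier G" if "V \<subseteq> normalizing G L"
  proof -
    have "generate G (L \<union> V) \<subseteq> normalizing G L"
      using generate_subgroup_incl[OF _ subgroup_normalizing[OF subgroup.subset[OF sL]]]
        that subgroup_subset_normalizing[OF sL] by blast
    then have "L \<lhd> G" using normal_of_normalizing[OF sL] top by blast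
    then show ?thesis using gen EL(2) by blast
  qed
  have sLV: "subgroup (L \<inter> V) G" using subgroups_Inter_pair[OF sL sV] .
  \<comment> \<open>\<open>L\<close> normalizes the intersection because \<open>V\<close> is normal,
    and \<open>V\<close> centralizes it because \<open>V\<close> is abelian. So it is normal in
    \<open>G = LV\<close>, and by minimality of \<open>V\<close> it is trivial or
    \<open>V\<close>.\<close>
  have "L \<union> V \<subseteq> normalizing G (L \<inter> V)"
  proof
    fix k assume k: "k \<in> L \<union> V"
    have kc: "k \<in> carrier G" using k Lc Vc by blast
    show "k \<in> normalizing G (L \<inter> V)"
    proof (cases "k \<in> L")
      case True
      then show ?thesis
        using kc normal_conjD[OF V _ kc] subgroup.m_closed[OF sL] subgroup.m_inv_closed[OF sL]
        by (simp add: normalizing_def)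
    next
      case False
      then have kV: "k \<in> V" using k by blast
      have "k \<otimes> x \<otimes> inv k = x" "inv k \<otimes> x \<otimes> k = x" if "x \<in> V" for x
        using abel[OF kV that] abel[OF subgroup.m_inv_closed[OF sV kV] that] kc Vc[OF that]
        by (simp_all add: m_assoc)
      then show ?thesis using kc by (simp add: normalizing_def)
    qed
  qed
  then have "generate G (L \<union> V) \<subseteq> normalizing G (L \<inter> V)"
    using generate_subgroup_incl[OF _ subgroup_normalizing[OF subgroup.subset[OF sLV]]] by blast
  then have "L \<inter> V \<lhd> G" using normal_of_normalizing[OF sLV] top by blast
  then have "L \<inter> V = {\<one>} \<or> L \<inter> V = V" using min by blast
  then show ?thesis
  proof
    assume "L \<inter> V = V"
    then show ?thesis using VL by blast
  next
    assume LV: "L \<inter> V = {\<one>}"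
    define C where "C = {v \<in> V. v \<otimes> g = g \<otimes> v}"
    have sC: "subgroup C G"
    proof -
      have "C = V \<inter> {x \<in> carrier G. \<forall>y\<in>{g}. x \<otimes> y = y \<otimes> x}" using Vc by (auto simp: C_def)
      then show ?thesis using subgroups_Inter_pair[OF sV subgroup_commute[of "{g}"]] g by simp
    qed
    have CV: "C \<subseteq> V" by (auto simp: C_def)
    have comm: "c \<otimes> x = x \<otimes> c" if c: "c \<in> C" and x: "x \<in> L \<union> V" for c x
    proof (cases "x \<in> V")
      case True
      then show ?thesis using abel c CV by blast
    next
      case False
      then have xL: "x \<in> L" using x by blast
      have cc: "c \<in> carrier G" using c CV Vc by blast
      have "c \<in> normalizing G L"
        unfolding L using centralizer_normalizing_engel[OF g cc] c by (simp add: C_def)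
      then have "inv c \<otimes> x \<otimes> c \<in> L" using xL by (simp add: normalizing_def)
      then have "inv x \<otimes> (inv c \<otimes> x \<otimes> c) \<in> L"
        using subgroup.m_closed[OF sL subgroup.m_inv_closed[OF sL xL]] by blast
      then have "group_comm G x c \<in> L" using Lc[OF xL] cc by (simp add: group_comm_def m_assoc)
      moreover have "group_comm G x c \<in> V" using normal_group_comm(2)[OF V Lc[OF xL]] c CV by blast
      ultimately have "group_comm G x c = \<one>" using LV by blast
      then show ?thesis using group_comm_eq_one_iff[OF Lc[OF xL] cc] by simp
    qed
    have cent: "c \<otimes> x = x \<otimes> c" if c: "c \<in> C" and x: "x \<in> carrier G" for c x
    proof (rule generate_commute[of C "L \<union> V"])
      show "C \<subseteq> carrier G" "L \<union> V \<subseteq> carrier G" using CV Vc Lc by blast+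
      show "c \<in> generate G C" using c by (rule generate.incl)
      show "x \<in> generate G (L \<union> V)" using x top by simp
    qed (rule comm)
    have "k \<otimes> c \<otimes> inv k = c" if "c \<in> C" "k \<in> carrier G" for k c
      using cent[OF that] that subgroup.mem_carrier[OF sC] by (metis inv_solve_right' m_closed)
    then have "C \<lhd> G" using sC by (simp add: normal_inv_iff)
    then have "C = {\<one>} \<or> C = V" using min CV by blast
    then show ?thesis
    proof
      assume "C = V"
      then have VC: "v \<otimes> x = x \<otimes> v" if "v \<in> V" "x \<in> carrier G" for v x using cent that by blast
      have "V \<subseteq> normalizing G L"
      proof
        fix v assume v: "v \<in> V"
        have "v \<otimes> x \<otimes> inv v = x" "inv v \<otimes> x \<otimes> v = x" if x: "x \<in> L" for x
          using VC[OF v Lc[OF x]] VC[OF subgroup.m_inv_closed[OF sV v] Lc[OF x]] Vc[OF v] Lc[OF x]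
          by (simp_all add: m_assoc)
        then show "v \<in> normalizing G L" using Vc[OF v] by (simp add: normalizing_def)
      qed
      then show ?thesis by (rule normal_of)
    next
      assume C1: "C = {\<one>}"
      let ?h = "\<lambda>v. group_comm G v g"
      have hV: "?h ` V \<subseteq> V" using normal_group_comm(1)[OF V g] by blast
      have "inj_on ?h V"
      proof (rule inj_onI)
        fix v w assume v: "v \<in> V" and w: "w \<in> V" and eq: "?h v = ?h w"
        note [simp] = Vc[OF v] Vc[OF w] g
        have wv: "w \<otimes> inv v \<in> V" using subgroup.m_closed[OF sV w subgroup.m_inv_closed[OF sV v]] .
        \<comment> \<open>The multipliers are chosen so that the left side collapses to
          \<open>g \<otimes> (w \<otimes> inv v)\<close> and the right side to
          \<open>(w \<otimes> inv v) \<otimes> g\<close>: equal commutators with \<open>g\<close>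
          put \<open>w \<otimes> inv v\<close> into \<open>C\<close>.\<close>
        have "g \<otimes> (w \<otimes> ?h v) \<otimes> inv g \<otimes> inv v \<otimes> g = g \<otimes> (w \<otimes> ?h w) \<otimes> inv g \<otimes> inv v \<otimes> g" using eq by simp
        then have "g \<otimes> (w \<otimes> inv v) = (w \<otimes> inv v) \<otimes> g" by (simp add: group_comm_def m_assoc)
        then have "w \<otimes> inv v \<in> C" using wv by (simp add: C_def)
        then have "w \<otimes> inv v = \<one>" using C1 by blast
        then have "w \<otimes> inv v \<otimes> v = v" by simp
        then show "v = w" by (simp add: m_assoc)
      qed
      then have surj: "?h ` V = V"
        using endo_inj_surj[OF finite_subgroup[OF sV fin] hV] by blast
      have "V = (\<lambda>v. engel_comm G v g k) ` V" for k
      proof (induction k)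
        case (Suc k)
        have "(\<lambda>v. engel_comm G v g (Suc k)) ` V = ?h ` (\<lambda>v. engel_comm G v g k) ` V"
          by (simp add: image_image)
        then show ?case using Suc surj by simp
      qed simp
      then have "V \<subseteq> {engel_comm G x g n |x. x \<in> carrier G}" using Vc by blast
      then have "V \<subseteq> engel_subgroup G n g"
        unfolding engel_subgroup_def by (blast intro: generate.incl)
      then show ?thesis using VL EL(1) by blast
    qed
  qed
qed

lemma (in group) chief_step:
  assumes hyp: engel_generates_simple_products and n: "1 \<le> n"
    and fin: "finite (carrier G)" and g: "g \<in> carrier G"
    and gen: "\<And>N. N \<lhd> G \<Longrightarrow> g \<in> N \<Longrightarrow> N = carrier G"
    and V: "V \<lhd> G" "V \<noteq> {\<one>}" and min: "\<And>N. N \<lhd> G \<Longrightarrow> N \<subseteq> V \<Longrightarrow> N = {\<one>} \<or> N = V"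
    and L: "L = generate G (engel_subgroup G n g \<union> {g})"
    and top: "generate G (L \<union> V) = carrier G"
  shows "L = carrier G"
  using minimal_normal_cases[OF fin V min]
proof
  assume "\<forall>x\<in>V. \<forall>y\<in>V. x \<otimes> y = y \<otimes> x"
  then show ?thesis
    by (intro abelian_chief_step[OF fin g _ V(1) _ _ L top]) (use gen min in blast)+
next
  let ?A = "\<Union>{Q. component G Q \<and> nonabelian_simple (G \<down> Q) \<and> Q \<subseteq> V}"
  assume VA: "V \<subseteq> generate G ?A"
  have EG: "engel_subgroup G n g \<union> {g} \<subseteq> carrier G"
    using subgroup.subset[OF engel_subgroup_subgroup[OF g]] g by blast
  have sL: "subgroup L G" unfolding L using EG by (rule generate_is_subgroup)
  have sN: "subgroup (normalizing G L) G" using subgroup_normalizing[OF subgroup.subset[OF sL]] .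
  have LN: "L \<subseteq> normalizing G L" using subgroup_subset_normalizing[OF sL] .
  have EL: "engel_subgroup G n g \<subseteq> L" "g \<in> L" unfolding L by (auto intro: generate.incl)
  have "?A \<subseteq> normalizing G L"
  proof
    fix x assume "x \<in> ?A"
    then obtain Q where Q: "component G Q" "nonabelian_simple (G \<down> Q)" "x \<in> Q" by blast
    have xc: "x \<in> carrier G" using subgroup.mem_carrier[OF componentD(1)[OF fin Q(1)] Q(3)] .
    from simple_component_engel[OF hyp fin g n Q(1,2)] show "x \<in> normalizing G L"
    proof
      assume "Q \<subseteq> engel_subgroup G n g"
      then show ?thesis using EL(1) LN Q(3) by blast
    next
      assume "\<forall>x\<in>Q. x \<otimes> g = g \<otimes> x"
      then show ?thesis unfolding L using centralizer_normalizing_engel[OF g xc] Q(3) by blast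
    qed
  qed
  then have "generate G ?A \<subseteq> normalizing G L" by (rule generate_subgroup_incl[OF _ sN])
  then have "generate G (L \<union> V) \<subseteq> normalizing G L"
    using VA LN by (intro generate_subgroup_incl[OF _ sN]) blast
  then have "L \<lhd> G" using normal_of_normalizing[OF sL] top by blast
  then show ?thesis using gen EL(2) by blast
qed

text \<open>Choose a normal \<open>N\<close> of least order with \<open>G = LN\<close>. If
  \<open>N\<close> is nontrivial, a normal subgroup \<open>M\<close> of \<open>G\<close> of greatest
  order properly inside \<open>N\<close> makes \<open>N/M\<close> minimal normal in
  \<open>G/M\<close>. Since \<open>L\<close> maps onto the corresponding subgroup for the image of
  \<open>g\<close>, \<open>chief_step\<close> in \<open>G/M\<close> gives \<open>G = LM\<close>,
  against the choice of \<open>N\<close>.\<close>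

lemma (in group) engel_subgroup_generate:
  assumes hyp: engel_generates_simple_products and n: "1 \<le> n"
    and fin: "finite (carrier G)" and g: "g \<in> carrier G"
    and gen: "\<And>N. N \<lhd> G \<Longrightarrow> g \<in> N \<Longrightarrow> N = carrier G"
  shows "generate G (engel_subgroup G n g \<union> {g}) = carrier G"
proof -
  define L where "L = generate G (engel_subgroup G n g \<union> {g})"
  have EG: "engel_subgroup G n g \<union> {g} \<subseteq> carrier G"
    using subgroup.subset[OF engel_subgroup_subgroup[OF g]] g by blast
  have sL: "subgroup L G" unfolding L_def using EG by (rule generate_is_subgroup)
  have LG: "L \<subseteq> carrier G" using sL by (rule subgroup.subset)
  let ?P = "\<lambda>N. N \<lhd> G \<and> generate G (L \<union> N) = carrier G"
  have "generate G (L \<union> carrier G) = carrier G"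
    using generate_incl[of "L \<union> carrier G"] LG generate.incl[of _ "L \<union> carrier G" G] by blast
  then have "?P (carrier G)" using normal_self by blast
  then obtain N where N: "?P N" "\<And>M. ?P M \<Longrightarrow> card N \<le> card M"
    using ex_has_least_nat[of ?P "carrier G" card] by blast
  have nN: "N \<lhd> G" and topN: "generate G (L \<union> N) = carrier G" using N(1) by blast+
  have sN: "subgroup N G" using nN by (rule normal_imp_subgroup)
  have NG: "N \<subseteq> carrier G" using sN by (rule subgroup.subset)
  have finN: "finite N" using finite_subset[OF NG fin] .
  have "N = {\<one>}"
  proof (rule ccontr)
    assume ne: "N \<noteq> {\<one>}"
    let ?R = "\<lambda>M. M \<lhd> G \<and> M \<subset> N"
    have "?R {\<one>}" using one_is_normal ne subgroup.one_closed[OF sN] by blast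
    moreover have "\<forall>M. ?R M \<longrightarrow> card M < card N" using psubset_card_mono[OF finN] by blast
    ultimately obtain M where M: "?R M" "\<And>M'. ?R M' \<Longrightarrow> card M' \<le> card M"
      using ex_has_greatest_nat[of ?R "{\<one>}" card "card N"] by blast
    interpret M: normal M G using M(1) by blast
    interpret q: group_hom G "G Mod M" "\<lambda>x. M #> x" by (rule M.quotient_hom)
    let ?q = "\<lambda>x. M #> x"
    have finQ: "finite (carrier (G Mod M))" using fin by (rule M.finite_quotient)
    have max: "P = M \<or> P = N" if P: "P \<lhd> G" "M \<subseteq> P" "P \<subseteq> N" for P
    proof (rule ccontr)
      assume c: "\<not> (P = M \<or> P = N)"
      then have "?R P" using P by blast
      then have "card P \<le> card M" by (rule M(2))
      moreover have "card M < card P"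
        using c P finite_subset[OF P(3) finN] by (intro psubset_card_mono) auto
      ultimately show False by simp
    qed
    have "?q ` N \<noteq> {M}"
    proof
      assume "?q ` N = {M}"
      then have "x \<in> M" if "x \<in> N" for x
        using M.coset_eq_self_iff[OF subsetD[OF NG that]] that by blast
      then show False using M(1) by blast
    qed
    then have ntV: "?q ` N \<noteq> {\<one>\<^bsub>G Mod M\<^esub>}" by simp
    have pre: "M \<subseteq> {x \<in> carrier G. ?q x \<in> P} \<and> P = ?q ` {x \<in> carrier G. ?q x \<in> P}" if P: "P \<lhd> G Mod M" for P
    proof
      have sP: "subgroup P (G Mod M)" using P by (rule normal_imp_subgroup)
      have "M \<in> P" using subgroup.one_closed[OF sP] by simp
      then show "M \<subseteq> {x \<in> carrier G. ?q x \<in> P}"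
        using M.coset_eq_self_iff[OF subsetD[OF M.subset]] M.subset by (simp add: subset_iff)
      show "P = ?q ` {x \<in> carrier G. ?q x \<in> P}"
        using subgroup.subset[OF sP] unfolding M.quotient_surj[symmetric] by blast
    qed
    have gen': "P = carrier (G Mod M)" if P: "P \<lhd> G Mod M" "?q g \<in> P" for P
    proof -
      have "{x \<in> carrier G. ?q x \<in> P} = carrier G"
        by (rule gen[OF q.preimage_normal[OF P(1)]]) (use g P(2) in simp)
      then show ?thesis using pre[OF P(1)] M.quotient_surj by simp
    qed
    have min': "P = {\<one>\<^bsub>G Mod M\<^esub>} \<or> P = ?q ` N" if P: "P \<lhd> G Mod M" "P \<subseteq> ?q ` N" for P
    proof -
      let ?P' = "{x \<in> carrier G. ?q x \<in> P}"
      have "x \<in> N" if x: "x \<in> carrier G" "?q x \<in> P" for x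
      proof -
        obtain y where y: "y \<in> N" "?q x = ?q y" using x(2) P(2) by blast
        have yc: "y \<in> carrier G" using y(1) NG by blast
        have "x \<otimes> inv y \<in> N" using M.coset_eq_iff[OF x(1) yc] y(2) M(1) by blast
        then have "x \<otimes> inv y \<otimes> y \<in> N" using subgroup.m_closed[OF sN _ y(1)] by blast
        then show ?thesis using x(1) yc by (simp add: m_assoc)
      qed
      then have "?P' = M \<or> ?P' = N"
        using max[OF q.preimage_normal[OF P(1)]] pre[OF P(1)] by blast
      moreover have "P = {M}" if "?P' = M"
      proof -
        have "?q x = M" if "x \<in> M" for x using M.coset_eq_self_iff that M.subset by blast
        then have "?q ` M = {M}" using M.one_closed by blast
        then show ?thesis using pre[OF P(1)] that by simp
      qed
      ultimately show ?thesis using pre[OF P(1)] by auto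
    qed
    have Lq: "?q ` L = generate (G Mod M) (engel_subgroup (G Mod M) n (?q g) \<union> {?q g})"
      unfolding L_def using q.generate_img[OF EG] q.engel_subgroup_image[OF M.quotient_surj g, of n]
      by (simp add: image_Un)
    have "generate (G Mod M) (?q ` L \<union> ?q ` N) = ?q ` generate G (L \<union> N)"
      using q.generate_img[of "L \<union> N"] LG NG by (simp add: image_Un)
    then have top': "generate (G Mod M) (?q ` L \<union> ?q ` N) = carrier (G Mod M)"
      using topN M.quotient_surj by simp
    have all: "?q ` L = carrier (G Mod M)"
      by (rule q.H.chief_step[OF hyp n finQ q.hom_closed[OF g] gen' M.image_in_quotient_normal[OF nN] ntV min' Lq top'])
    have "carrier G \<subseteq> generate G (L \<union> M)"
    proof
      fix x assume x: "x \<in> carrier G"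
      then have "?q x \<in> ?q ` L" using all q.hom_closed by simp
      then obtain l where l: "l \<in> L" "?q x = ?q l" by blast
      have lc: "l \<in> carrier G" using l(1) LG by blast
      have "x \<otimes> inv l \<in> M" using M.coset_eq_iff[OF x lc] l(2) by blast
      then have "x \<otimes> inv l \<otimes> l \<in> generate G (L \<union> M)"
        by (intro generate.eng generate.incl UnI2 UnI1[OF l(1)])
      then show "x \<in> generate G (L \<union> M)" using x lc by (simp add: m_assoc)
    qed
    then have "?P M" using generate_incl[of "L \<union> M"] LG M.subset M.normal_axioms by blast
    then have "card N \<le> card M" by (rule N(2))
    moreover have "card M < card N" using M(1) finN by (intro psubset_card_mono) auto
    ultimately show False by simp
  qed
  then have "generate G (L \<union> {\<one>}) = carrier G" using topN by simp
  moreover have "L \<union> {\<one>} = L" using subgroup.one_closed[OF sL] by blast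
  ultimately show ?thesis
    using generate_subgroup_incl[OF order_refl sL] LG unfolding L_def by simp
qed

section \<open>From \<open>E\<close> up to \<open>K\<close> and into \<open>G\<close>\<close>

lemma (in group) abelian_quotient:
  assumes N: "N \<lhd> G" and comm: "\<And>x y. x \<in> carrier G \<Longrightarrow> y \<in> carrier G \<Longrightarrow> group_comm G x y \<in> N"
  shows "comm_group (G Mod N)"
proof -
  interpret N: normal N G by fact
  interpret q: group_hom G "G Mod N" "\<lambda>x. N #> x" by (rule N.quotient_hom)
  show ?thesis
  proof (rule q.H.group_comm_groupI)
    fix u v assume "u \<in> carrier (G Mod N)" "v \<in> carrier (G Mod N)"
    then obtain x y where x: "x \<in> carrier G" "u = N #> x" and y: "y \<in> carrier G" "v = N #> y"
      unfolding N.quotient_surj[symmetric] by blast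
    have "N #> group_comm G x y = N"
      using N.coset_eq_self_iff[of "group_comm G x y"] comm[OF x(1) y(1)] x(1) y(1) by simp
    then have "group_comm (G Mod N) (N #> x) (N #> y) = \<one>\<^bsub>G Mod N\<^esub>"
      using q.hom_group_comm[OF x(1) y(1)] by simp
    then show "u \<otimes>\<^bsub>G Mod N\<^esub> v = v \<otimes>\<^bsub>G Mod N\<^esub> u"
      using q.H.group_comm_eq_one_iff[of u v] q.hom_closed[OF x(1)] q.hom_closed[OF y(1)]
      unfolding x(2) y(2) by blast
  qed
qed

text \<open>An abelian quotient is nilpotent and thus its own Fitting subgroup, so one more layer
  reaches the top. This layer is the \<open>+ 1\<close> in the height bound.\<close>

lemma ext_gen_fitting_abelian:
  assumes \<rho>: "radical \<rho>" and G: "group G" "finite (carrier G)"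
    and comm: "\<And>x y. x \<in> carrier G \<Longrightarrow> y \<in> carrier G \<Longrightarrow> group_comm G x y \<in> \<rho> G"
  shows "carrier G \<subseteq> ext_radical \<rho> gen_fitting_subgroup G"
proof -
  interpret group G by fact
  interpret R: normal "\<rho> G" G using radical_normal[OF \<rho> G] .
  interpret Q: group "G Mod \<rho> G" by (rule R.factorgroup_is_group)
  have fin: "finite (carrier (G Mod \<rho> G))" using G(2) by (rule R.finite_quotient)
  have "nilpotent_group (((G Mod \<rho> G) \<down> carrier (G Mod \<rho> G)))"
    using comm_group.comm_group_nilpotent[OF abelian_quotient[OF R.normal_axioms comm]] by simp
  then have "carrier (G Mod \<rho> G) \<subseteq> gen_fitting_subgroup (G Mod \<rho> G)"
    using fitting_greatest(3)[OF Q.is_group fin Q.normal_self] Q.subset_gen_fitting(1)[OF fin] by blast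
  then show ?thesis unfolding R.quotient_surj[symmetric] ext_radical_def by blast
qed

text \<open>The counterpart for the nonsoluble length: an abelian quotient is soluble and is
  absorbed by \<open>\<rho>\<close> itself, so the index does not grow.\<close>

lemma solvable_closed_abelian:
  assumes \<rho>: "radical \<rho>" "solvable_closed \<rho>" and G: "group G" "finite (carrier G)"
    and comm: "\<And>x y. x \<in> carrier G \<Longrightarrow> y \<in> carrier G \<Longrightarrow> group_comm G x y \<in> \<rho> G"
  shows "carrier G \<subseteq> \<rho> G"
proof -
  interpret group G by fact
  interpret R: normal "\<rho> G" G using radical_normal[OF \<rho>(1) G] .
  have "solvable (G Mod \<rho> G)"
    using group.nilpotent_imp_solvable[OF R.factorgroup_is_group]
      comm_group.comm_group_nilpotent[OF abelian_quotient[OF R.normal_axioms comm]] by blast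
  then show ?thesis
    using solvable_closedD[OF \<rho>(2) G normal_self R.normal_axioms R.subset order_refl] by simp
qed

lemma (in group) engel_subgroup_subnormal:
  assumes hyp: engel_generates_simple_products and n: "1 \<le> n"
    and fin: "finite (carrier G)" and g: "g \<in> carrier G"
  obtains K E where "subnormal G K" "g \<in> K" "E \<lhd> (G \<down> K)"
    "\<And>x y. x \<in> K \<Longrightarrow> y \<in> K \<Longrightarrow> group_comm (G \<down> K) x y \<in> E"
    "E \<subseteq> engel_subgroup G n g"
proof -
  let ?P = "\<lambda>K. subnormal G K \<and> g \<in> K"
  have "?P (carrier G)" using g subnormal.self by blast
  then obtain K where K: "?P K" "\<And>N. ?P N \<Longrightarrow> card K \<le> card N"
    using ex_has_least_nat[of ?P "carrier G" card] by blast
  have sK: "subgroup K G" using K(1) subnormal_imp_subgroup by blast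
  have finK: "finite K" using finite_subgroup[OF sK fin] .
  let ?K = "G \<down> K"
  interpret K: group ?K using sK by (rule subgroup_imp_group)
  have gK: "g \<in> carrier ?K" using K(1) by simp
  let ?E = "engel_subgroup ?K n g"
  have gen: "N = carrier ?K" if N: "N \<lhd> ?K" "g \<in> N" for N
  proof -
    have "subnormal G N" using subnormal.step[OF _ N(1)] K(1) by blast
    then have "card K \<le> card N" using K(2) N(2) by blast
    moreover have "N \<subseteq> K" using normal_restrict_iff[OF sK] N(1) by blast
    ultimately show ?thesis using card_seteq[OF finK] by auto
  qed
  have top: "generate ?K (?E \<union> {g}) = carrier ?K"
    by (rule K.engel_subgroup_generate[OF hyp n _ gK gen]) (use finK in simp)
  have sE: "subgroup ?E ?K" using K.engel_subgroup_subgroup[OF gK] .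
  have "inv\<^bsub>?K\<^esub> g \<otimes>\<^bsub>?K\<^esub> g = g \<otimes>\<^bsub>?K\<^esub> inv\<^bsub>?K\<^esub> g" using K.l_inv[OF gK] K.r_inv[OF gK] by (simp only:)
  \<comment> \<open>\<open>g\<close> commutes with itself and with its inverse, so conjugation by
    either preserves \<open>?E\<close>. As \<open>?E\<close> and \<open>g\<close> generate
    \<open>K\<close>, this makes \<open>?E\<close> normal in \<open>K\<close>.\<close>
  from K.engel_subgroup_conj[OF gK gK refl] K.engel_subgroup_conj[OF gK K.inv_closed[OF gK] this]
  have "g \<in> normalizing ?K ?E"
    unfolding normalizing_def K.inv_inv[OF gK] using gK by blast
  then have "?E \<union> {g} \<subseteq> normalizing ?K ?E" using K.subgroup_subset_normalizing[OF sE] by blast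
  then have "carrier ?K \<subseteq> normalizing ?K ?E"
    using K.generate_subgroup_incl[OF _ K.subgroup_normalizing[OF subgroup.subset[OF sE]]] top by blast
  then have nE: "?E \<lhd> ?K" using K.normal_of_normalizing[OF sE] by blast
  have EgK: "?E \<union> {g} \<subseteq> carrier ?K" using subgroup.subset[OF sE] gK by blast
  \<comment> \<open>Modulo \<open>?E\<close> the generating set \<open>?E \<union> {g}\<close>
    shrinks to the identity and the image of \<open>g\<close>, which commute; hence \<open>K\<close>
    is abelian modulo \<open>?E\<close>.\<close>
  have "group_comm ?K a b \<in> ?E" if a: "a \<in> ?E \<union> {g}" and b: "b \<in> ?E \<union> {g}" for a b
  proof -
    have ab: "a \<in> carrier ?K" "b \<in> carrier ?K" using a b EgK by blast+
    have "group_comm ?K g g = \<one>\<^bsub>?K\<^esub>" using K.group_comm_eq_one_iff[OF gK gK] by blast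
    then have "group_comm ?K g g \<in> ?E" using subgroup.one_closed[OF sE] by (simp only:)
    then show ?thesis
      using a b K.normal_group_comm(1)[OF nE ab(2), of a] K.normal_group_comm(2)[OF nE ab(1), of b] by blast
  qed
  then have comm: "group_comm ?K x y \<in> ?E" if "x \<in> K" "y \<in> K" for x y
    using K.group_comm_generate[OF nE EgK EgK] that top by simp
  show ?thesis
    by (rule that[OF _ _ nE comm engel_subgroup_restrict[OF sK]]) (use K(1) in blast)+
qed

text \<open>\<open>E\<close> is subnormal in \<open>G\<close>, hence also in \<open>M\<close>,
  although \<open>M\<close> itself need not be subnormal in \<open>G\<close>. Computed inside
  \<open>M\<close> the radical of \<open>E\<close> is all of \<open>E\<close>; computed inside
  \<open>K\<close> it is the intersection of \<open>E\<close> with the radical of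
  \<open>K\<close>.\<close>

lemma (in group) radical_engel_kernel:
  assumes \<rho>: "radical \<rho>" and fin: "finite (carrier G)" and K: "subnormal G K" "E \<lhd> (G \<down> K)"
    and M: "subgroup M G" "E \<subseteq> M" "\<rho> (G \<down> M) = M"
  shows "E \<subseteq> \<rho> (G \<down> K)"
proof -
  have sK: "subgroup K G" using K(1) by (rule subnormal_imp_subgroup)
  interpret K: group "G \<down> K" using sK by (rule subgroup_imp_group)
  interpret M: group "G \<down> M" using M(1) by (rule subgroup_imp_group)
  have fK: "finite (carrier (G \<down> K))" "finite (carrier (G \<down> M))"
    using finite_subgroup[OF sK fin] finite_subgroup[OF M(1) fin] by simp_all
  have "subnormal (G \<down> M) E"
    using subnormal_restrict[OF subnormal.step[OF K] M(1,2)] .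
  then have "\<rho> (G \<down> E) = E \<inter> M"
    using radical_restrict_subnormal[OF \<rho> M.is_group fK(2)] M(3) by simp
  moreover have "\<rho> (G \<down> E) = E \<inter> \<rho> (G \<down> K)"
    using radical_restrict[OF \<rho> K.is_group fK(1) K(2)] by simp
  ultimately show ?thesis using M(2) by blast
qed

theorem theorem7p5:
  fixes G :: "('a, 'b) monoid_scheme" and g :: 'a and n :: nat
  assumes
    "\<forall>(r :: nat) (T :: nat \<Rightarrow> nat monoid) \<phi> (m :: nat).
       1 \<le> r \<longrightarrow>
       (\<forall>i<r. nonabelian_simple (T i)) \<longrightarrow>
       \<phi> \<in> auto (product_group {..<r} T) \<longrightarrow>
       (\<exists>x\<in>carrier (product_group {..<r} T). \<phi> x \<noteq> x) \<longrightarrow>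
       permutes_factors_transitively r T \<phi> \<longrightarrow>
       1 \<le> m \<longrightarrow>
       aut_engel_subgroup (product_group {..<r} T) m \<phi> = carrier (product_group {..<r} T)"
    and "group G" and "finite (carrier G)" and "g \<in> carrier G" and "1 \<le> n"
  shows "(\<forall>k. gen_fitting_height (G\<lparr>carrier := engel_subgroup G n g\<rparr>) = k
                \<longrightarrow> g \<in> gen_fitting_series G (k + 1)) \<and>
         (\<forall>k. nonsoluble_length (G\<lparr>carrier := engel_subgroup G n g\<rparr>) = k
                \<longrightarrow> g \<in> nonsoluble_radical G k)"
proof -
  interpret group G by fact
  note G = assms(2,3)
  have hyp: engel_generates_simple_products
    using assms(1) unfolding engel_generates_simple_products_def .
  let ?M = "engel_subgroup G n g"
  obtain K E where K: "subnormal G K" "g \<in> K" "E \<lhd> (G \<down> K)"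
    and comm: "\<And>x y. x \<in> K \<Longrightarrow> y \<in> K \<Longrightarrow> group_comm (G \<down> K) x y \<in> E"
    and EM: "E \<subseteq> ?M"
    using engel_subgroup_subnormal[OF hyp assms(5,3,4)] by blast
  have sK: "subgroup K G" using K(1) by (rule subnormal_imp_subgroup)
  have sM: "subgroup ?M G" using engel_subgroup_subgroup[OF assms(4)] .
  interpret K: group "G \<down> K" using sK by (rule subgroup_imp_group)
  interpret M: group "G \<down> ?M" using sM by (rule subgroup_imp_group)
  have fK: "finite (carrier (G \<down> K))" "finite (carrier (G \<down> ?M))"
    using finite_subgroup[OF sK G(2)] finite_subgroup[OF sM G(2)]
    by simp_all
  note kernel = radical_engel_kernel[OF _ G(2) K(1,3) sM EM]
  have 1: "g \<in> gen_fitting_series G (k + 1)" if k: "gen_fitting_height (G \<down> ?M) = k" for k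
  proof -
    have "gen_fitting_series (G \<down> ?M) k = ?M"
      using gen_fitting_height_series[OF M.is_group fK(2)] k by simp
    then have "E \<subseteq> gen_fitting_series (G \<down> K) k"
      using kernel[OF radical_gen_fitting_series] by blast
    then have "carrier (G \<down> K)
        \<subseteq> ext_radical (\<lambda>G. gen_fitting_series G k) gen_fitting_subgroup (G \<down> K)"
      using comm by (intro ext_gen_fitting_abelian[OF radical_gen_fitting_series K.is_group fK(1)]) auto
    then have "K \<subseteq> gen_fitting_series (G \<down> K) (k + 1)" by (simp add: ext_radical_def)
    then show ?thesis
      using radical_restrict_subnormal[OF radical_gen_fitting_series G K(1), of "k + 1"] K(2) by blast
  qed
  have 2: "g \<in> nonsoluble_radical G k" if k: "nonsoluble_length (G \<down> ?M) = k" for k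
  proof -
    have "nonsoluble_series k (G \<down> ?M) = ?M"
      using nonsoluble_length_le_iff[OF M.is_group fK(2), of k] k by simp
    then have "E \<subseteq> nonsoluble_series k (G \<down> K)"
      using kernel[OF radical_nonsoluble_series] by blast
    then have "carrier (G \<down> K) \<subseteq> nonsoluble_series k (G \<down> K)"
      using comm by (intro solvable_closed_abelian[OF radical_nonsoluble_series
            solvable_closed_nonsoluble_series K.is_group fK(1)]) auto
    then show ?thesis
      using radical_restrict_subnormal[OF radical_nonsoluble_series G K(1), of k] K(2)
        nonsoluble_radical_eq[OF G] by auto
  qed
  from 1 2 show ?thesis by blast
qed

end
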